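(* Let $d\Gamma$ be a probability measure on $\mathbb{D}^\infty=\prod_{j=0}^\infty\mathbb{D}$ giving the joint distribution of random Verblunsky coefficients $\alpha=\{\alpha_j\}_{j=0}^\infty$, let $\mathbb{E}$ denote expectation with respect to $d\Gamma$, and let $\mathcal{C}=\mathcal{C}(\alpha)$ be the associated random CMV matrix. Suppose that $d\Gamma$ is strongly quasi-invariant and that for some $p$ with $0<p<1$, some $\kappa_1>0$ and some constant $C_1$, $$\mathbb{E}\biggl(\int_0^{2\pi}|F_{k\ell}(e^{i\theta})|^p\,\frac{d\theta}{2\pi}\biggr)\le C_1e^{-\kappa_1|k-\ell|}\qquad\text{for all } k,\ell\in\{0,1,2,\dots\}.$$ Then there exist $\kappa_2>0$ and a constant $C_2$ such that $$\mathbb{E}\Bigl(\sup_{n\in\mathbb{Z}}|(\mathcal{C}^n)_{k\ell}|\Bigr)\le C_2e^{-\kappa_2|k-\ell|}\qquad\text{for all } k,\ell\in\{0,1,2,\dots\}.$$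
   Context: $\mathbb{D}=\{z\in\mathbb{C}:|z|<1\}$ and $\partial\mathbb{D}$ is the unit circle. CMV matrix: for $\alpha\in\mathbb{D}$ let $\rho=(1-|\alpha|^2)^{1/2}$ and $\Theta(\alpha)=\begin{pmatrix}\bar\alpha&\rho\\ \rho&-\alpha\end{pmatrix}$. For a sequence $\alpha=\{\alpha_j\}_{j=0}^\infty\in\mathbb{D}^\infty$ define the unitary operators on $\ell^2(\{0,1,2,\dots\})$, written as matrices in the standard basis $\{\delta_j\}_{j=0}^\infty$, $$\mathcal{L}(\alpha)=\Theta(\alpha_0)\oplus\Theta(\alpha_2)\oplus\Theta(\alpha_4)\oplus\cdots,\qquad \mathcal{M}(\alpha)=\mathbf{1}_1\oplus\Theta(\alpha_1)\oplus\Theta(\alpha_3)\oplus\cdots,$$ where $\mathbf{1}_1$ is the $1\times1$ identity matrix. The CMV matrix is $\mathcal{C}(\alpha)=\mathcal{L}(\alpha)\mathcal{M}(\alpha)$, a unitary operator. For $z\in\mathbb{D}$, $F_{k\ell}(z)=\bigl[(\mathcal{C}+z)(\mathcal{C}-z)^{-1}\bigr]_{k\ell}$, and $F_{k\ell}(e^{i\theta})=\lim_{r\uparrow1}F_{k\ell}(re^{i\theta})$, which exists for Lebesgue-a.e. $\theta$ (and $F_{k\ell}$ lies in the Hardy space $H^p(\mathbb{D})$ for all $0<p<1$). Strong quasi-invariance: for $n=0,1,2,\dots$ and $\lambda\in\partial\mathbb{D}$ define $T_{n,\lambda}:\mathbb{D}^\infty\to\mathbb{D}^\infty$ by $(T_{n,\lambda}(\alpha))_j=\alpha_j$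 for $0\le j\le n-1$ and $(T_{n,\lambda}(\alpha))_j=\lambda\alpha_j$ for $j\ge n$. Let $d\Gamma_{n,\lambda}(\alpha)=d\Gamma(T_{n,\lambda}(\alpha))$, i.e. $\Gamma_{n,\lambda}(A)=\Gamma(T_{n,\lambda}(A))$ for Borel $A$. The measure $d\Gamma$ is called strongly quasi-invariant if every $d\Gamma_{n,\lambda}$ is absolutely continuous with respect to $d\Gamma$ and $\sup_{n,\lambda}\|d\Gamma_{n,\lambda}/d\Gamma\|_{L^\infty(d\Gamma)}<\infty$. *)

theory Defs
  imports "HOL-Probability.Probability"
begin

section \<open>CMV matrices\<close>

definition rho :: "complex \<Rightarrow> real" where
  "rho a = sqrt (1 - (cmod a)\<^sup>2)"

text \<open>The entries of the \<open>2 \<times> 2\<close> matrix are indexed by \<open>0, 1\<close>.\<close>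

definition Theta :: "complex \<Rightarrow> nat \<Rightarrow> nat \<Rightarrow> complex" where
  "Theta a i j =
     (if i = 0 \<and> j = 0 then cnj a
      else if i = 1 \<and> j = 1 then - a
      else complex_of_real (rho a))"

text \<open>
  The direct sums: block \<open>m\<close> of \<open>L\<close> occupies the indices \<open>2m, 2m + 1\<close> and is
  \<open>\<Theta>(\<alpha>\<^sub>2\<^sub>m)\<close>; apart from the entry \<open>1\<close> at \<open>(0, 0)\<close>, block \<open>m\<close> of \<open>M\<close> occupies the
  indices \<open>2m + 1, 2m + 2\<close> and is \<open>\<Theta>(\<alpha>\<^sub>2\<^sub>m\<^sub>+\<^sub>1)\<close>.
\<close>

definition L_mat :: "(nat \<Rightarrow> complex) \<Rightarrow> nat \<Rightarrow> nat \<Rightarrow> complex" where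
  "L_mat \<alpha> i j =
     (if i div 2 = j div 2 then Theta (\<alpha> (2 * (i div 2))) (i mod 2) (j mod 2) else 0)"

definition M_mat :: "(nat \<Rightarrow> complex) \<Rightarrow> nat \<Rightarrow> nat \<Rightarrow> complex" where
  "M_mat \<alpha> i j =
     (if i = 0 \<or> j = 0 then (if i = j then 1 else 0)
      else if (i - 1) div 2 = (j - 1) div 2
        then Theta (\<alpha> (2 * ((i - 1) div 2) + 1)) ((i - 1) mod 2) ((j - 1) mod 2)
      else 0)"

definition ell2 :: "(nat \<Rightarrow> complex) set" where
  "ell2 = {x. summable (\<lambda>j. (cmod (x j))\<^sup>2)}"

definition basis_vec :: "nat \<Rightarrow> nat \<Rightarrow> complex" where
  "basis_vec l = (\<lambda>j. if j = l then 1 else 0)"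

text \<open>
  Matrices act on sequences row by row; for \<open>L\<close> and \<open>M\<close> every row has at most two
  nonzero entries, so the series below are finite sums.
\<close>

definition mat_op :: "(nat \<Rightarrow> nat \<Rightarrow> complex) \<Rightarrow> (nat \<Rightarrow> complex) \<Rightarrow> (nat \<Rightarrow> complex)" where
  "mat_op A x = (\<lambda>i. \<Sum>j. A i j * x j)"

definition cmv :: "(nat \<Rightarrow> complex) \<Rightarrow> (nat \<Rightarrow> complex) \<Rightarrow> (nat \<Rightarrow> complex)" where
  "cmv \<alpha> = mat_op (L_mat \<alpha>) \<circ> mat_op (M_mat \<alpha>)"

text \<open>
  Inverses are taken as operators on \<open>\<ell>\<^sup>2\<close>, hence \<open>inv_into ell2\<close>; on the space of all
  sequences \<open>cmv \<alpha> - z\<close> need not be injective.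
\<close>

definition cmv_resolvent ::
    "(nat \<Rightarrow> complex) \<Rightarrow> complex \<Rightarrow> (nat \<Rightarrow> complex) \<Rightarrow> (nat \<Rightarrow> complex)" where
  "cmv_resolvent \<alpha> z = inv_into ell2 (\<lambda>x j. cmv \<alpha> x j - z * x j)"

definition cmv_power ::
    "(nat \<Rightarrow> complex) \<Rightarrow> int \<Rightarrow> (nat \<Rightarrow> complex) \<Rightarrow> (nat \<Rightarrow> complex)" where
  "cmv_power \<alpha> n =
     (if n \<ge> 0 then cmv \<alpha> ^^ nat n else inv_into ell2 (cmv \<alpha>) ^^ nat (- n))"

definition cmv_power_entry :: "(nat \<Rightarrow> complex) \<Rightarrow> int \<Rightarrow> nat \<Rightarrow> nat \<Rightarrow> complex" where
  "cmv_power_entry \<alpha> n k l = cmv_power \<alpha> n (basis_vec l) k"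

definition carF :: "(nat \<Rightarrow> complex) \<Rightarrow> nat \<Rightarrow> nat \<Rightarrow> complex \<Rightarrow> complex" where
  "carF \<alpha> k l z =
     (let y = cmv_resolvent \<alpha> z (basis_vec l) in cmv \<alpha> y k + z * y k)"

text \<open>
  The radial boundary value. It exists for almost every \<open>\<theta>\<close>; elsewhere \<open>Lim\<close> returns an
  unspecified constant.
\<close>

definition carF_bdry :: "(nat \<Rightarrow> complex) \<Rightarrow> nat \<Rightarrow> nat \<Rightarrow> real \<Rightarrow> complex" where
  "carF_bdry \<alpha> k l \<theta> = Lim (at_left 1) (\<lambda>r. carF \<alpha> k l (complex_of_real r * cis \<theta>))"


section \<open>Strong quasi-invariance\<close>

definition Verb_space :: "(nat \<Rightarrow> complex) measure" where
  "Verb_space = (\<Pi>\<^sub>M j\<in>UNIV. restrict_space borel (ball 0 1))"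

definition T_rot :: "nat \<Rightarrow> complex \<Rightarrow> (nat \<Rightarrow> complex) \<Rightarrow> (nat \<Rightarrow> complex)" where
  "T_rot n u \<alpha> = (\<lambda>j. if j < n then \<alpha> j else u * \<alpha> j)"

definition rotated_measure ::
    "(nat \<Rightarrow> complex) measure \<Rightarrow> nat \<Rightarrow> complex \<Rightarrow> (nat \<Rightarrow> complex) measure" where
  "rotated_measure \<Gamma> n u =
     measure_of (space \<Gamma>) (sets \<Gamma>) (\<lambda>A. emeasure \<Gamma> (T_rot n u ` A))"

definition strongly_quasi_invariant :: "(nat \<Rightarrow> complex) measure \<Rightarrow> bool" where
  "strongly_quasi_invariant \<Gamma> \<longleftrightarrow>
     (\<forall>n. \<forall>u\<in>sphere 0 1. absolutely_continuous \<Gamma> (rotated_measure \<Gamma> n u)) \<and>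
     (SUP n. SUP u\<in>sphere 0 1. esssup \<Gamma> (RN_deriv \<Gamma> (rotated_measure \<Gamma> n u))) < \<infinity>"

lemma space_Verb_space: "space Verb_space = {\<alpha>. \<forall>j. \<alpha> j \<in> ball 0 1}"
  by (auto simp: Verb_space_def space_PiM space_restrict_space PiE_def Pi_def)

lemma T_rot_inverse:
  assumes "u \<in> sphere 0 1"
  shows "T_rot n (cnj u) (T_rot n u \<alpha>) = \<alpha>" "T_rot n u (T_rot n (cnj u) \<alpha>) = \<alpha>"
proof -
  have 1: "cnj u * u = 1"
    using assms by (metis complex_norm_square mult.commute of_real_1 one_power2 mem_sphere_0)
  then have "cnj u * (u * x) = x" "u * (cnj u * x) = x" for x
    by (simp_all flip: mult.assoc add: mult.commute[of u])
  then show "T_rot n (cnj u) (T_rot n u \<alpha>) = \<alpha>" "T_rot n u (T_rot n (cnj u) \<alpha>) = \<alpha>"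
    by (auto simp: T_rot_def fun_eq_iff)
qed

lemma T_rot_measurable:
  assumes "u \<in> sphere 0 1"
  shows "T_rot n u \<in> Verb_space \<rightarrow>\<^sub>M Verb_space"
  unfolding Verb_space_def
proof (rule measurable_PiM_single')
  let ?B = "restrict_space borel (ball (0::complex) 1)"
  let ?P = "Pi\<^sub>M UNIV (\<lambda>j::nat. ?B)"
  have sp: "\<alpha> j \<in> ball 0 1" if "\<alpha> \<in> space ?P" for \<alpha> j
    using that space_Verb_space by (auto simp: Verb_space_def)
  then show "T_rot n u \<in> space ?P \<rightarrow> (\<Pi>\<^sub>E j\<in>UNIV. space ?B)"
    using assms by (auto simp: T_rot_def norm_mult space_restrict_space)
  fix j :: nat
  have comp: "(\<lambda>\<alpha>. \<alpha> j) \<in> ?P \<rightarrow>\<^sub>M ?B"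
    by simp
  then have b: "(\<lambda>\<alpha>. \<alpha> j) \<in> borel_measurable ?P"
    by (rule measurable_restrict_space2_iff[THEN iffD1, THEN conjunct1])
  show "(\<lambda>\<alpha>. T_rot n u \<alpha> j) \<in> ?P \<rightarrow>\<^sub>M ?B"
    using assms b sp
    by (intro measurable_restrict_space2) (auto simp: T_rot_def norm_mult)
qed

text \<open>The set function in \<open>rotated_measure\<close> is indeed a measure.\<close>

lemma
  assumes \<Gamma>: "sets \<Gamma> = sets Verb_space" and u: "u \<in> sphere 0 1"
  shows rotated_measure_eq_distr: "rotated_measure \<Gamma> n u = distr \<Gamma> \<Gamma> (T_rot n (cnj u))"
    and emeasure_rotated_measure:
      "A \<in> sets \<Gamma> \<Longrightarrow> emeasure (rotated_measure \<Gamma> n u) A = emeasure \<Gamma> (T_rot n u ` A)"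
proof -
  have sp: "space \<Gamma> = space Verb_space"
    using \<Gamma> by (rule sets_eq_imp_space_eq)
  have meas: "T_rot n (cnj u) \<in> \<Gamma> \<rightarrow>\<^sub>M \<Gamma>" "T_rot n u \<in> \<Gamma> \<rightarrow>\<^sub>M \<Gamma>"
    using T_rot_measurable[of "cnj u" n] T_rot_measurable[of u n] u
    by (simp_all add: measurable_cong_sets[OF \<Gamma> \<Gamma>])
  have img: "T_rot n u ` A = T_rot n (cnj u) -` A \<inter> space \<Gamma>" if "A \<in> sets \<Gamma>" for A
  proof -
    have "T_rot n u \<alpha> \<in> space \<Gamma>" if "\<alpha> \<in> A" for \<alpha>
      using measurable_space[OF meas(2)] sets.sets_into_space[OF \<open>A \<in> sets \<Gamma>\<close>] that by auto
    then show ?thesis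
      using T_rot_inverse[OF u, of n] by (auto simp: image_iff) metis
  qed
  have eq: "emeasure \<Gamma> (T_rot n u ` A) = emeasure (distr \<Gamma> \<Gamma> (T_rot n (cnj u))) A"
    if "A \<in> sets \<Gamma>" for A
    using that meas by (simp add: emeasure_distr img)
  have "rotated_measure \<Gamma> n u =
      measure_of (space \<Gamma>) (sets \<Gamma>) (emeasure (distr \<Gamma> \<Gamma> (T_rot n (cnj u))))"
    unfolding rotated_measure_def
    by (rule measure_of_eq) (auto simp: sets.space_closed sets.sigma_sets_eq eq)
  also have "\<dots> = distr \<Gamma> \<Gamma> (T_rot n (cnj u))"
    using measure_of_of_measure[of "distr \<Gamma> \<Gamma> (T_rot n (cnj u))"] by simp
  finally show *: "rotated_measure \<Gamma> n u = distr \<Gamma> \<Gamma> (T_rot n (cnj u))" .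
  show "emeasure (rotated_measure \<Gamma> n u) A = emeasure \<Gamma> (T_rot n u ` A)" if "A \<in> sets \<Gamma>"
    unfolding * using eq[OF that] by simp
qed

end

theory Submission
  imports Defs "HOL-Complex_Analysis.Complex_Analysis"
begin

text \<open>
  Let \<open>W\<close> be the inverse of the CMV operator \<open>C\<close>, and \<open>R(z) = (1 - z W)\<^sup>-\<^sup>1\<close>, so that
  \<open>F = 2 R - 1\<close> and the \<open>n\<close>-th power series coefficient of \<open>R\<^sub>k\<^sub>l\<close> is \<open>(W\<^sup>n)\<^sub>k\<^sub>l\<close>. For \<open>k \<noteq> l\<close> put
  \<open>P\<^sub>k\<^sub>l = R\<^sub>k\<^sub>l + cnj R\<^sub>l\<^sub>k\<close>, and \<open>P\<^sub>k\<^sub>k = 2 Re R\<^sub>k\<^sub>k - 1\<close>; this is the Poisson extension of the spectral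
  measures. The Fourier coefficients of \<open>P\<^sub>k\<^sub>l\<close> on the circle of radius \<open>r\<close> are, up to the factors
  \<open>r\<close> to the power \<open>|n|\<close>, the entries of the powers of \<open>C\<close>. Hence it suffices to bound
  the expected circle mean of \<open>|P\<^sub>k\<^sub>l|\<close> as \<open>r \<rightarrow> 1\<close> (\<open>cmv_power_fourier_bound\<close>,
  \<open>expectation_sup_power_le\<close>).

  Two facts control \<open>P\<close> inside the disk. First, the matrix \<open>P(z)\<close> is positive because \<open>W\<close> is an isometry, so
  \<open>|P\<^sub>k\<^sub>l|\<^sup>2 \<le> P\<^sub>k\<^sub>k P\<^sub>l\<^sub>l\<close>, and \<open>P\<^sub>k\<^sub>k\<close> has circle mean one. Second, multiplying all \<open>\<alpha>\<^sub>j\<close> with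
  \<open>j \<ge> l\<close> by a unimodular \<open>u\<close> changes \<open>W\<close>, up to conjugation by a diagonal unitary, into
  \<open>W (1 + (u - 1) |\<delta>\<^sub>l><\<delta>\<^sub>l|)\<close> (\<open>T_rot_factors\<close>). With \<open>f = 1 - 1/R\<^sub>l\<^sub>l\<close>, which satisfies \<open>|f| < 1\<close>, this
  rank one perturbation turns \<open>P\<^sub>l\<^sub>l\<close> into \<open>(1 - |f|\<^sup>2) / |1 - u f|\<^sup>2\<close> and multiplies \<open>|R\<^sub>k\<^sub>l|\<close> and
  \<open>|R\<^sub>l\<^sub>k|\<close> by \<open>1 / (|R\<^sub>l\<^sub>l| |1 - u f|) \<le> 2 / |1 - u f|\<close> (\<open>Res_T_rot\<close>, \<open>Pdiag_T_rot\<close>).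

  The positivity bound and the arithmetic-geometric mean inequality give
  \<open>|P\<^sub>k\<^sub>l| \<le> A |P\<^sub>k\<^sub>l|\<^sup>p P\<^sub>l\<^sub>l\<^sup>1\<^sup>-\<^sup>p + B P\<^sub>k\<^sub>k\<close> with adjustable \<open>A\<close> and \<open>B\<close> (\<open>powr_interpolation\<close>). After the
  rotation by \<open>u\<close> the first term is at most a constant times \<open>(|R\<^sub>k\<^sub>l|\<^sup>p + |R\<^sub>l\<^sub>k|\<^sup>p)\<close> times
  \<open>(1 - |f|\<^sup>2)\<^sup>1\<^sup>-\<^sup>p |1 - u f|\<^sup>p\<^sup>-\<^sup>2\<close>, and the average of the last factor over \<open>u\<close> is bounded uniformly in
  \<open>f\<close> (\<open>kernel_average\<close>). Strong quasi-invariance is what permits averaging over \<open>u\<close> under the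
  expectation. So the expected mean of \<open>|P\<^sub>k\<^sub>l|\<close> is controlled by \<open>p\<close>-th moments of \<open>R\<^sub>k\<^sub>l\<close> and \<open>R\<^sub>l\<^sub>k\<close> on
  the circle of radius \<open>r\<close>; choosing \<open>A\<close> and \<open>B\<close> in terms of \<open>exp (- \<kappa>\<^sub>1 |k - l|)\<close> gives the rate
  \<open>\<kappa>\<^sub>2 = \<kappa>\<^sub>1 / (2 - p)\<close>.

  It remains to compare these moments with those of the boundary values of \<open>F\<close>, which the hypothesis
  bounds. By polarization, \<open>F\<^sub>k\<^sub>l\<close> is a combination of four analytic functions with positive real part.
  Such functions have moments of any order \<open>q < 1\<close> bounded uniformly in \<open>r\<close> (\<open>kolmogorov_moment\<close>) and
  radial limits almost everywhere (\<open>fatou_Re_pos\<close>), so with \<open>p < q < 1\<close> the moments of order \<open>p\<close> at radius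
  \<open>r\<close> are asymptotically at most those on the boundary (\<open>carF_moments_inside\<close>). The radial limits are obtained
  from an \<open>L\<^sup>2\<close> bound for the radial maximal function; this is proved by the \<open>T T\<^sup>*\<close> method
  (\<open>linearized_maximal_bound\<close>), for which one needs only that the Poisson kernels form a convolution
  semigroup and \<open>P\<^sub>r\<^sub>s \<le> 8 (P\<^sub>r + P\<^sub>s)\<close>.
\<close>

section \<open>Averages over the unit circle\<close>

definition circ :: "real measure" where
  "circ = uniform_measure lborel {0..2*pi}"

lemma sets_circ [measurable_cong, simp]: "sets circ = sets borel"
  by (simp add: circ_def)

lemma space_circ [simp]: "space circ = UNIV"
  by (simp add: circ_def)

lemma prob_space_circ: "prob_space circ"
  unfolding circ_def by (rule prob_space_uniform_measure) simp_all

interpretation circ: prob_space circ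
  by (rule prob_space_circ)

lemma nn_integral_circ:
  assumes [measurable]: "f \<in> borel_measurable borel"
  shows "(\<integral>\<^sup>+ t. f t \<partial>circ) = (\<integral>\<^sup>+ t\<in>{0..2*pi}. f t \<partial>lborel) / ennreal (2*pi)"
  unfolding circ_def by (subst nn_integral_uniform_measure) auto

lemma AE_circ_iff: "(AE t in circ. P t) \<longleftrightarrow> (AE t in lborel. t \<in> {0..2*pi} \<longrightarrow> P t)"
  unfolding circ_def
  by (rule AE_uniform_measure) simp_all

lemma integrable_circ_bounded:
  fixes f :: "real \<Rightarrow> 'a::{banach, second_countable_topology}"
  assumes "f \<in> borel_measurable borel" "\<And>t. norm (f t) \<le> B"
  shows "integrable circ f"
  by (rule circ.integrable_const_bound[where B = B]) (use assms in auto)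

lemma integral_circ:
  fixes f :: "real \<Rightarrow> complex"
  assumes [measurable]: "f \<in> borel_measurable borel"
  shows "(LINT t|circ. f t) = (LINT t:{0..2*pi}|lborel. f t) / (2*pi)"
proof -
  have eq: "circ = density lborel (\<lambda>t. ennreal (indicator {0..2*pi} t / (2*pi)))"
    unfolding circ_def uniform_measure_def
    by (intro density_cong) (auto simp: divide_ennreal[symmetric] indicator_def ennreal_1[symmetric]
         simp del: ennreal_1)
  have "(LINT t|circ. f t) = (LINT t|lborel. (indicator {0..2*pi} t / (2*pi)) *\<^sub>R f t)"
    unfolding eq by (subst integral_density) auto
  also have "\<dots> = (LINT t|lborel. (indicator {0..2*pi} t *\<^sub>R f t) / (2*pi))"
    by (intro Bochner_Integration.integral_cong) (auto simp: scaleR_conv_of_real)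
  finally show ?thesis
    by (simp add: set_lebesgue_integral_def)
qed

lemma cauchy_formula_circ:
  fixes f :: "complex \<Rightarrow> complex" and r \<rho> :: real
  assumes f: "f holomorphic_on ball 0 \<rho>" and r: "0 < r" "r < \<rho>" and z: "cmod z < r"
  shows "(LINT t|circ. f (r * cis t) * (r * cis t) / (r * cis t - z)) = f z"
proof -
  let ?g = "\<lambda>t. f (r * cis t) * (r * cis t) / (r * cis t - z)"
  have sub: "cball 0 r \<subseteq> ball (0::complex) \<rho>" using r by auto
  have cont: "continuous_on (cball 0 r) f"
    using f sub holomorphic_on_imp_continuous_on holomorphic_on_subset by blast
  have hol: "f holomorphic_on ball 0 r"
    using f r by (intro holomorphic_on_subset[OF f]) auto
  have "((\<lambda>u. f u / (u - z)) has_contour_integral (2 * of_real pi * \<i> * f z)) (circlepath 0 r)"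
    by (rule Cauchy_integral_circlepath[OF cont hol]) (use z in auto)
  then have hi: "((\<lambda>t. (f (r * cis t) / (r * cis t - z)) * r * \<i> * cis t) has_integral
      (2 * of_real pi * \<i> * f z)) {0..2*pi}"
    unfolding circlepath_def
    by (subst (asm) has_contour_integral_part_circlepath_iff) (auto)
  have "((\<lambda>t. \<i> * ?g t) has_integral (2 * of_real pi * \<i> * f z)) {0..2*pi}"
    by (rule has_integral_eq[OF _ hi]) (auto simp: field_simps)
  then have "((\<lambda>t. (- \<i>) * (\<i> * ?g t)) has_integral (-\<i>) * (2 * of_real pi * \<i> * f z)) {0..2*pi}"
    by (rule has_integral_mult_right)
  then have hi2: "(?g has_integral (2 * of_real pi * f z)) {0..2*pi}"
  proof -
    have "(- \<i>) * (\<i> * x) = x" "(-\<i>) * (2 * of_real pi * \<i> * x) = 2 * of_real pi * x" for x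
      by (simp_all add: complex_eq_iff)
    then show ?thesis
      using \<open>((\<lambda>t. (- \<i>) * (\<i> * ?g t)) has_integral (-\<i>) * (2 * of_real pi * \<i> * f z)) {0..2*pi}\<close>
      by (simp only:)
  qed
  have nz: "complex_of_real r * cis t \<noteq> z" for t
    using z r by (auto simp: norm_mult)
  have contg: "continuous_on UNIV ?g"
  proof -
    have "continuous_on UNIV (\<lambda>t. f (r * cis t))"
      by (rule continuous_on_compose2[OF cont]) (use r in \<open>auto intro!: continuous_intros simp: norm_mult\<close>)
    then show ?thesis
      by (intro continuous_intros) (use nz in auto)
  qed
  then have meas: "?g \<in> borel_measurable borel"
    by (intro borel_measurable_continuous_onI)
  have "set_integrable lborel {0..2*pi} ?g"
    unfolding set_integrable_def
    by (rule borel_integrable_compact) (use contg in \<open>auto intro: continuous_on_subset\<close>)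
  then have "(LINT t:{0..2*pi}|lborel. ?g t) = integral {0..2*pi} ?g"
    by (rule set_borel_integral_eq_integral(2))
  also have "\<dots> = 2 * of_real pi * f z"
    using hi2 by (rule integral_unique)
  finally show ?thesis
    using meas by (simp add: integral_circ)
qed

lemma mean_value_circ:
  fixes f :: "complex \<Rightarrow> complex" and r \<rho> :: real
  assumes f: "f holomorphic_on ball 0 \<rho>" and r: "0 < r" "r < \<rho>"
  shows "(LINT t|circ. f (r * cis t)) = f 0"
  using cauchy_formula_circ[OF f r, of 0] r by simp

abbreviation polar :: "real \<Rightarrow> real \<Rightarrow> complex" where
  "polar r t \<equiv> of_real r * cis t"

lemma holomorphic_circ_measurable:
  fixes f :: "complex \<Rightarrow> complex" and r \<rho> :: real
  assumes f: "f holomorphic_on ball 0 \<rho>" and r: "0 \<le> r" "r < \<rho>"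
  shows "(\<lambda>t. f (r * cis t)) \<in> borel_measurable borel" "continuous_on UNIV (\<lambda>t. f (r * cis t))"
    "\<exists>B. \<forall>t. cmod (f (r * cis t)) \<le> B"
proof -
  have c: "continuous_on (ball 0 \<rho>) f"
    by (rule holomorphic_on_imp_continuous_on[OF f])
  show ct: "continuous_on UNIV (\<lambda>t. f (r * cis t))"
    by (rule continuous_on_compose2[OF c]) (use r in \<open>auto intro!: continuous_intros simp: norm_mult\<close>)
  then show "(\<lambda>t. f (r * cis t)) \<in> borel_measurable borel"
    by (intro borel_measurable_continuous_onI)
  have "compact (f ` cball 0 r)"
    by (rule compact_continuous_image) (use r in \<open>auto intro: continuous_on_subset[OF c]\<close>)
  then obtain B where "\<And>x. x \<in> f ` cball 0 r \<Longrightarrow> norm x \<le> B"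
    using compact_imp_bounded bounded_iff by metis
  then show "\<exists>B. \<forall>t. cmod (f (r * cis t)) \<le> B"
    using r by (intro exI[of _ B]) (auto simp: norm_mult)
qed

section \<open>The Poisson kernel\<close>

text \<open>
  The kernel at the point with polar coordinates \<open>r\<close> and \<open>\<theta>\<close> and the boundary angle \<open>\<phi>\<close> is
  \<open>poisson r (\<theta> - \<phi>)\<close>; a real function of the difference of the angles makes the symmetry visible.
\<close>

definition poisson :: "real \<Rightarrow> real \<Rightarrow> real" where
  "poisson r t = (1 - r\<^sup>2) / (1 - 2 * r * cos t + r\<^sup>2)"

lemma poisson_denom: "1 - 2 * r * cos t + r\<^sup>2 = (cmod (1 - r * cis t))\<^sup>2"
proof -
  have "(cmod (1 - r * cis t))\<^sup>2 = (1 - r * cos t)\<^sup>2 + (r * sin t)\<^sup>2"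
    by (simp add: cmod_power2)
  also have "\<dots> = 1 - 2 * r * cos t + r\<^sup>2 * ((sin t)\<^sup>2 + (cos t)\<^sup>2)"
    unfolding power2_eq_square by algebra
  finally show ?thesis by simp
qed

lemma poisson_denom_ge: fixes r t :: real assumes "0 \<le> r" shows "(1 - r)\<^sup>2 \<le> 1 - 2 * r * cos t + r\<^sup>2"
proof -
  have "r * cos t \<le> r" using mult_left_mono[of "cos t" 1 r] assms by simp
  then show ?thesis by (simp add: power2_eq_square algebra_simps)
qed

lemma poisson_even: "poisson r (a - b) = poisson r (b - a)"
  using cos_minus[of "a - b"] by (simp add: poisson_def)

lemma poisson_nonneg: "\<lbrakk>0 \<le> r; r < 1\<rbrakk> \<Longrightarrow> 0 \<le> poisson r t"
  unfolding poisson_def poisson_denom using power_mono[of r 1 2]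
  by (intro divide_nonneg_nonneg) auto

lemma poisson_le: assumes "0 \<le> r" "r \<le> R" "R < 1" shows "poisson r t \<le> 1 / (1 - R)\<^sup>2"
  unfolding poisson_def
proof (rule frac_le)
  show "(1 - R)\<^sup>2 \<le> 1 - 2 * r * cos t + r\<^sup>2"
    using poisson_denom_ge[of r t] power_mono[of "1 - R" "1 - r" 2] assms by linarith
qed (use assms in auto)

lemma poisson_cis: "(1 - (cmod (r * cis \<theta>))\<^sup>2) / (cmod (cis \<phi> - r * cis \<theta>))\<^sup>2 = poisson r (\<theta> - \<phi>)"
proof -
  have "cis \<phi> - r * cis \<theta> = cis \<phi> * (1 - r * cis (\<theta> - \<phi>))"
    by (simp add: algebra_simps cis_mult)
  then have "cmod (cis \<phi> - r * cis \<theta>) = cmod (1 - r * cis (\<theta> - \<phi>))"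
    by (simp add: norm_mult)
  then show ?thesis
    unfolding poisson_def poisson_denom by (simp add: norm_mult)
qed

lemma poisson_Re: assumes "0 \<le> r" "r < 1" shows "Re ((1 + r * cis t) / (1 - r * cis t)) = poisson r t"
proof -
  let ?v = "r * cis t"
  have "Re ((1 + ?v) / (1 - ?v)) = Re ((1 + ?v) * cnj (1 - ?v)) / (cmod (1 - ?v))\<^sup>2"
    by (simp add: complex_div_cnj[of "1 + ?v"])
  also have "Re ((1 + ?v) * cnj (1 - ?v)) = 1 - r\<^sup>2 * ((sin t)\<^sup>2 + (cos t)\<^sup>2)"
    by (simp add: power2_eq_square) algebra
  finally show ?thesis
    unfolding poisson_def poisson_denom by simp
qed

text \<open>
  On the unit circle the Poisson kernel is \<open>w / (w - z) + cnj z w / (1 - cnj z w)\<close>. The first summand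
  reproduces \<open>f z\<close> by the Cauchy formula; the second, multiplied by \<open>f\<close>, is analytic in the closed disk
  and vanishes at the origin, so its mean is zero.
\<close>

lemma poisson_formula:
  fixes f :: "complex \<Rightarrow> complex"
  assumes f: "f holomorphic_on ball 0 \<rho>" and "1 < \<rho>" and r: "0 \<le> r" "r < 1"
  shows "(LINT \<phi>|circ. f (cis \<phi>) * poisson r (\<theta> - \<phi>)) = f (r * cis \<theta>)"
proof -
  define z where "z = r * cis \<theta>"
  have z: "cmod z < 1" using r by (simp add: z_def norm_mult)
  define pz where "pz w = (1 - (cmod z)\<^sup>2) / (cmod (w - z))\<^sup>2" for w
  have pkz: "poisson r (\<theta> - \<phi>) = pz (cis \<phi>)" for \<phi>
    unfolding pz_def z_def poisson_cis ..
  let ?k = "\<lambda>w. f w * (cnj z * w) / (1 - cnj z * w)"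
  obtain \<rho>' where \<rho>': "1 < \<rho>'" "\<rho>' \<le> \<rho>" "\<rho>' * cmod z < 1"
  proof (cases "z = 0")
    case True then show ?thesis using that[of \<rho>] \<open>1 < \<rho>\<close> by auto
  next
    case False
    have "1 < 1 / cmod z" using False z by (simp add: field_simps)
    then obtain q where "1 < q" "q < 1 / cmod z" using dense by blast
    then have "min q \<rho> * cmod z < 1"
      using False by (smt (verit) min_def mult_right_mono norm_ge_zero pos_less_divide_eq zero_less_norm_iff)
    then show ?thesis using that[of "min q \<rho>"] \<open>1 < q\<close> \<open>1 < \<rho>\<close> by auto
  qed
  have nz: "1 - cnj z * w \<noteq> 0" if "w \<in> ball 0 \<rho>'" for w
  proof
    assume "1 - cnj z * w = 0"
    then have "cmod (cnj z * w) = 1" by (metis norm_one right_minus_eq)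
    moreover have "cmod w * cmod z \<le> \<rho>' * cmod z"
      using that by (intro mult_right_mono) auto
    ultimately show False using \<rho>' by (simp add: norm_mult mult.commute)
  qed
  have k: "?k holomorphic_on ball 0 \<rho>'"
    by (intro holomorphic_intros holomorphic_on_subset[OF f]) (use \<rho>' nz in auto)
  have 1: "(LINT t|circ. f (cis t) * cis t / (cis t - z)) = f z"
    using cauchy_formula_circ[OF f, of 1 z] assms z by simp
  have 2: "(LINT t|circ. ?k (cis t)) = 0"
    using mean_value_circ[OF k, of 1] \<rho>' by simp
  have nz1: "cis t - z \<noteq> 0" for t using z by (metis eq_iff_diff_eq_0 norm_cis less_irrefl)
  have nz2: "1 - cnj z * cis t \<noteq> 0" for t using nz[of "cis t"] \<rho>' by simp
  have eq: "f (cis t) * pz (cis t) = f (cis t) * cis t / (cis t - z) + ?k (cis t)" for t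
  proof -
    let ?w = "cis t"
    have c: "?w * cnj ?w = 1" by (simp add: cis_cnj cis_mult)
    have e1: "1 - z * cnj z = (1 - cnj z * ?w) + cnj z * (?w - z)"
      by (simp add: algebra_simps)
    have e2: "(?w - z) * cnj (?w - z) = cnj ?w * ((?w - z) * (1 - cnj z * ?w))"
      unfolding complex_cnj_diff using c by algebra
    have "complex_of_real (pz ?w) = (1 - z * cnj z) / ((?w - z) * cnj (?w - z))"
      unfolding pz_def of_real_divide of_real_diff
      by (simp only: complex_norm_square of_real_1)
    also have "\<dots> = ?w * ((1 - cnj z * ?w) + cnj z * (?w - z)) / ((?w - z) * (1 - cnj z * ?w))"
      unfolding e1 e2 using nz1[of t] nz2[of t] by (simp add: divide_simps cis_cnj cis_mult)
    also have "\<dots> = ?w / (?w - z) + cnj z * ?w / (1 - cnj z * ?w)"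
      using nz1[of t] nz2[of t] by (simp add: divide_simps) (simp add: algebra_simps)
    finally show ?thesis by (simp add: algebra_simps)
  qed
  have cont: "continuous_on UNIV (\<lambda>t. f (cis t))"
    using holomorphic_circ_measurable(2)[OF f, of 1] \<open>1 < \<rho>\<close> by simp
  obtain B where B: "\<And>t. cmod (f (cis t)) \<le> B"
    using holomorphic_circ_measurable(3)[OF f, of 1] \<open>1 < \<rho>\<close> by auto
  obtain B' where B': "\<And>t. cmod (?k (cis t)) \<le> B'"
    using holomorphic_circ_measurable(3)[OF k, of 1] \<rho>' by auto
  have i2: "integrable circ (\<lambda>t. ?k (cis t))"
    using holomorphic_circ_measurable(1)[OF k, of 1] \<rho>' B' by (intro integrable_circ_bounded[of _ B']) auto
  have i1: "integrable circ (\<lambda>t. f (cis t) * cis t / (cis t - z))"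
  proof (rule integrable_circ_bounded[where B = "B / (1 - cmod z)"])
    show "(\<lambda>t. f (cis t) * cis t / (cis t - z)) \<in> borel_measurable borel"
      by (intro borel_measurable_continuous_onI continuous_intros cont) (use nz1 in auto)
    show "norm (f (cis t) * cis t / (cis t - z)) \<le> B / (1 - cmod z)" for t
    proof -
      have "1 - cmod z \<le> cmod (cis t - z)"
        by (metis norm_cis norm_triangle_ineq2)
      then show ?thesis
        using B[of t] z by (auto simp: norm_mult norm_divide intro!: frac_le order_trans[OF norm_ge_zero])
    qed
  qed
  show ?thesis
    unfolding pkz eq using Bochner_Integration.integral_add[OF i1 i2] 1 2 by (simp add: z_def)
qed

lemma poisson_measurable [measurable]: "case_prod poisson \<in> borel_measurable (borel \<Otimes>\<^sub>M borel)"
  unfolding poisson_def by measurable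

text \<open>
  The Poisson formula for \<open>(1 + v) / (1 - v)\<close>, where \<open>v = s cis (- x') w\<close>, whose real part is a Poisson
  kernel.
\<close>

lemma poisson_convolution:
  assumes r: "0 \<le> r" "r < 1" and s: "0 \<le> s" "s < 1"
  shows "(LINT y|circ. poisson r (x - y) * poisson s (x' - y)) = poisson (r * s) (x - x')"
proof -
  define f where "f w = (1 + s * cis (- x') * w) / (1 - s * cis (- x') * w)" for w
  define \<rho> where "\<rho> = 2 / (1 + s)"
  have \<rho>: "1 < \<rho>" "s * \<rho> < 1" using s by (auto simp: \<rho>_def field_simps)
  have nz: "1 - s * cis (- x') * w \<noteq> 0" if "w \<in> ball 0 \<rho>" for w
  proof
    assume "1 - s * cis (- x') * w = 0"
    then have "cmod (s * cis (- x') * w) = 1" by (metis norm_one right_minus_eq)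
    moreover have "s * cmod w \<le> s * \<rho>"
      using that s by (intro mult_left_mono) auto
    ultimately show False using \<rho> s by (simp add: norm_mult)
  qed
  have hol: "f holomorphic_on ball 0 \<rho>"
    unfolding f_def by (intro holomorphic_intros) (use nz in auto)
  have Re_f: "Re (f (q * cis a)) = poisson (q * s) (a - x')" if "0 \<le> q" "q \<le> 1" for q a
  proof -
    have e: "s * cis (- x') * (q * cis a) = (q * s) * cis (a - x')"
      using cis_mult[of a "- x'"] by (simp add: algebra_simps)
    have "q * s < 1" using that s by (metis mult_left_le_one_le le_less_trans)
    then show ?thesis
      unfolding f_def e using that s by (subst poisson_Re[symmetric]) auto
  qed
  obtain B where B: "\<And>t. cmod (f (cis t)) \<le> B"
    using holomorphic_circ_measurable(3)[OF hol, of 1] \<rho> by auto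
  have mf: "(\<lambda>t. f (cis t)) \<in> borel_measurable borel"
    using holomorphic_circ_measurable(1)[OF hol, of 1] \<rho> by auto
  have "integrable circ (\<lambda>y. f (cis y) * poisson r (x - y))"
  proof (rule integrable_circ_bounded[where B = "B * (1 / (1 - r)\<^sup>2)"])
    show "(\<lambda>t. f (cis t) * (poisson r (x - t))) \<in> borel_measurable borel"
      using mf by measurable
    show "norm (f (cis t) * (poisson r (x - t))) \<le> B * (1 / (1 - r)\<^sup>2)" for t
      unfolding norm_mult using B[of t] poisson_le[of r r "x - t"] poisson_nonneg[of r "x - t"] r norm_ge_zero[of "f (cis t)"]
      by (intro mult_mono) (auto simp del: norm_ge_zero)
  qed
  then have "Re (LINT y|circ. f (cis y) * poisson r (x - y)) = (LINT y|circ. Re (f (cis y) * poisson r (x - y)))"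
    by (rule integral_Re[symmetric])
  also have "\<dots> = (LINT y|circ. poisson r (x - y) * poisson s (x' - y))"
    using Re_f[of 1] poisson_even by (intro Bochner_Integration.integral_cong) (auto simp: mult.commute)
  finally show ?thesis
    using poisson_formula[OF hol \<rho>(1) r, of x] Re_f[of r x] r by simp
qed

text \<open>
  Replacing \<open>r\<close> by \<open>r s\<close> with \<open>r \<le> s\<close> at most doubles the numerator \<open>1 - r\<^sup>2\<close>, and the distance from \<open>1\<close> to
  \<open>r cis t\<close> is at most twice that to \<open>r s cis t\<close>.
\<close>

lemma poisson_mult_le_aux:
  assumes r: "0 \<le> r" "r \<le> s" "s < 1"
  shows "poisson (r * s) t \<le> 8 * poisson r t"
proof -
  let ?w = "cis t"
  have rs: "r * s \<le> r" "0 \<le> r * s" using r by (auto simp: mult_left_le)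
  have pos: "0 < (cmod (1 - r * ?w))\<^sup>2" "0 < (cmod (1 - complex_of_real (r * s) * ?w))\<^sup>2"
    using poisson_denom_ge[of r t] poisson_denom_ge[of "r * s" t] r rs
    unfolding poisson_denom[symmetric] by (smt (verit) zero_less_power)+
  have n1: "1 - r * s \<le> cmod (1 - complex_of_real (r * s) * ?w)"
    using norm_triangle_ineq2[of 1 "complex_of_real (r * s) * ?w"] rs r by (simp add: norm_mult abs_mult)
  have "cmod (1 - r * ?w) \<le> cmod (1 - complex_of_real (r * s) * ?w) + cmod (complex_of_real (r * s) * ?w - r * ?w)"
    using norm_triangle_ineq[of "1 - complex_of_real (r * s) * ?w" "complex_of_real (r * s) * ?w - r * ?w"] by simp
  also have "cmod (complex_of_real (r * s) * ?w - r * ?w) = r * (1 - s)"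
  proof -
    have "complex_of_real (r * s) * ?w - r * ?w = complex_of_real (r * s - r) * ?w" by (simp add: algebra_simps)
    then have "cmod (complex_of_real (r * s) * ?w - r * ?w) = \<bar>r * s - r\<bar>" by (simp only: norm_mult norm_of_real norm_cis mult_1_right)
    then show ?thesis using rs by (simp add: algebra_simps)
  qed
  also have "r * (1 - s) \<le> 1 - r * s" using r by (simp add: algebra_simps)
  finally have "cmod (1 - r * ?w) \<le> 2 * cmod (1 - complex_of_real (r * s) * ?w)"
    using n1 by linarith
  then have "(cmod (1 - r * ?w))\<^sup>2 \<le> (2 * cmod (1 - complex_of_real (r * s) * ?w))\<^sup>2"
    by (intro power_mono) auto
  then have den: "(cmod (1 - r * ?w))\<^sup>2 \<le> 4 * (cmod (1 - complex_of_real (r * s) * ?w))\<^sup>2"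
    by (simp add: power_mult_distrib)
  have "r\<^sup>2 * r\<^sup>2 \<le> r\<^sup>2 * s\<^sup>2" using r by (intro mult_left_mono power_mono) auto
  moreover have "(1 - r\<^sup>2)\<^sup>2 = 1 - 2 * r\<^sup>2 + r\<^sup>2 * r\<^sup>2" by algebra
  then have "0 \<le> 1 - 2 * r\<^sup>2 + r\<^sup>2 * r\<^sup>2" by (metis zero_le_power2)
  ultimately have num: "1 - (r * s)\<^sup>2 \<le> 2 * (1 - r\<^sup>2)"
  proof -
    have "1 - y \<le> 2 * (1 - a)" if "x \<le> y" "0 \<le> 1 - 2 * a + x" for x y a :: real
      using that by (simp add: algebra_simps)
    then show ?thesis
      unfolding power_mult_distrib using \<open>r\<^sup>2 * r\<^sup>2 \<le> r\<^sup>2 * s\<^sup>2\<close> \<open>0 \<le> 1 - 2 * r\<^sup>2 + r\<^sup>2 * r\<^sup>2\<close> by blast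
  qed
  have num0: "0 \<le> 1 - r\<^sup>2" using r power_mono[of r 1 2] by simp
  have "poisson (r * s) t \<le> 2 * (1 - r\<^sup>2) / (cmod (1 - complex_of_real (r * s) * ?w))\<^sup>2"
    unfolding poisson_def poisson_denom by (intro divide_right_mono num) simp
  also have "\<dots> \<le> 2 * (1 - r\<^sup>2) / ((cmod (1 - r * ?w))\<^sup>2 / 4)"
    using pos den num0 by (intro divide_left_mono) auto
  finally show ?thesis unfolding poisson_def poisson_denom by simp
qed

lemma poisson_mult_le:
  assumes r: "0 \<le> r" "r < 1" and s: "0 \<le> s" "s < 1"
  shows "poisson (r * s) t \<le> 8 * (poisson r t + poisson s t)"
  using poisson_mult_le_aux[of r s t] poisson_mult_le_aux[of s r t] poisson_nonneg[of r t] poisson_nonneg[of s t] assms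
  by (cases "r \<le> s") (auto simp: mult.commute)

section \<open>The radial maximal function in mean square\<close>

interpretation cc: pair_prob_space circ circ
  by unfold_locales

lemma fubini_circ:
  fixes f :: "real \<Rightarrow> real \<Rightarrow> real"
  assumes [measurable]: "case_prod f \<in> borel_measurable (borel \<Otimes>\<^sub>M borel)" and B: "\<And>x y. \<bar>f x y\<bar> \<le> B"
  shows "(LINT x|circ. LINT y|circ. f x y) = (LINT y|circ. LINT x|circ. f x y)"
proof -
  have "integrable (circ \<Otimes>\<^sub>M circ) (case_prod f)"
    by (rule cc.integrable_const_bound[where B = B]) (use B in auto)
  then show ?thesis using cc.Fubini_integral[of f] by simp
qed

lemma integral_circ_bound:
  fixes f :: "real \<Rightarrow> real"
  assumes "\<And>x. \<bar>f x\<bar> \<le> B" "f \<in> borel_measurable borel"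
  shows "\<bar>LINT x|circ. f x\<bar> \<le> B"
proof -
  have i: "integrable circ f" using assms by (intro integrable_circ_bounded) auto
  have "\<bar>LINT x|circ. f x\<bar> \<le> (LINT x|circ. \<bar>f x\<bar>)" by (rule integral_abs_bound)
  also have "\<dots> \<le> (LINT x|circ. B)"
    using i assms by (intro integral_mono) auto
  finally show ?thesis using circ.prob_space by simp
qed

text \<open>
  The function \<open>\<rho>\<close> selects a radius at each angle, so that the map \<open>T\<close> taking \<open>v\<close> to the right-hand side of the
  last hypothesis is linear. The kernel of \<open>T T\<^sup>*\<close> at \<open>x\<close> and \<open>x'\<close> is a Poisson kernel of radius
  \<open>\<rho> x * \<rho> x'\<close>, which is at most \<open>8\<close> times the sum of the kernels of \<open>T\<close> and \<open>T\<^sup>*\<close>. Therefore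
  \<open>\<parallel>T\<parallel>\<^sup>2 \<le> 16 \<parallel>T\<parallel>\<close> on nonnegative functions, and the bound does not depend on \<open>R\<close> or on \<open>\<rho>\<close>.
\<close>

lemma linearized_maximal_bound:
  fixes M v \<rho> :: "real \<Rightarrow> real"
  assumes [measurable]: "M \<in> borel_measurable borel" "v \<in> borel_measurable borel" "\<rho> \<in> borel_measurable borel"
    and M: "\<And>t. 0 \<le> M t" "\<And>t. M t \<le> B" and v: "\<And>t. 0 \<le> v t" "\<And>t. v t \<le> B"
    and \<rho>: "\<And>t. 0 \<le> \<rho> t" "\<And>t. \<rho> t \<le> R" "R < 1"
    and le: "\<And>x. M x \<le> (LINT y|circ. v y * poisson (\<rho> x) (x - y))"
  shows "(LINT x|circ. (M x)\<^sup>2) \<le> 256 * (LINT x|circ. (v x)\<^sup>2)"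
proof -
  define K where "K = 1 / (1 - R)\<^sup>2"
  define k where "k x y = poisson (\<rho> x) (x - y)" for x y
  have \<rho>1: "\<rho> t < 1" for t using \<rho> le_less_trans by blast
  have B0: "0 \<le> B" using M order_trans by blast
  have K0: "0 \<le> K" by (simp add: K_def)
  have k: "0 \<le> k a b" "k a b \<le> K" for a b
    using poisson_nonneg[of "\<rho> a"] poisson_le[of "\<rho> a" R] \<rho> \<rho>1 by (auto simp: k_def K_def)
  have [measurable]: "case_prod k \<in> borel_measurable (borel \<Otimes>\<^sub>M borel)"
    unfolding k_def by measurable
  have [measurable]: "(\<lambda>y. k a y) \<in> borel_measurable borel" "(\<lambda>x. k x a) \<in> borel_measurable borel" for a
    by measurable
  define h where "h y = (LINT x|circ. M x * k x y)" for y
  have [measurable]: "h \<in> borel_measurable borel"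
    unfolding h_def by measurable
  have Mk: "\<bar>M a * k a b\<bar> \<le> B * K" "\<bar>M c * k a b\<bar> \<le> B * K" for a b c
    using M k B0 by (auto simp: abs_mult intro!: mult_mono)
  have h: "\<bar>h y\<bar> \<le> B * K" for y
    unfolding h_def by (rule integral_circ_bound) (use Mk in auto)
  have abs_le: "\<bar>x * y\<bar> \<le> a * b" if "\<bar>x\<bar> \<le> a" "\<bar>y\<bar> \<le> b" for x y a b :: real
    using that by (auto simp: abs_mult intro!: mult_mono order_trans[OF abs_ge_zero])
  have bM: "\<bar>M t\<bar> \<le> B" "\<bar>v t\<bar> \<le> B" "\<bar>k s t\<bar> \<le> K" for s t using M v k by auto
  note int = integrable_circ_bounded[where 'a = real, simplified]
  have iM2: "integrable circ (\<lambda>t. (M t)\<^sup>2)" "integrable circ (\<lambda>t. (v t)\<^sup>2)"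
    unfolding power2_eq_square
    by (rule int[of _ "B * B"], measurable, rule abs_le[OF bM(1) bM(1)],
        rule int[of _ "B * B"], measurable, rule abs_le[OF bM(2) bM(2)])
  have ih2: "integrable circ (\<lambda>t. (h t)\<^sup>2)"
    unfolding power2_eq_square
    by (rule int[of _ "(B*K) * (B*K)"], measurable, rule abs_le[OF h h])
  have ivh: "integrable circ (\<lambda>t. v t * h t)" "integrable circ (\<lambda>t. M t * h t)"
    by (rule int[of _ "B * (B*K)"], measurable, rule abs_le[OF bM(2) h],
        rule int[of _ "B * (B*K)"], measurable, rule abs_le[OF bM(1) h])
  \<comment> \<open>Duality: \<open>h\<close> is the adjoint \<open>T\<^sup>* M\<close>, and the square integral of \<open>M\<close> is at most the inner product of \<open>M\<close> with \<open>T v\<close>.\<close>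
  have "(LINT x|circ. (M x)\<^sup>2) \<le> (LINT x|circ. M x * (LINT y|circ. v y * k x y))"
  proof (rule integral_mono[OF iM2(1)])
    show "integrable circ (\<lambda>x. M x * (LINT y|circ. v y * k x y))"
      by (rule int[of _ "B * (B*K)"]) (auto intro!: abs_le bM integral_circ_bound)
    show "(M x)\<^sup>2 \<le> M x * (LINT y|circ. v y * k x y)" for x
      using le[of x] M(1)[of x] by (auto simp: power2_eq_square k_def intro: mult_left_mono)
  qed
  also have "\<dots> = (LINT x|circ. LINT y|circ. M x * (v y * k x y))"
    by simp
  also have "\<dots> = (LINT y|circ. LINT x|circ. M x * (v y * k x y))"
    by (rule fubini_circ[where B = "B * (B * K)"]) (auto intro!: abs_le bM)
  also have "\<dots> = (LINT y|circ. v y * h y)"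
    unfolding h_def by (simp add: mult.left_commute flip: Bochner_Integration.integral_mult_right_zero)
  finally have 1: "(LINT x|circ. (M x)\<^sup>2) \<le> (LINT y|circ. v y * h y)" .
  have semi: "(LINT y|circ. k a y * k b y) \<le> 8 * (k a b + k b a)" for a b
  proof -
    have "(LINT y|circ. k a y * k b y) = poisson (\<rho> a * \<rho> b) (a - b)"
      unfolding k_def using \<rho> \<rho>1 by (intro poisson_convolution) auto
    also have "\<dots> \<le> 8 * (poisson (\<rho> a) (a - b) + poisson (\<rho> b) (a - b))"
      using \<rho> \<rho>1 by (intro poisson_mult_le) auto
    finally show ?thesis unfolding k_def poisson_even[of "\<rho> b" a b] .
  qed
  \<comment> \<open>The square integral of \<open>h\<close> is the quadratic form of \<open>T T\<^sup>*\<close> at \<open>M\<close>.\<close>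
  have "(LINT y|circ. (h y)\<^sup>2) = (LINT y|circ. h y * (LINT x|circ. M x * k x y))"
    by (simp add: power2_eq_square h_def)
  also have "\<dots> = (LINT y|circ. LINT x|circ. h y * (M x * k x y))"
    by simp
  also have "\<dots> = (LINT x|circ. LINT y|circ. h y * (M x * k x y))"
    by (rule fubini_circ[where B = "B * K * (B * K)"]) (auto intro!: abs_le bM h)
  also have "\<dots> = (LINT x|circ. M x * (LINT y|circ. k x y * (LINT x'|circ. M x' * k x' y)))"
    by (simp add: h_def mult_ac flip: Bochner_Integration.integral_mult_right_zero)
  also have "\<dots> = (LINT x|circ. M x * (LINT x'|circ. M x' * (LINT y|circ. k x y * k x' y)))"
  proof -
    have "(LINT y|circ. k x y * (LINT x'|circ. M x' * k x' y)) = (LINT x'|circ. M x' * (LINT y|circ. k x y * k x' y))" for x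
    proof -
      have "(LINT y|circ. k x y * (LINT x'|circ. M x' * k x' y)) = (LINT y|circ. LINT x'|circ. k x y * (M x' * k x' y))"
        by simp
      also have "\<dots> = (LINT x'|circ. LINT y|circ. k x y * (M x' * k x' y))"
        by (rule fubini_circ[where B = "K * (B * K)"]) (auto intro!: abs_le bM)
      finally show ?thesis
        by (simp add: mult_ac flip: Bochner_Integration.integral_mult_right_zero)
    qed
    then show ?thesis by simp
  qed
  also have "\<dots> \<le> (LINT x|circ. M x * (LINT x'|circ. M x' * (8 * (k x x' + k x' x))))"
  proof -
    have kk: "\<bar>LINT y|circ. k x y * k x' y\<bar> \<le> K * K" for x x'
      by (rule integral_circ_bound) (auto intro!: abs_le bM)
    have kk': "\<bar>8 * (k x x' + k x' x)\<bar> \<le> 16 * K" for x x' using k[of x x'] k[of x' x] by simp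
    have kk'': "\<bar>8 * k x x' + 8 * k x' x\<bar> \<le> 16 * K" for x x' using k[of x x'] k[of x' x] by simp
    have 1: "integrable circ (\<lambda>x'. M x' * (LINT y|circ. k x y * k x' y))" for x
      by (rule int[of _ "B * (K * K)"]) (auto intro!: abs_le bM kk)
    have 2: "integrable circ (\<lambda>x'. M x' * (8 * (k x x' + k x' x)))" for x
      by (rule int[of _ "B * (16 * K)"]) (auto intro!: abs_le bM kk'')
    have 3: "integrable circ (\<lambda>x. M x * (LINT x'|circ. M x' * (LINT y|circ. k x y * k x' y)))"
      by (rule int[of _ "B * (B * (K * K))"]) (auto intro!: abs_le bM kk integral_circ_bound)
    have 4: "integrable circ (\<lambda>x. M x * (LINT x'|circ. M x' * (8 * (k x x' + k x' x))))"
      by (rule int[of _ "B * (B * (16 * K))"]) (auto intro!: abs_le bM kk'' integral_circ_bound)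
    have 5: "(LINT x'|circ. M x' * (LINT y|circ. k x y * k x' y)) \<le> (LINT x'|circ. M x' * (8 * (k x x' + k x' x)))" for x
      by (rule integral_mono[OF 1 2]) (rule mult_left_mono[OF semi M(1)])
    show ?thesis
      by (rule integral_mono[OF 3 4]) (rule mult_left_mono[OF 5 M(1)])
  qed
  also have "\<dots> = (LINT x|circ. 8 * (LINT x'|circ. M x * (M x' * k x x')) + 8 * (M x * h x))"
  proof (intro Bochner_Integration.integral_cong refl)
    fix x
    have i: "integrable circ (\<lambda>x'. M x' * k x x')" "integrable circ (\<lambda>x'. M x' * k x' x)"
      by (rule int[of _ "B * K"]; auto intro!: abs_le bM)+
    have "(LINT x'|circ. M x' * (8 * (k x x' + k x' x))) = (LINT x'|circ. 8 * (M x' * k x x') + 8 * (M x' * k x' x))"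
      by (simp add: algebra_simps)
    also have "\<dots> = 8 * (LINT x'|circ. M x' * k x x') + 8 * h x"
      using i by (simp add: h_def)
    finally have e1: "(LINT x'|circ. M x' * (8 * (k x x' + k x' x))) = 8 * (LINT x'|circ. M x' * k x x') + 8 * h x" .
    have e2: "(LINT x'|circ. M x * (M x' * k x x')) = M x * (LINT x'|circ. M x' * k x x')" by simp
    show "M x * (LINT x'|circ. M x' * (8 * (k x x' + k x' x))) = 8 * (LINT x'|circ. M x * (M x' * k x x')) + 8 * (M x * h x)"
      unfolding e1 e2 by (simp only: distrib_left mult.left_commute)
  qed
  also have "\<dots> = 8 * (LINT x|circ. LINT x'|circ. M x * (M x' * k x x')) + 8 * (LINT x|circ. M x * h x)"
  proof -
    have "integrable circ (\<lambda>x. LINT x'|circ. M x * (M x' * k x x'))"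
      by (rule int[of _ "B * (B * K)"]) (auto intro!: abs_le bM integral_circ_bound simp del: Bochner_Integration.integral_mult_right_zero)
    then show ?thesis using ivh by simp
  qed
  also have "(LINT x|circ. LINT x'|circ. M x * (M x' * k x x')) = (LINT x'|circ. LINT x|circ. M x * (M x' * k x x'))"
    by (rule fubini_circ[where B = "B * (B * K)"]) (auto intro!: abs_le bM)
  also have "\<dots> = (LINT x'|circ. M x' * h x')"
    unfolding h_def by (simp add: mult.left_commute flip: Bochner_Integration.integral_mult_right_zero)
  finally have 2: "(LINT y|circ. (h y)\<^sup>2) \<le> 16 * (LINT x|circ. M x * h x)" by simp
  \<comment> \<open>The weights make the term in \<open>h\<close> half of the left-hand side of the previous bound, where it is absorbed; finiteness comes from the boundedness of \<open>M\<close> and of the kernel.\<close>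
  have "(LINT x|circ. M x * h x) \<le> (LINT x|circ. 8 * (M x)\<^sup>2 + (h x)\<^sup>2 / 32)"
  proof (intro integral_mono ivh)
    show "integrable circ (\<lambda>x. 8 * (M x)\<^sup>2 + (h x)\<^sup>2 / 32)" using iM2 ih2 by simp
    show "M x * h x \<le> 8 * (M x)\<^sup>2 + (h x)\<^sup>2 / 32" for x
      using zero_le_power2[of "16 * M x - h x"] by (simp add: power2_eq_square algebra_simps)
  qed
  also have "\<dots> = 8 * (LINT x|circ. (M x)\<^sup>2) + (LINT x|circ. (h x)\<^sup>2) / 32"
    using iM2 ih2 by simp
  finally have 3: "(LINT y|circ. (h y)\<^sup>2) \<le> 256 * (LINT x|circ. (M x)\<^sup>2)" using 2 by simp
  have "(LINT x|circ. v x * h x) \<le> (LINT x|circ. 128 * (v x)\<^sup>2 + (h x)\<^sup>2 / 512)"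
  proof (intro integral_mono ivh)
    show "integrable circ (\<lambda>x. 128 * (v x)\<^sup>2 + (h x)\<^sup>2 / 512)" using iM2 ih2 by simp
    show "v x * h x \<le> 128 * (v x)\<^sup>2 + (h x)\<^sup>2 / 512" for x
      using zero_le_power2[of "256 * v x - h x"] by (simp add: power2_eq_square algebra_simps)
  qed
  also have "\<dots> = 128 * (LINT x|circ. (v x)\<^sup>2) + (LINT x|circ. (h x)\<^sup>2) / 512"
    using iM2 ih2 by simp
  finally show ?thesis using 1 3 by simp
qed

lemma cis_measurable [measurable]: "cis \<in> borel_measurable borel"
  by (intro borel_measurable_continuous_onI continuous_intros)

lemma cnj_measurable [measurable]: "cnj \<in> borel_measurable borel"
  by (intro borel_measurable_continuous_onI continuous_intros)

text \<open>
  For finitely many radii the maximum is attained at a measurable choice of radius, and the Poisson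
  formula at that radius is the linearized operator applied to the boundary modulus.
\<close>

lemma finite_radii_maximal:
  fixes f :: "complex \<Rightarrow> complex" and R :: real
  assumes f: "f holomorphic_on ball 0 1" and R: "0 < R" "R < 1"
    and A: "finite A" "A \<noteq> {}" "A \<subseteq> {0..<1}"
  shows "(LINT t|circ. (Max ((\<lambda>r. cmod (f (of_real r * of_real R * cis t))) ` A))\<^sup>2) \<le> 256 * (LINT t|circ. (cmod (f (R * cis t)))\<^sup>2)"
proof -
  have m: "(\<lambda>t. cmod (f (complex_of_real r * R * cis t))) \<in> borel_measurable borel" if "0 \<le> r" "r < 1" for r
  proof -
    have "r * R \<le> 1 * R" using that R by (intro mult_right_mono) auto
    then have "r * R < 1" using R by linarith
    moreover have "0 \<le> r * R" using that R by auto
    ultimately show ?thesis using holomorphic_circ_measurable(1)[OF f, of "r * R"] by simp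
  qed
  \<comment> \<open>The choice is measurable because each new radius only competes with the previous maximum.\<close>
  have sel: "\<exists>\<rho>\<in>borel_measurable borel. (\<lambda>t. cmod (f (complex_of_real (\<rho> t) * R * cis t))) \<in> borel_measurable borel \<and>
      (\<forall>t. \<rho> t \<in> A \<and> (\<forall>r\<in>A. cmod (f (of_real r * of_real R * cis t)) \<le> cmod (f (complex_of_real (\<rho> t) * R * cis t))))"
    using A
  proof (induction rule: finite_ne_induct)
    case (singleton r)
    then show ?case using m[of r] by (intro bexI[of _ "\<lambda>_. r"]) auto
  next
    case (insert r F)
    then obtain \<rho> where [measurable]: "\<rho> \<in> borel_measurable borel"
      and mp[measurable]: "(\<lambda>t. cmod (f (complex_of_real (\<rho> t) * R * cis t))) \<in> borel_measurable borel"
      and \<rho>: "\<And>t. \<rho> t \<in> F" "\<And>t r. r \<in> F \<Longrightarrow> cmod (f (of_real r * of_real R * cis t)) \<le> cmod (f (complex_of_real (\<rho> t) * R * cis t))"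
      by auto
    define a where "a t = cmod (f (complex_of_real r * R * cis t))" for t
    define b where "b t = cmod (f (complex_of_real (\<rho> t) * R * cis t))" for t
    have [measurable]: "a \<in> borel_measurable borel" "b \<in> borel_measurable borel"
      unfolding a_def b_def using insert.prems m[of r] mp by auto
    define \<rho>' where "\<rho>' t = (if b t \<le> a t then r else \<rho> t)" for t
    have [measurable]: "\<rho>' \<in> borel_measurable borel" unfolding \<rho>'_def by measurable
    have e: "cmod (f (complex_of_real (\<rho>' t) * R * cis t)) = max (b t) (a t)" for t
      by (auto simp: \<rho>'_def a_def b_def)
    show ?case
    proof (intro bexI[of _ \<rho>'] conjI allI ballI)
      show "(\<lambda>t. cmod (f (complex_of_real (\<rho>' t) * R * cis t))) \<in> borel_measurable borel"
        unfolding e by measurable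
      show "\<rho>' t \<in> insert r F" for t using \<rho>(1) by (auto simp: \<rho>'_def)
      show "cmod (f (of_real s * of_real R * cis t)) \<le> cmod (f (complex_of_real (\<rho>' t) * R * cis t))" if "s \<in> insert r F" for s t
        unfolding e a_def b_def using that \<rho>(2)[of s t] by auto
    qed auto
  qed
  then obtain \<rho> where [measurable]: "\<rho> \<in> borel_measurable borel"
      and mp[measurable]: "(\<lambda>t. cmod (f (complex_of_real (\<rho> t) * R * cis t))) \<in> borel_measurable borel"
      and \<rho>: "\<And>t. \<rho> t \<in> A" "\<And>t r. r \<in> A \<Longrightarrow> cmod (f (of_real r * of_real R * cis t)) \<le> cmod (f (complex_of_real (\<rho> t) * R * cis t))"
      by auto
  have eqM: "Max ((\<lambda>r. cmod (f (of_real r * of_real R * cis t))) ` A) = cmod (f (complex_of_real (\<rho> t) * R * cis t))" for t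
    using A \<rho> by (intro Max_eqI) auto
  define v where "v \<phi> = cmod (f (R * cis \<phi>))" for \<phi>
  have [measurable]: "(\<lambda>\<phi>. f (R * cis \<phi>)) \<in> borel_measurable borel"
    using holomorphic_circ_measurable(1)[OF f, of R] R by auto
  have [measurable]: "v \<in> borel_measurable borel" unfolding v_def by measurable
  have \<rho>01: "0 \<le> \<rho> t" "\<rho> t < 1" "\<rho> t \<le> Max A" for t
    using \<rho>(1)[of t] A by (auto intro: Max_ge)
  have MA: "Max A < 1" using A by auto
  have cont: "continuous_on (cball 0 R) f"
    by (rule continuous_on_subset[OF holomorphic_on_imp_continuous_on[OF f]]) (use R in auto)
  have "compact (f ` cball 0 R)" by (rule compact_continuous_image[OF cont]) auto
  then obtain B where B: "\<And>x. x \<in> f ` cball 0 R \<Longrightarrow> norm x \<le> B"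
    using compact_imp_bounded bounded_iff by metis
  have vB: "v \<phi> \<le> B" for \<phi> unfolding v_def using R by (intro B) (auto simp: norm_mult)
  have MB: "cmod (f (complex_of_real (\<rho> t) * R * cis t)) \<le> B" for t
  proof (rule B, rule imageI)
    have "\<rho> t * R \<le> R" using \<rho>01[of t] R by (simp add: mult_left_le_one_le)
    then show "complex_of_real (\<rho> t) * R * cis t \<in> cball 0 R" using \<rho>01[of t] R by (simp add: norm_mult)
  qed
  show ?thesis
    unfolding eqM v_def[symmetric]
  proof (rule linearized_maximal_bound[where B = B and R = "Max A" and \<rho> = \<rho>])
    fix t
    have hol: "(\<lambda>w. f (R * w)) holomorphic_on ball 0 (1 / R)"
    proof -
      have "(f \<circ> (\<lambda>w. R * w)) holomorphic_on ball 0 (1 / R)"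
        by (rule holomorphic_on_compose_gen[OF _ f])
           (use R in \<open>auto intro!: holomorphic_intros simp: norm_mult field_simps\<close>)
      then show ?thesis by (simp add: o_def)
    qed
    have "f (complex_of_real (\<rho> t) * R * cis t) = (LINT \<phi>|circ. f (R * cis \<phi>) * poisson (\<rho> t) (t - \<phi>))"
      using poisson_formula[OF hol, of "\<rho> t" t] R \<rho>01[of t] by (simp add: mult_ac)
    also have "cmod \<dots> \<le> (LINT \<phi>|circ. cmod (f (R * cis \<phi>) * poisson (\<rho> t) (t - \<phi>)))"
      by (rule integral_norm_bound)
    also have "\<dots> = (LINT \<phi>|circ. v \<phi> * poisson (\<rho> t) (t - \<phi>))"
      using poisson_nonneg \<rho>01 by (simp add: norm_mult v_def)
    finally show "cmod (f (complex_of_real (\<rho> t) * R * cis t)) \<le> (LINT \<phi>|circ. v \<phi> * poisson (\<rho> t) (t - \<phi>))" .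
  qed (use \<rho>01 MA vB MB in \<open>auto simp: v_def\<close>)
qed

section \<open>Absolutely convergent power series on the circle\<close>

lemma cis_orthonormal:
  "(LINT t|circ. cis t ^ n * cnj (cis t ^ m)) = (if n = m then 1 else 0)"
proof -
  have ge: "(LINT t|circ. cis t ^ n * cnj (cis t ^ m)) = (if n = m then 1 else 0)" if "m \<le> n" for n m :: nat
  proof -
    have "cis t ^ n * cnj (cis t ^ m) = cis t ^ (n - m)" for t
    proof -
      have "cis t ^ n = cis t ^ (n - m) * cis t ^ m" using that by (simp flip: power_add)
      then show ?thesis by (simp add: cis_cnj Complex.DeMoivre cis_mult)
    qed
    moreover have "(LINT t|circ. cis t ^ (n - m)) = 0 ^ (n - m)"
      using mean_value_circ[of "\<lambda>z. z ^ (n - m)" 2 1, OF holomorphic_on_power[OF holomorphic_on_ident]] by simp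
    ultimately show ?thesis using that by simp
  qed
  show ?thesis
  proof (cases "m \<le> n")
    case False
    have "(LINT t|circ. cis t ^ n * cnj (cis t ^ m)) = (LINT t|circ. cnj (cis t ^ m * cnj (cis t ^ n)))"
      by (simp add: mult.commute)
    also have "\<dots> = cnj (LINT t|circ. cis t ^ m * cnj (cis t ^ n))"
      by (rule Bochner_Integration.integral_cnj)
    finally show ?thesis using ge[of n m] False by simp
  next
    case True
    then show ?thesis by (rule ge)
  qed
qed

lemma power_series_integral:
  fixes c :: "nat \<Rightarrow> complex" and g :: "real \<Rightarrow> complex"
  assumes c: "summable (\<lambda>n. cmod (c n))" and g[measurable]: "g \<in> borel_measurable borel" and B: "\<And>t. cmod (g t) \<le> B"
  shows "(\<lambda>n. c n * (LINT t|circ. cis t ^ n * g t)) sums (LINT t|circ. (\<Sum>n. c n * cis t ^ n) * g t)"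
proof -
  have B0: "0 \<le> B" using B[of 0] norm_ge_zero order_trans by blast
  have s: "summable (\<lambda>n. c n * cis t ^ n)" for t
    by (rule summable_norm_cancel) (use c in \<open>simp add: norm_mult norm_power\<close>)
  have "(\<lambda>n. LINT t|circ. c n * cis t ^ n * g t) sums (LINT t|circ. (\<Sum>n. c n * cis t ^ n * g t))"
  proof (rule sums_integral)
    show i: "integrable circ (\<lambda>t. c n * cis t ^ n * g t)" for n
      by (rule integrable_circ_bounded[of _ "cmod (c n) * B"])
         (use B in \<open>auto simp: norm_mult norm_power intro: mult_left_mono\<close>)
    show "AE t in circ. summable (\<lambda>n. norm (c n * cis t ^ n * g t))"
      using summable_mult2[OF c] by (auto simp: norm_mult norm_power)
    show "summable (\<lambda>n. LINT t|circ. norm (c n * cis t ^ n * g t))"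
    proof (rule summable_comparison_test'[OF summable_mult2[OF c, of B]])
      show "norm (LINT t|circ. norm (c n * cis t ^ n * g t)) \<le> cmod (c n) * B" for n
        unfolding real_norm_def
        by (rule integral_circ_bound) (use B in \<open>auto simp: norm_mult norm_power intro: mult_left_mono\<close>)
    qed
  qed
  moreover have "(\<Sum>n. c n * cis t ^ n * g t) = (\<Sum>n. c n * cis t ^ n) * g t" for t
    using s by (rule suminf_mult2[symmetric])
  ultimately show ?thesis by (simp add: mult.assoc)
qed

lemma power_series_coeff:
  fixes c :: "nat \<Rightarrow> complex"
  assumes c: "summable (\<lambda>n. cmod (c n))"
  shows "(LINT t|circ. (\<Sum>n. c n * cis t ^ n) * cnj (cis t ^ m)) = c m"
proof -
  have "(\<lambda>n. c n * (LINT t|circ. cis t ^ n * cnj (cis t ^ m))) sums (LINT t|circ. (\<Sum>n. c n * cis t ^ n) * cnj (cis t ^ m))"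
    by (rule power_series_integral[OF c, where B = 1]) (auto simp: norm_power)
  moreover have "(\<lambda>n. c n * (LINT t|circ. cis t ^ n * cnj (cis t ^ m))) sums c m"
  proof -
    have "(\<lambda>n. c n * (if n = m then 1 else 0)) = (\<lambda>n. if n = m then c n else 0)" by auto
    then show ?thesis unfolding cis_orthonormal using sums_single[of m c] by (simp only:)
  qed
  ultimately show ?thesis by (rule sums_unique2)
qed

lemma power_series_coeff_neg:
  fixes c :: "nat \<Rightarrow> complex"
  assumes c: "summable (\<lambda>n. cmod (c n))" and "0 < m"
  shows "(LINT t|circ. (\<Sum>n. c n * cis t ^ n) * cis t ^ m) = 0"
proof -
  have "(\<lambda>n. c n * (LINT t|circ. cis t ^ n * cis t ^ m)) sums (LINT t|circ. (\<Sum>n. c n * cis t ^ n) * cis t ^ m)"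
    by (rule power_series_integral[OF c, where B = 1]) (auto simp: norm_power)
  moreover have "(LINT t|circ. cis t ^ n * cis t ^ m) = 0" for n
    using cis_orthonormal[of "n + m" 0] \<open>0 < m\<close> by (simp add: power_add)
  ultimately have "(\<lambda>n. 0) sums (LINT t|circ. (\<Sum>n. c n * cis t ^ n) * cis t ^ m)" by simp
  then show ?thesis using sums_unique2[OF _ sums_zero] by blast
qed

lemma power_series_parseval:
  fixes c :: "nat \<Rightarrow> complex"
  assumes c: "summable (\<lambda>n. cmod (c n))"
  shows "(\<lambda>n. (cmod (c n))\<^sup>2) sums (LINT t|circ. (cmod (\<Sum>n. c n * cis t ^ n))\<^sup>2)"
proof -
  define f where "f t = (\<Sum>n. c n * cis t ^ n)" for t
  have B: "cmod (f t) \<le> (\<Sum>n. cmod (c n))" for t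
    unfolding f_def using summable_norm[of "\<lambda>n. c n * cis t ^ n"] c by (simp add: norm_mult norm_power)
  have [measurable]: "f \<in> borel_measurable borel" unfolding f_def by measurable
  have "(\<lambda>n. c n * (LINT t|circ. cis t ^ n * cnj (f t))) sums (LINT t|circ. f t * cnj (f t))"
    unfolding f_def by (rule power_series_integral[OF c, where B = "\<Sum>n. cmod (c n)"]) (use B in \<open>auto simp: f_def\<close>)
  moreover have "(LINT t|circ. cis t ^ n * cnj (f t)) = cnj (c n)" for n
  proof -
    have "(LINT t|circ. cis t ^ n * cnj (f t)) = (LINT t|circ. cnj (f t * cnj (cis t ^ n)))"
      by (simp add: mult.commute)
    also have "\<dots> = cnj (LINT t|circ. f t * cnj (cis t ^ n))" by (rule Bochner_Integration.integral_cnj)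
    finally show ?thesis using power_series_coeff[OF c, of n] by (simp add: f_def)
  qed
  ultimately have "(\<lambda>n. c n * cnj (c n)) sums (LINT t|circ. f t * cnj (f t))" by simp
  then have "(\<lambda>n. complex_of_real ((cmod (c n))\<^sup>2)) sums (LINT t|circ. complex_of_real ((cmod (f t))\<^sup>2))"
    by (simp only: complex_norm_square)
  then have "(\<lambda>n. complex_of_real ((cmod (c n))\<^sup>2)) sums complex_of_real (LINT t|circ. ((cmod (f t))\<^sup>2))"
    by (simp only: integral_complex_of_real)
  then show ?thesis unfolding sums_of_real_iff f_def .
qed

section \<open>Radial limits of bounded analytic functions\<close>

text \<open>
  By Parseval, the mean square on a circle of radius \<open>R\<close> is at most the tail of the series of squared Taylor
  coefficients, and this series converges because \<open>f\<close> is bounded.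
\<close>

lemma taylor_remainder_mean_square:
  fixes f :: "complex \<Rightarrow> complex"
  assumes f: "f holomorphic_on ball 0 1" and B: "\<And>z. cmod z < 1 \<Longrightarrow> cmod (f z) \<le> B"
  obtains S :: "nat \<Rightarrow> complex \<Rightarrow> complex" and T :: "nat \<Rightarrow> real" where
    "\<And>n. S n holomorphic_on UNIV" "T \<longlonglongrightarrow> 0"
    "\<And>n R. \<lbrakk>0 \<le> R; R < 1\<rbrakk> \<Longrightarrow> (LINT t|circ. (cmod (f (of_real R * cis t) - S n (of_real R * cis t)))\<^sup>2) \<le> T n"
proof -
  define a where "a n = (deriv ^^ n) f 0 / fact n" for n
  have fa: "(\<lambda>n. a n * w ^ n) sums f w" if "cmod w < 1" for w
    using holomorphic_power_series[OF f, of w] that by (simp add: a_def)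
  have abs_a: "summable (\<lambda>n. cmod (a n * of_real R ^ n))" if "0 \<le> R" "R < 1" for R
  proof -
    have "summable (\<lambda>n. norm (a n * (of_real R) ^ n))"
    proof (rule powser_insidea[where x = "of_real ((1 + R) / 2)"])
      show "summable (\<lambda>n. a n * of_real ((1 + R) / 2) ^ n)"
        using fa[of "of_real ((1 + R) / 2)"] that by (simp add: sums_iff del: of_real_divide of_real_add)
      show "norm (complex_of_real R) < norm (complex_of_real ((1 + R) / 2))"
        using that by (simp del: of_real_divide of_real_add)
    qed
    then show ?thesis .
  qed
  define S where "S n w = (\<Sum>m<n. a m * w ^ m)" for n w
  define g where "g n w = f w - S n w" for n w
  define b where "b n m = (if m < n then 0 else a m)" for n m
  have hol_g: "g n holomorphic_on ball 0 1" for n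
    unfolding g_def S_def by (intro holomorphic_intros f)
  have gb: "(\<lambda>m. b n m * w ^ m) sums g n w" if "cmod w < 1" for n w
  proof -
    have "(\<lambda>m. a m * w ^ m - (if m \<in> {..<n} then a m * w ^ m else 0)) sums (f w - S n w)"
      unfolding S_def by (intro sums_diff fa that sums_If_finite_set) auto
    moreover have "(\<lambda>m. a m * w ^ m - (if m \<in> {..<n} then a m * w ^ m else 0)) = (\<lambda>m. b n m * w ^ m)"
      by (auto simp: b_def)
    ultimately show ?thesis by (simp add: g_def)
  qed
  have parseval: "(\<lambda>m. (cmod (b n m))\<^sup>2 * (R ^ m)\<^sup>2) sums (LINT t|circ. (cmod (g n (of_real R * cis t)))\<^sup>2)"
    if R: "0 \<le> R" "R < 1" for n R
  proof -
    define c where "c m = b n m * of_real R ^ m" for m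
    have c: "summable (\<lambda>m. cmod (c m))"
      by (rule summable_comparison_test'[OF abs_a[OF R]]) (auto simp: c_def b_def)
    have "(\<Sum>m. c m * cis t ^ m) = g n (of_real R * cis t)" for t
    proof -
      have "(\<lambda>m. b n m * (of_real R * cis t) ^ m) sums g n (of_real R * cis t)"
        using R by (intro gb) (simp add: norm_mult)
      then show ?thesis by (simp add: c_def sums_iff power_mult_distrib mult.assoc)
    qed
    moreover have "(cmod (c m))\<^sup>2 = (cmod (b n m))\<^sup>2 * (R ^ m)\<^sup>2" for m
      using R by (simp add: c_def norm_mult power_mult_distrib norm_power)
    ultimately show ?thesis
      using power_series_parseval[OF c] by simp
  qed
  have B0: "0 \<le> B" using B[of 0] by (simp add: order_trans[OF norm_ge_zero])
  have partial: "(\<Sum>m<N. (cmod (a m))\<^sup>2) \<le> B\<^sup>2" for N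
  proof (rule tendsto_upperbound)
    show "((\<lambda>R. \<Sum>m<N. (cmod (a m))\<^sup>2 * (R ^ m)\<^sup>2) \<longlongrightarrow> (\<Sum>m<N. (cmod (a m))\<^sup>2)) (at_left 1)"
      by (rule tendsto_eq_intros tendsto_intros refl | simp)+
    show "\<forall>\<^sub>F R in at_left 1. (\<Sum>m<N. (cmod (a m))\<^sup>2 * (R ^ m)\<^sup>2) \<le> B\<^sup>2"
    proof (rule eventually_mono[OF eventually_at_left_real[of 0 1]])
      fix R :: real assume R: "R \<in> {0<..<1}"
      have 1: "(\<lambda>m. (cmod (a m))\<^sup>2 * (R ^ m)\<^sup>2) sums (LINT t|circ. (cmod (f (of_real R * cis t)))\<^sup>2)"
        using parseval[of R 0] R by (simp add: b_def g_def S_def)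
      then have "(\<Sum>m<N. (cmod (a m))\<^sup>2 * (R ^ m)\<^sup>2) \<le> (LINT t|circ. (cmod (f (of_real R * cis t)))\<^sup>2)"
        unfolding sums_iff by (metis (no_types, lifting) sum_le_suminf finite_lessThan mult_nonneg_nonneg zero_le_power2)
      also have "\<dots> \<le> B\<^sup>2"
      proof -
        have [measurable]: "(\<lambda>t. f (of_real R * cis t)) \<in> borel_measurable borel"
          using holomorphic_circ_measurable(1)[OF f, of R] R by auto
        have "cmod (f (of_real R * cis t)) \<le> B" for t using R by (intro B) (simp add: norm_mult)
        then have "\<bar>(LINT t|circ. (cmod (f (of_real R * cis t)))\<^sup>2)\<bar> \<le> B\<^sup>2"
          by (intro integral_circ_bound) (auto intro: power_mono)
        then show ?thesis by simp
      qed
      finally show "(\<Sum>m<N. (cmod (a m))\<^sup>2 * (R ^ m)\<^sup>2) \<le> B\<^sup>2" .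
    qed auto
  qed (simp add: trivial_limit_at_left_real)
  have sum_a: "summable (\<lambda>m. (cmod (a m))\<^sup>2)"
    by (rule summableI_nonneg_bounded[OF _ partial]) auto
  define T where "T n = (\<Sum>m. (cmod (a (m + n)))\<^sup>2)" for n
  have T: "T \<longlonglongrightarrow> 0" unfolding T_def by (rule suminf_exist_split2[OF sum_a])
  have g_le: "(LINT t|circ. (cmod (g n (of_real R * cis t)))\<^sup>2) \<le> T n" if R: "0 \<le> R" "R < 1" for n R
  proof -
    have sb: "(\<lambda>m. (cmod (b n m))\<^sup>2) sums T n"
    proof -
      have "(\<lambda>m. (cmod (b n (m + n)))\<^sup>2) sums T n"
        unfolding T_def b_def using summable_ignore_initial_segment[OF sum_a, of n] by (simp add: summable_sums)
      then show ?thesis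
        by (subst (asm) sums_iff_shift) (simp add: b_def)
    qed
    show ?thesis
    proof (rule sums_le[OF _ parseval[OF R] sb])
      fix m
      have "(R ^ m)\<^sup>2 \<le> 1" using R by (simp add: power_le_one)
      then show "(cmod (b n m))\<^sup>2 * (R ^ m)\<^sup>2 \<le> (cmod (b n m))\<^sup>2" by (simp add: mult_left_le)
    qed
  qed
  show ?thesis
  proof (rule that)
    show "S n holomorphic_on UNIV" for n unfolding S_def by (intro holomorphic_intros)
  qed (use T g_le in \<open>auto simp: g_def\<close>)
qed

text \<open>
  The maximal inequality for finitely many radii does not depend on their number, so monotone convergence gives
  the supremum over all rational radii, and continuity of \<open>g\<close> inside the disk all others.
\<close>

lemma radial_maximal:
  fixes g :: "complex \<Rightarrow> complex" and T :: real
  assumes g: "g holomorphic_on ball 0 1"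
    and le: "\<And>R. \<lbrakk>0 \<le> R; R < 1\<rbrakk> \<Longrightarrow> (LINT t|circ. (cmod (g (of_real R * cis t)))\<^sup>2) \<le> T"
  obtains Y :: "real \<Rightarrow> ennreal" where "Y \<in> borel_measurable borel"
    "(\<integral>\<^sup>+t. Y t \<partial>circ) \<le> ennreal (256 * T)"
    "\<And>r t. \<lbrakk>0 \<le> r; r < 1\<rbrakk> \<Longrightarrow> ennreal ((cmod (g (polar r t)))\<^sup>2) \<le> Y t"
proof -
  define q :: "nat \<Rightarrow> real" where "q = from_nat_into (\<rat> \<inter> {0..<1})"
  have cQ: "countable (\<rat> \<inter> {0..<1::real})" using countable_rat by blast
  have neQ: "\<rat> \<inter> {0..<1::real} \<noteq> {}" by (auto intro: exI[of _ 0])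
  have rq: "range q = \<rat> \<inter> {0..<1}" unfolding q_def by (rule range_from_nat_into[OF neQ cQ])
  have q01: "0 \<le> q i" "q i < 1" for i
    using rangeI[of q i] unfolding rq by auto
  define Q where "Q N = q ` {..N}" for N
  define X where "X N t = (Max ((\<lambda>r. cmod (g (polar r t))) ` Q N))\<^sup>2" for N t
  have finQ: "finite (Q N)" "Q N \<noteq> {}" "Q N \<subseteq> {0..<1}" for N using q01 by (auto simp: Q_def)
  have gm: "(\<lambda>t. cmod (g (polar r t))) \<in> borel_measurable borel" if "r \<in> Q N" for r N
    using holomorphic_circ_measurable(1)[OF g, of r] that finQ(3)[of N] by auto
  have Xm[measurable]: "X N \<in> borel_measurable borel" for N
    unfolding X_def using finQ by (intro borel_measurable_power borel_measurable_Max gm) auto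
  have Xi: "integrable circ (X N)" and X_le: "(LINT t|circ. X N t) \<le> 256 * T" for N
  proof -
    \<comment> \<open>Any \<open>R\<close> between the largest radius and one serves as the boundary of the maximal inequality.\<close>
    define R where "R = (1 + Max (Q N)) / 2"
    have M: "Max (Q N) < 1" "0 \<le> Max (Q N)" using Max_in[OF finQ(1,2)[of N]] finQ(3)[of N] by auto
    then have R: "0 < R" "R < 1" "Max (Q N) < R" by (auto simp: R_def)
    define A where "A = (\<lambda>r. r / R) ` Q N"
    have rR: "r < R" if "r \<in> Q N" for r using that Max_ge[OF finQ(1), of r N] R by simp
    have A: "finite A" "A \<noteq> {}" "A \<subseteq> {0..<1}"
      using finQ[of N] R rR by (auto simp: A_def)
    have "(\<lambda>r. cmod (g (of_real r * of_real R * cis t))) ` A = (\<lambda>r. cmod (g (polar r t))) ` Q N" for t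
      unfolding A_def image_image using R by simp
    then have X: "X N t = (Max ((\<lambda>r. cmod (g (of_real r * of_real R * cis t))) ` A))\<^sup>2" for t
      by (simp add: X_def)
    have "(LINT t|circ. X N t) \<le> 256 * (LINT t|circ. (cmod (g (of_real R * cis t)))\<^sup>2)"
      unfolding X by (rule finite_radii_maximal[OF g R(1,2) A])
    also have "\<dots> \<le> 256 * T" using le[of R] R by simp
    finally show "(LINT t|circ. X N t) \<le> 256 * T" .
    have "\<exists>C. \<forall>r\<in>Q N. \<forall>t. cmod (g (polar r t)) \<le> C"
    proof -
      have "compact (g ` cball 0 R)"
        by (rule compact_continuous_image)
           (use R in \<open>auto intro: continuous_on_subset[OF holomorphic_on_imp_continuous_on[OF g]]\<close>)
      then obtain C where C: "\<And>x. x \<in> g ` cball 0 R \<Longrightarrow> norm x \<le> C"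
        using compact_imp_bounded bounded_iff by metis
      show ?thesis
      proof (intro exI[of _ C] ballI allI)
        fix r t assume "r \<in> Q N"
        then have "of_real r * cis t \<in> cball 0 R" using rR[of r] finQ(3)[of N] by (auto simp: norm_mult)
        then show "cmod (g (polar r t)) \<le> C" by (intro C imageI)
      qed
    qed
    then obtain C where C: "\<And>r t. r \<in> Q N \<Longrightarrow> cmod (g (polar r t)) \<le> C" by blast
    show "integrable circ (X N)"
    proof (rule integrable_circ_bounded[of _ "C\<^sup>2"])
      fix t
      have "Max ((\<lambda>r. cmod (g (polar r t))) ` Q N) \<le> C"
        using finQ C by (subst Max_le_iff) auto
      moreover have "0 \<le> Max ((\<lambda>r. cmod (g (polar r t))) ` Q N)"
        using finQ(1,2)[of N] by (subst Max_ge_iff) auto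
      ultimately show "norm (X N t) \<le> C\<^sup>2" by (auto simp: X_def intro: power_mono)
    qed auto
  qed
  define Y where "Y t = (SUP N. ennreal (X N t))" for t
  have [measurable]: "Y \<in> borel_measurable borel" unfolding Y_def by measurable
  have Y_le: "(\<integral>\<^sup>+t. Y t \<partial>circ) \<le> ennreal (256 * T)"
  proof -
    have inc: "X N t \<le> X N' t" if "N \<le> N'" for N N' t
    proof -
      have "0 \<le> Max ((\<lambda>r. cmod (g (polar r t))) ` Q N)"
        using finQ(1,2)[of N] by (subst Max_ge_iff) auto
      moreover have "Q N \<subseteq> Q N'" using that by (auto simp: Q_def)
      ultimately show ?thesis unfolding X_def using finQ
        by (intro power_mono Max_mono) auto
    qed
    have "(\<integral>\<^sup>+t. Y t \<partial>circ) = (SUP N. \<integral>\<^sup>+t. ennreal (X N t) \<partial>circ)"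
      unfolding Y_def
      by (rule nn_integral_monotone_convergence_SUP) (auto simp: incseq_def le_fun_def intro: ennreal_leI inc)
    also have "\<dots> \<le> ennreal (256 * T)"
    proof (rule SUP_least)
      fix N
      have "(\<integral>\<^sup>+t. ennreal (X N t) \<partial>circ) = ennreal (LINT t|circ. X N t)"
        by (rule nn_integral_eq_integral[OF Xi]) (auto simp: X_def)
      then show "(\<integral>\<^sup>+t. ennreal (X N t) \<partial>circ) \<le> ennreal (256 * T)"
        using X_le[of N] by (simp add: ennreal_leI)
    qed
    finally show ?thesis .
  qed
  have sup: "ennreal ((cmod (g (polar r t)))\<^sup>2) \<le> Y t" if r: "0 \<le> r" "r < 1" for r t
  proof -
    have rat: "ennreal ((cmod (g (of_real s * cis t)))\<^sup>2) \<le> Y t" if "s \<in> \<rat> \<inter> {0..<1}" for s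
    proof -
      obtain N where N: "s = q N" using \<open>s \<in> _\<close> rq by blast
      have "cmod (g (of_real s * cis t)) \<le> Max ((\<lambda>r. cmod (g (polar r t))) ` Q N)"
        using finQ N by (intro Max_ge) (auto simp: Q_def)
      then have "(cmod (g (of_real s * cis t)))\<^sup>2 \<le> X N t" unfolding X_def by (intro power_mono) auto
      then show ?thesis unfolding Y_def by (meson SUP_upper UNIV_I ennreal_leI order_trans)
    qed
    obtain s where s: "\<And>i. s i \<in> \<rat>" "\<And>i. r < s i \<and> s i < 1" "s \<longlonglongrightarrow> r"
    proof -
      have "\<exists>x\<in>\<rat>. r < x \<and> x < min 1 (r + 1 / Suc i)" for i
        using Rats_dense_in_real[of r "min 1 (r + 1 / Suc i)"] r by auto
      then obtain s where s: "\<And>i. s i \<in> \<rat> \<and> r < s i \<and> s i < min 1 (r + 1 / Suc i)" by metis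
      have "s \<longlonglongrightarrow> r"
      proof (rule real_tendsto_sandwich[where f = "\<lambda>_. r" and h = "\<lambda>i. r + 1 / real (Suc i)"])
        show "(\<lambda>i. r + 1 / real (Suc i)) \<longlonglongrightarrow> r" using LIMSEQ_inverse_real_of_nat_add[of r] by (simp add: inverse_eq_divide)
        show "\<forall>\<^sub>F i in sequentially. r \<le> s i" using s by (intro always_eventually) (auto intro: less_imp_le)
        show "\<forall>\<^sub>F i in sequentially. s i \<le> r + 1 / real (Suc i)" using s by (intro always_eventually allI) (meson less_imp_le min_less_iff_conj)
      qed simp
      then show ?thesis using that s by auto
    qed
    have s01: "0 \<le> s i" "s i < 1" for i using s(2)[of i] r by linarith+
    have "(\<lambda>i. g (of_real (s i) * cis t)) \<longlonglongrightarrow> g (polar r t)"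
    proof (rule continuous_on_tendsto_compose[OF holomorphic_on_imp_continuous_on[OF g]])
      show "(\<lambda>i. of_real (s i) * cis t) \<longlonglongrightarrow> of_real r * cis t" by (intro tendsto_intros s)
      show "of_real r * cis t \<in> ball 0 1" using r by (simp add: norm_mult)
      show "\<forall>\<^sub>F i in sequentially. of_real (s i) * cis t \<in> ball 0 1"
        using s01 by (intro always_eventually) (auto simp: norm_mult)
    qed
    then have "(\<lambda>i. ennreal ((cmod (g (of_real (s i) * cis t)))\<^sup>2)) \<longlonglongrightarrow> ennreal ((cmod (g (polar r t)))\<^sup>2)"
      by (intro tendsto_intros)
    moreover have "ennreal ((cmod (g (of_real (s i) * cis t)))\<^sup>2) \<le> Y t" for i
      using s(1) s01 by (intro rat) auto
    ultimately show ?thesis by (blast intro: LIMSEQ_le_const2)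
  qed
  show ?thesis by (rule that[OF _ Y_le sup]) auto
qed

text \<open>
  Fatou's theorem for bounded functions. A Taylor polynomial is continuous up to the boundary, and the radial
  maximal function of the remainder is small in mean square. So at almost every angle the oscillation of \<open>f\<close>
  along the radius drops below any positive bound near the boundary.
\<close>

lemma fatou_bounded:
  fixes f :: "complex \<Rightarrow> complex"
  assumes f: "f holomorphic_on ball 0 1" and B: "\<And>z. cmod z < 1 \<Longrightarrow> cmod (f z) \<le> B"
  shows "AE t in circ. \<exists>l. ((\<lambda>r. f (polar r t)) \<longlongrightarrow> l) (at_left 1)"
proof -
  obtain S :: "nat \<Rightarrow> complex \<Rightarrow> complex" and T :: "nat \<Rightarrow> real" where
    S: "\<And>n. S n holomorphic_on UNIV" and T: "T \<longlonglongrightarrow> 0"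
    and g_le: "\<And>n R. \<lbrakk>0 \<le> R; R < 1\<rbrakk> \<Longrightarrow> (LINT t|circ. (cmod (f (of_real R * cis t) - S n (of_real R * cis t)))\<^sup>2) \<le> T n"
    using taylor_remainder_mean_square[OF f B] by blast
  define g where "g n w = f w - S n w" for n w
  have hol_g: "g n holomorphic_on ball 0 1" for n
    unfolding g_def by (intro holomorphic_on_diff f holomorphic_on_subset[OF S]) auto
  have "\<exists>Y. Y \<in> borel_measurable borel \<and> (\<integral>\<^sup>+t. Y t \<partial>circ) \<le> ennreal (256 * T n) \<and>
      (\<forall>r t. 0 \<le> r \<and> r < 1 \<longrightarrow> ennreal ((cmod (g n (polar r t)))\<^sup>2) \<le> Y t)" for n
    by (rule radial_maximal[OF hol_g[of n], of "T n"]) (use g_le in \<open>auto simp: g_def\<close>)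
  then obtain Y where Y: "\<And>n. Y n \<in> borel_measurable borel" "\<And>n. (\<integral>\<^sup>+t. Y n t \<partial>circ) \<le> ennreal (256 * T n)"
    "\<And>n r t. 0 \<le> r \<Longrightarrow> r < 1 \<Longrightarrow> ennreal ((cmod (g n (polar r t)))\<^sup>2) \<le> Y n t"
    by metis
  note [measurable] = Y(1)
  have "(\<integral>\<^sup>+t. (INF n. Y n t) \<partial>circ) \<le> ennreal (256 * T n)" for n
    by (rule order_trans[OF nn_integral_mono Y(2)]) (auto intro: INF_lower)
  moreover have "(\<lambda>n. ennreal (256 * T n)) \<longlonglongrightarrow> ennreal (256 * 0)"
    by (intro tendsto_intros T)
  ultimately have "(\<integral>\<^sup>+t. (INF n. Y n t) \<partial>circ) \<le> ennreal (256 * 0)"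
    by (intro tendsto_lowerbound) auto
  then have "(\<integral>\<^sup>+t. (INF n. Y n t) \<partial>circ) = 0" by simp
  then have "AE t in circ. (INF n. Y n t) = 0"
    by (subst (asm) nn_integral_0_iff_AE) auto
  then show ?thesis
  proof (rule eventually_mono)
    fix t assume Y0: "(INF n. Y n t) = 0"
    have "cauchy_filter (filtermap (\<lambda>r. f (polar r t)) (at_left 1))"
      unfolding cauchy_filter_metric_filtermap
    proof (intro allI impI)
      fix e :: real assume e: "0 < e"
      have "(INF n. Y n t) < ennreal ((e/4)\<^sup>2)" unfolding Y0 using e by simp
      then obtain n where n: "Y n t < ennreal ((e/4)\<^sup>2)" unfolding INF_less_iff by blast
      have gsmall: "cmod (g n (polar r t)) < e / 4" if "0 \<le> r" "r < 1" for r
      proof -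
        have "ennreal ((cmod (g n (polar r t)))\<^sup>2) < ennreal ((e/4)\<^sup>2)"
          using Y(3)[OF that, where n = n] n by (rule le_less_trans)
        then have "(cmod (g n (polar r t)))\<^sup>2 < (e/4)\<^sup>2" by (simp add: ennreal_less_iff)
        then show ?thesis using e by (intro power_less_imp_less_base[of _ 2 "e/4"]) auto
      qed
      have "((\<lambda>r. S n (polar r t)) \<longlongrightarrow> S n (of_real 1 * cis t)) (at_left 1)"
        by (intro continuous_on_tendsto_compose[OF holomorphic_on_imp_continuous_on[OF S]] tendsto_intros) auto
      then have "\<forall>\<^sub>F r in at_left 1. dist (S n (polar r t)) (S n (of_real 1 * cis t)) < e / 4"
        using e by (intro tendstoD) auto
      moreover have "\<forall>\<^sub>F r in at_left 1. r \<in> {0<..<1::real}" by (rule eventually_at_left_real) auto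
      ultimately have ev: "\<forall>\<^sub>F r in at_left 1. dist (S n (polar r t)) (S n (of_real 1 * cis t)) < e / 4 \<and> r \<in> {0<..<1::real}"
        by (rule eventually_conj)
      show "\<exists>P. eventually P (at_left 1) \<and> (\<forall>x y. P x \<and> P y \<longrightarrow> dist (f (of_real x * cis t)) (f (of_real y * cis t)) < e)"
      proof (intro exI conjI allI impI, rule ev)
        fix x y :: real
        assume P: "(dist (S n (of_real x * cis t)) (S n (of_real 1 * cis t)) < e / 4 \<and> x \<in> {0<..<1}) \<and>
           (dist (S n (of_real y * cis t)) (S n (of_real 1 * cis t)) < e / 4 \<and> y \<in> {0<..<1})"
        have fx: "f w = g n w + S n w" for w by (simp add: g_def)
        have "cmod (g n (of_real x * cis t)) < e/4" "cmod (g n (of_real y * cis t)) < e/4"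
          using P gsmall[of x] gsmall[of y] by auto
        then have "dist (g n (of_real x * cis t)) (g n (of_real y * cis t)) < e/2"
          using norm_triangle_ineq4[of "g n (of_real x * cis t)" "g n (of_real y * cis t)"] by (simp add: dist_norm)
        moreover have "dist (S n (of_real x * cis t)) (S n (of_real y * cis t)) < e/2"
          using P dist_triangle2[of "S n (of_real x * cis t)" "S n (of_real y * cis t)" "S n (of_real 1 * cis t)"] by linarith
        ultimately show "dist (f (of_real x * cis t)) (f (of_real y * cis t)) < e"
          unfolding fx using dist_triangle_add[of "g n (of_real x * cis t)" "S n (of_real x * cis t)" "g n (of_real y * cis t)" "S n (of_real y * cis t)"]
          by linarith
      qed
    qed
    then have "\<exists>c. filtermap (\<lambda>r. f (polar r t)) (at_left 1) \<le> nhds c"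
      by (rule cauchy_filter_complete_converges[where A = UNIV]) (auto simp: complete_UNIV filtermap_bot_iff trivial_limit_at_left_real)
    then show "\<exists>l. ((\<lambda>r. f (polar r t)) \<longlongrightarrow> l) (at_left 1)"
      by (simp add: filterlim_def)
  qed
qed

section \<open>Analytic functions with positive real part\<close>

lemma powr_add_le:
  fixes a b q :: real
  assumes "0 \<le> a" "0 \<le> b" "0 < q" "q \<le> 1"
  shows "(a + b) powr q \<le> a powr q + b powr q"
proof (cases "a + b = 0")
  case True then show ?thesis using assms by (simp add: add_nonneg_eq_0_iff)
next
  case False
  define s where "s = a + b"
  have s: "0 < s" using False assms by (simp add: s_def)
  have le: "x / s \<le> (x / s) powr q" if "0 \<le> x" "x \<le> s" for x
  proof (cases "x = 0")
    case False
    have "(x / s) powr 1 \<le> (x / s) powr q"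
      using that s False assms by (intro powr_mono') auto
    then show ?thesis using that s by simp
  qed simp
  have "1 = a / s + b / s" using s by (simp add: s_def add_divide_distrib[symmetric])
  also have "\<dots> \<le> (a / s) powr q + (b / s) powr q"
    using assms by (intro add_mono le) (auto simp: s_def)
  also have "\<dots> = (a powr q + b powr q) / s powr q"
    using assms s by (simp add: powr_divide add_divide_distrib)
  finally show ?thesis using s by (simp add: s_def pos_le_divide_eq)
qed

lemma powr_sum_le:
  fixes a :: "'a \<Rightarrow> real"
  assumes "finite J" "\<And>j. j \<in> J \<Longrightarrow> 0 \<le> a j" "0 < q" "q \<le> 1"
  shows "(\<Sum>j\<in>J. a j) powr q \<le> (\<Sum>j\<in>J. a j powr q)"
  using assms(1,2)
proof (induction rule: finite_induct)
  case (insert x F)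
  then have "(a x + sum a F) powr q \<le> a x powr q + (sum a F) powr q"
    using assms(3,4) by (intro powr_add_le sum_nonneg) auto
  then show ?case using insert by force
qed simp

text \<open>
  The principal branch of \<open>w\<close> to the power \<open>q\<close>.
\<close>

definition ppow :: "real \<Rightarrow> complex \<Rightarrow> complex" where
  "ppow q w = exp (of_real q * Ln w)"

lemma ppow_holomorphic:
  assumes h: "h holomorphic_on S" and pos: "\<And>z. z \<in> S \<Longrightarrow> 0 < Re (h z)"
  shows "(\<lambda>z. ppow q (h z)) holomorphic_on S"
proof -
  have "(\<lambda>z. Ln (h z)) holomorphic_on S"
    by (rule holomorphic_on_Ln'[OF _ h]) (use pos in \<open>force simp: complex_nonpos_Reals_iff\<close>)
  then have "(exp \<circ> (\<lambda>z. of_real q * Ln (h z))) holomorphic_on S"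
    by (intro holomorphic_on_compose holomorphic_on_mult holomorphic_on_const holomorphic_on_exp)
  then show ?thesis by (simp add: ppow_def o_def)
qed

lemma norm_ppow: "w \<noteq> 0 \<Longrightarrow> cmod (ppow q w) = cmod w powr q"
  by (simp add: ppow_def powr_def)

lemma cos_half_pi_pos: assumes "0 < q" "q < (1::real)" shows "0 < cos (q * pi / 2)"
  using assms by (intro cos_gt_zero_pi) (auto intro: less_le_trans[of _ 0])

text \<open>
  The argument of \<open>w\<close> is less than \<open>pi / 2\<close> in modulus, so that of the power is less than \<open>q pi / 2\<close>.
\<close>

lemma Re_ppow_ge:
  assumes w: "0 < Re w" and q: "0 < q" "q < 1"
  shows "cos (q * pi / 2) * cmod w powr q \<le> Re (ppow q w)"
proof -
  have w0: "w \<noteq> 0" using w by auto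
  define t where "t = Im (Ln w)"
  have "\<bar>t\<bar> < pi / 2" unfolding t_def using Re_Ln_pos_lt[OF w0] w by simp
  then have "\<bar>q * t\<bar> \<le> q * pi / 2" using q by (simp add: abs_mult)
  moreover have "q * pi / 2 \<le> pi" using q by (simp add: mult_le_one field_simps)
  ultimately have "cos (q * pi / 2) \<le> cos \<bar>q * t\<bar>"
    by (intro cos_monotone_0_pi_le) auto
  then have "cos (q * pi / 2) \<le> cos (q * t)" by simp
  moreover have "Re (ppow q w) = cmod (ppow q w) * cos (q * t)"
    by (simp add: ppow_def t_def Re_exp)
  ultimately show ?thesis
    using mult_left_mono[of "cos (q * pi / 2)" "cos (q * t)" "cmod (ppow q w)"] norm_ppow[OF w0, of q]
    by (simp add: mult.commute)
qed

text \<open>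
  The power \<open>h\<^sup>q\<close> is analytic, its real part dominates \<open>|h|\<^sup>q\<close> up to the factor \<open>cos (q pi / 2)\<close>, and the
  mean of the real part is its value at the origin.
\<close>

lemma kolmogorov_moment:
  fixes h :: "complex \<Rightarrow> complex"
  assumes h: "h holomorphic_on ball 0 1" and pos: "\<And>z. cmod z < 1 \<Longrightarrow> 0 < Re (h z)"
    and q: "0 < q" "q < 1" and r: "0 < r" "r < 1"
  shows "(\<integral>\<^sup>+\<theta>. ennreal (cmod (h (polar r \<theta>)) powr q) \<partial>circ) \<le> ennreal (cmod (h 0) powr q / cos (q * pi / 2))"
proof -
  define k where "k z = ppow q (h z)" for z
  have nz: "h z \<noteq> 0" if "cmod z < 1" for z using pos[OF that] by auto
  have k: "k holomorphic_on ball 0 1"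
    unfolding k_def by (rule ppow_holomorphic[OF h]) (use pos in auto)
  have nk: "cmod (k z) = cmod (h z) powr q" if "cmod z < 1" for z
    unfolding k_def by (rule norm_ppow[OF nz[OF that]])
  define c where "c = cos (q * pi / 2)"
  have c: "0 < c" unfolding c_def by (rule cos_half_pi_pos[OF q])
  have Rek: "c * cmod (h z) powr q \<le> Re (k z)" if "cmod z < 1" for z
    unfolding c_def k_def by (rule Re_ppow_ge[OF pos[OF that] q])
  have z: "cmod (polar r \<theta>) < 1" for \<theta> using r by (simp add: norm_mult)
  have [measurable]: "(\<lambda>\<theta>. h (polar r \<theta>)) \<in> borel_measurable borel" "(\<lambda>\<theta>. k (polar r \<theta>)) \<in> borel_measurable borel"
    using holomorphic_circ_measurable(1)[OF h, of r] holomorphic_circ_measurable(1)[OF k, of r] r by auto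
  obtain B where B: "\<And>\<theta>. cmod (k (polar r \<theta>)) \<le> B"
    using holomorphic_circ_measurable(3)[OF k, of r] r by auto
  have ik: "integrable circ (\<lambda>\<theta>. k (polar r \<theta>))" by (rule integrable_circ_bounded[of _ B]) (use B in auto)
  have ih: "integrable circ (\<lambda>\<theta>. cmod (h (polar r \<theta>)) powr q)"
    by (rule integrable_circ_bounded[of _ B]) (use B nk[OF z] in auto)
  have "c * (LINT \<theta>|circ. cmod (h (polar r \<theta>)) powr q) = (LINT \<theta>|circ. c * cmod (h (polar r \<theta>)) powr q)"
    by simp
  also have "\<dots> \<le> (LINT \<theta>|circ. Re (k (polar r \<theta>)))"
    by (intro integral_mono integrable_mult_right ih integrable_Re ik Rek z)
  also have "\<dots> = Re (k 0)"
    using mean_value_circ[OF k r] integral_Re[OF ik] by simp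
  also have "\<dots> \<le> cmod (h 0) powr q"
    using nk[of 0] complex_Re_le_cmod[of "k 0"] by simp
  finally have "(LINT \<theta>|circ. cmod (h (polar r \<theta>)) powr q) \<le> cmod (h 0) powr q / c"
    using c by (simp add: pos_le_divide_eq mult.commute)
  then show ?thesis
    unfolding c_def[symmetric] by (subst nn_integral_eq_integral[OF ih]) (auto intro: ennreal_leI)
qed

lemma radius_seq: "(\<lambda>n. 1 - 1 / real (n + 2)) \<longlonglongrightarrow> 1"
  "filterlim (\<lambda>n. 1 - 1 / real (n + 2)) (at_left 1) sequentially"
  "0 < 1 - 1 / real (n + 2)" "1 - 1 / real (n + 2) < 1"
proof -
  show 1: "(\<lambda>n. 1 - 1 / real (n + 2)) \<longlonglongrightarrow> 1"
  proof -
    have "(\<lambda>n. 1 - 1 / real (Suc (Suc n))) \<longlonglongrightarrow> 1 - 0"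
      by (intro tendsto_intros LIMSEQ_Suc[OF LIMSEQ_Suc[OF lim_1_over_n]])
    then show ?thesis by (simp add: numeral_2_eq_2)
  qed
  then show "filterlim (\<lambda>n. 1 - 1 / real (n + 2)) (at_left 1) sequentially"
    by (auto simp: filterlim_at intro!: always_eventually)
qed (auto simp: field_simps)

text \<open>
  The function \<open>b = 1 / (1 + h)\<close> is bounded, so it has radial limits almost everywhere, and \<open>h\<close> has one
  wherever the limit of \<open>b\<close> is not zero. The limit vanishes only where \<open>|h|\<close> tends to infinity along the radius;
  this set is null because the moments of order one half are bounded.
\<close>

lemma fatou_Re_pos:
  fixes h :: "complex \<Rightarrow> complex"
  assumes h: "h holomorphic_on ball 0 1" and pos: "\<And>z. cmod z < 1 \<Longrightarrow> 0 < Re (h z)"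
  shows "AE \<theta> in circ. \<exists>l. ((\<lambda>r. h (polar r \<theta>)) \<longlongrightarrow> l) (at_left 1)"
proof -
  define b where "b z = 1 / (1 + h z)" for z
  have n1: "1 < cmod (1 + h z)" if "cmod z < 1" for z
    using complex_Re_le_cmod[of "1 + h z"] pos[OF that] by simp
  have nz: "1 + h z \<noteq> 0" if "cmod z < 1" for z using n1[OF that] by auto
  have b: "b holomorphic_on ball 0 1"
    unfolding b_def by (intro holomorphic_intros h) (use nz in auto)
  have b1: "cmod (b z) \<le> 1" if "cmod z < 1" for z
    using n1[OF that] by (simp add: b_def norm_divide divide_le_eq_1)
  define \<rho> where "\<rho> n = 1 - 1 / real (n + 2)" for n :: nat
  have \<rho>: "0 < \<rho> n" "\<rho> n < 1" for n using radius_seq(3,4)[of n] by (auto simp: \<rho>_def)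
  have [measurable]: "(\<lambda>\<theta>. h (of_real (\<rho> n) * cis \<theta>)) \<in> borel_measurable borel" for n
    using holomorphic_circ_measurable(1)[OF h, of "\<rho> n"] \<rho>[of n] by auto
  define C where "C = cmod (h 0) powr (1/2) / cos ((1/2) * pi / 2)"
  define u where "u n \<theta> = ennreal (cmod (h (of_real (\<rho> n) * cis \<theta>)) powr (1/2))" for n \<theta>
  have [measurable]: "u n \<in> borel_measurable borel" for n unfolding u_def by measurable
  have "(\<integral>\<^sup>+\<theta>. liminf (\<lambda>n. u n \<theta>) \<partial>circ) \<le> liminf (\<lambda>n. \<integral>\<^sup>+\<theta>. u n \<theta> \<partial>circ)"
    by (rule nn_integral_liminf) auto
  also have "\<dots> \<le> ennreal C"
  proof (rule Liminf_le[OF _ always_eventually])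
    show "\<forall>n. (\<integral>\<^sup>+\<theta>. u n \<theta> \<partial>circ) \<le> ennreal C"
      unfolding u_def C_def by (intro allI kolmogorov_moment h pos \<rho>) auto
  qed auto
  finally have "(\<integral>\<^sup>+\<theta>. liminf (\<lambda>n. u n \<theta>) \<partial>circ) \<noteq> \<infinity>" by (auto simp: top_unique)
  then have fin: "AE \<theta> in circ. liminf (\<lambda>n. u n \<theta>) \<noteq> \<infinity>"
    by (intro nn_integral_noteq_infinite) auto
  have "AE \<theta> in circ. \<exists>l. ((\<lambda>r. b (polar r \<theta>)) \<longlongrightarrow> l) (at_left 1)"
    by (rule fatou_bounded[OF b b1])
  with fin show ?thesis
  proof eventually_elim
    fix \<theta> assume inf: "liminf (\<lambda>n. u n \<theta>) \<noteq> \<infinity>"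
    assume "\<exists>l. ((\<lambda>r. b (polar r \<theta>)) \<longlongrightarrow> l) (at_left 1)"
    then obtain l where l: "((\<lambda>r. b (polar r \<theta>)) \<longlongrightarrow> l) (at_left 1)" by blast
    have "l \<noteq> 0"
    proof
      assume "l = 0"
      have "(\<lambda>n. b (of_real (\<rho> n) * cis \<theta>)) \<longlonglongrightarrow> 0"
        using filterlim_compose[OF l[unfolded \<open>l = 0\<close>] radius_seq(2)] by (simp add: \<rho>_def)
      then have "filterlim (\<lambda>n. inverse (b (of_real (\<rho> n) * cis \<theta>))) at_infinity sequentially"
        by (intro filterlim_compose[OF filterlim_inverse_at_infinity])
           (auto simp: filterlim_at b_def nz norm_mult \<rho> less_imp_le intro!: always_eventually)
      then have "filterlim (\<lambda>n. 1 + h (of_real (\<rho> n) * cis \<theta>)) at_infinity sequentially"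
        by (simp add: b_def)
      then have "filterlim (\<lambda>n. - 1 + (1 + h (of_real (\<rho> n) * cis \<theta>))) at_infinity sequentially"
        by (rule tendsto_add_filterlim_at_infinity[OF tendsto_const])
      then have "filterlim (\<lambda>n. cmod (h (of_real (\<rho> n) * cis \<theta>))) at_top sequentially"
        by (intro filterlim_at_infinity_imp_norm_at_top) simp
      then have "filterlim (\<lambda>n. cmod (h (of_real (\<rho> n) * cis \<theta>)) powr (1/2)) at_top sequentially"
        unfolding powr_half_sqrt[OF norm_ge_zero] by (rule filterlim_compose[OF sqrt_at_top])
      then have "(\<lambda>n. u n \<theta>) \<longlonglongrightarrow> \<infinity>"
        unfolding u_def by (simp add: ennreal_tendsto_top_eq_at_top)
      then have "liminf (\<lambda>n. u n \<theta>) = \<infinity>" by (intro lim_imp_Liminf) auto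
      then show False using inf by simp
    qed
    have "((\<lambda>r. 1 / b (polar r \<theta>) - 1) \<longlongrightarrow> 1 / l - 1) (at_left 1)"
      by (intro tendsto_intros l \<open>l \<noteq> 0\<close>)
    then show "\<exists>l. ((\<lambda>r. h (polar r \<theta>)) \<longlongrightarrow> l) (at_left 1)"
      by (auto simp: b_def)
  qed
qed

text \<open>
  The integrand is the Poisson kernel at the point \<open>cnj f\<close> times \<open>|h|\<^sup>q\<close>, where
  \<open>h w = (1 - w f) / (1 - |f|\<^sup>2)\<close> has positive real part and \<open>h (cnj f) = 1\<close>. The Poisson formula for the analytic
  function \<open>h\<^sup>q\<close> therefore bounds the mean independently of \<open>f\<close>.
\<close>

lemma kernel_average:
  assumes f: "cmod f < 1" and q: "0 < q" "q < 1"
  shows "(\<integral>\<^sup>+t. ennreal ((1 - (cmod f)\<^sup>2) powr (1 - q) * cmod (1 - cis t * f) powr (q - 2)) \<partial>circ)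
    \<le> ennreal (1 / cos (q * pi / 2))"
proof -
  define r where "r = cmod f"
  define \<beta> where "\<beta> = - Arg f"
  have r: "0 \<le> r" "r < 1" using f by (auto simp: r_def)
  have cf: "cnj f = of_real r * cis \<beta>"
    using rcis_cmod_Arg[of f] unfolding r_def \<beta>_def rcis_def by (metis cis_cnj complex_cnj_complex_of_real complex_cnj_mult)
  have r2: "0 < 1 - r\<^sup>2" using r by (simp add: abs_square_less_1)
  have dist_eq: "cmod (1 - cis t * f) = cmod (cis t - of_real r * cis \<beta>)" for t
  proof -
    have "cnj (cis t - cnj f) * cis t = 1 - cis t * f" by (simp add: algebra_simps cis_cnj cis_mult)
    then have "cmod (1 - cis t * f) = cmod (cnj (cis t - cnj f))" by (metis norm_mult norm_cis mult_1_right)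
    then show ?thesis by (simp only: complex_mod_cnj cf)
  qed
  have ft: "cmod (cis t * f) < 1" for t using f by (simp add: norm_mult)
  have pos: "0 < cmod (1 - cis t * f)" for t using ft[of t] by (metis norm_one zero_less_norm_iff right_minus_eq less_irrefl)
  define \<rho> where "\<rho> = 2 / (1 + r)"
  have \<rho>: "1 < \<rho>" "r * \<rho> < 1" using r by (auto simp: \<rho>_def field_simps)
  define h where "h w = (1 - w * f) / of_real (1 - r\<^sup>2)" for w
  have h: "h holomorphic_on ball 0 \<rho>" unfolding h_def using r2 by (intro holomorphic_intros) auto
  have Reh: "0 < Re (h w)" if "w \<in> ball 0 \<rho>" for w
  proof -
    have "cmod (w * f) \<le> r * \<rho>" using that r unfolding norm_mult r_def[symmetric] by (auto simp: mult.commute[of _ r] intro!: mult_left_mono)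
    then have "Re (w * f) < 1" using complex_Re_le_cmod[of "w * f"] \<rho> by linarith
    then show ?thesis using r2 by (simp add: h_def Re_divide_of_real del: of_real_diff times_complex.sel)
  qed
  define k where "k w = ppow q (h w)" for w
  have k: "k holomorphic_on ball 0 \<rho>" unfolding k_def by (rule ppow_holomorphic[OF h Reh])
  have cis\<rho>: "cis t \<in> ball 0 \<rho>" for t using \<rho> by simp
  have P0: "0 \<le> poisson r t" for t by (rule poisson_nonneg[OF r])
  define c where "c = cos (q * pi / 2)"
  have c: "0 < c" unfolding c_def by (rule cos_half_pi_pos[OF q])
  define G where "G t = (1 - (cmod f)\<^sup>2) powr (1 - q) * cmod (1 - cis t * f) powr (q - 2)" for t
  have G: "G t = cmod (h (cis t)) powr q * poisson r (\<beta> - t)" for t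
  proof -
    have e1: "poisson r (\<beta> - t) = (1 - r\<^sup>2) / (cmod (1 - cis t * f))\<^sup>2"
      unfolding dist_eq poisson_cis[symmetric] using r by (simp add: norm_mult)
    have e2: "cmod (h (cis t)) = cmod (1 - cis t * f) / (1 - r\<^sup>2)"
      using r2 by (simp add: h_def norm_divide del: of_real_diff)
    have gen: "x powr (1 - q) * y powr (q - 2) = (y / x) powr q * (x / y\<^sup>2)" if "0 < x" "0 < y" for x y :: real
      using that by (simp add: powr_divide powr_diff powr_numeral)
    show ?thesis
      unfolding G_def r_def[symmetric] e1 e2 by (rule gen[OF r2 pos])
  qed
  have G0: "0 \<le> G t" for t by (simp add: G_def)
  have Gk: "c * G t \<le> Re (k (cis t) * poisson r (\<beta> - t))" for t
    using mult_right_mono[OF Re_ppow_ge[OF Reh[OF cis\<rho>[of t]] q] P0[of "\<beta> - t"]]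
    unfolding G c_def k_def by (simp add: mult.assoc)
  obtain B where B: "\<And>t. cmod (k (cis t)) \<le> B"
    using holomorphic_circ_measurable(3)[OF k, of 1] \<rho> by auto
  have [measurable]: "(\<lambda>t. k (cis t)) \<in> borel_measurable borel"
    using holomorphic_circ_measurable(1)[OF k, of 1] \<rho> by auto
  have [measurable]: "G \<in> borel_measurable borel" unfolding G_def by measurable
  have ik: "integrable circ (\<lambda>t. k (cis t) * poisson r (\<beta> - t))"
  proof (rule integrable_circ_bounded[where B = "B * (1 / (1 - r)\<^sup>2)"])
    show "norm (k (cis t) * (poisson r (\<beta> - t))) \<le> B * (1 / (1 - r)\<^sup>2)" for t
      unfolding norm_mult using B[of t] poisson_le[of r r "\<beta> - t"] P0[of "\<beta> - t"] r norm_ge_zero[of "k (cis t)"]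
      by (intro mult_mono) (auto simp del: norm_ge_zero)
  qed measurable
  have iG: "integrable circ G"
  proof (rule Bochner_Integration.integrable_bound)
    show "integrable circ (\<lambda>t. Re (k (cis t) * poisson r (\<beta> - t)) / c)" using ik by (intro integrable_divide integrable_Re)
    show "AE t in circ. norm (G t) \<le> norm (Re (k (cis t) * poisson r (\<beta> - t)) / c)"
    proof (intro AE_I2)
      fix t
      have "G t \<le> Re (k (cis t) * poisson r (\<beta> - t)) / c" using Gk[of t] c by (simp only: pos_le_divide_eq mult.commute)
      then show "norm (G t) \<le> norm (Re (k (cis t) * poisson r (\<beta> - t)) / c)"
        using G0[of t] by (metis abs_ge_self abs_of_nonneg order_trans real_norm_def)
    qed
  qed auto
  have "c * (LINT t|circ. G t) = (LINT t|circ. c * G t)" by simp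
  also have "\<dots> \<le> (LINT t|circ. Re (k (cis t) * poisson r (\<beta> - t)))"
    by (intro integral_mono integrable_mult_right iG integrable_Re ik Gk)
  also have "\<dots> = Re (k (of_real r * cis \<beta>))"
    unfolding integral_Re[OF ik] poisson_formula[OF k \<rho>(1) r] ..
  also have "\<dots> = 1"
  proof -
    have ff: "cnj f * f = complex_of_real (r\<^sup>2)" using complex_norm_square[of f] by (simp add: r_def mult.commute)
    have nz: "complex_of_real (1 - r\<^sup>2) \<noteq> 0" using r2 by (simp del: of_real_diff)
    have "h (cnj f) = complex_of_real (1 - r\<^sup>2) / complex_of_real (1 - r\<^sup>2)" unfolding h_def ff by simp
    then have "h (cnj f) = 1" using nz by (simp del: of_real_diff)
    then show ?thesis unfolding cf[symmetric] k_def by (simp add: ppow_def)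
  qed
  finally have "(LINT t|circ. G t) \<le> 1 / c" using c by (simp add: pos_le_divide_eq mult.commute)
  then show ?thesis
    unfolding G_def[symmetric] c_def[symmetric] by (subst nn_integral_eq_integral[OF iG]) (auto simp: G0 intro: ennreal_leI)
qed

section \<open>The CMV operator and its inverse\<close>

text \<open>
  Rows with finitely many nonzero entries: the series in \<open>mat_op\<close> becomes a finite sum, so the operator is linear
  on all sequences and commutes with pointwise convergent series.
\<close>

definition upper_band :: "(nat \<Rightarrow> nat \<Rightarrow> complex) \<Rightarrow> bool" where
  "upper_band A \<longleftrightarrow> (\<forall>i j. i + 2 \<le> j \<longrightarrow> A i j = 0)"

lemma mat_op_upper_band: "upper_band A \<Longrightarrow> mat_op A x i = (\<Sum>j<i+2. A i j * x j)"
  unfolding mat_op_def by (rule suminf_finite) (auto simp: upper_band_def)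

lemma upper_band_L_mat [simp]: "upper_band (L_mat \<alpha>)"
  unfolding upper_band_def L_mat_def by auto

lemma upper_band_M_mat [simp]: "upper_band (M_mat \<alpha>)"
proof -
  have "(i - 1) div 2 \<noteq> (j - 1) div 2" if "i \<noteq> 0" "i + 2 \<le> j" for i j :: nat using that by linarith
  then show ?thesis unfolding upper_band_def M_mat_def by auto
qed

lemma mat_op_lincomb:
  "upper_band A \<Longrightarrow> mat_op A (\<lambda>j. a * x j + b * y j) = (\<lambda>i. a * mat_op A x i + b * mat_op A y i)"
  by (simp add: mat_op_upper_band fun_eq_iff sum.distrib algebra_simps sum_distrib_left)

lemma mat_op_sums:
  assumes "upper_band A" and "\<And>j. (\<lambda>n. f n j) sums s j"
  shows "(\<lambda>n. mat_op A (f n) i) sums mat_op A s i"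
  unfolding mat_op_upper_band[OF assms(1)] by (intro sums_sum sums_mult assms)

lemma L_op_even:
  fixes x :: "nat \<Rightarrow> complex"
  shows "mat_op (L_mat \<alpha>) x (2 * m) = cnj (\<alpha> (2 * m)) * x (2 * m) + rho (\<alpha> (2 * m)) * x (2 * m + 1)"
proof -
  have "mat_op (L_mat \<alpha>) x (2 * m) = (\<Sum>j\<in>{2*m, 2*m+1}. L_mat \<alpha> (2 * m) j * x j)"
    unfolding mat_op_def by (rule suminf_finite) (auto simp: L_mat_def)
  then show ?thesis by (simp add: L_mat_def Theta_def)
qed

lemma L_op_odd:
  fixes x :: "nat \<Rightarrow> complex"
  shows "mat_op (L_mat \<alpha>) x (2 * m + 1) = rho (\<alpha> (2 * m)) * x (2 * m) - \<alpha> (2 * m) * x (2 * m + 1)"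
proof -
  have "mat_op (L_mat \<alpha>) x (2 * m + 1) = (\<Sum>j\<in>{2*m, 2*m+1}. L_mat \<alpha> (2 * m + 1) j * x j)"
    unfolding mat_op_def by (rule suminf_finite) (auto simp: L_mat_def)
  then show ?thesis by (simp add: L_mat_def Theta_def)
qed

lemma M_op_0: "mat_op (M_mat \<alpha>) x 0 = x 0"
proof -
  have "mat_op (M_mat \<alpha>) x 0 = (\<Sum>j\<in>{0}. M_mat \<alpha> 0 j * x j)"
    unfolding mat_op_def by (rule suminf_finite) (auto simp: M_mat_def)
  then show ?thesis by (simp add: M_mat_def)
qed

lemma M_op_odd:
  fixes x :: "nat \<Rightarrow> complex"
  shows "mat_op (M_mat \<alpha>) x (2 * m + 1) = cnj (\<alpha> (2 * m + 1)) * x (2 * m + 1) + rho (\<alpha> (2 * m + 1)) * x (2 * m + 2)"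
proof -
  have "M_mat \<alpha> (2 * m + 1) j = 0" if "j \<notin> {2*m+1, 2*m+2}" for j
  proof -
    have "j = 0 \<or> (j - 1) div 2 \<noteq> m" using that by (cases j) auto
    then show ?thesis by (auto simp: M_mat_def)
  qed
  then have "mat_op (M_mat \<alpha>) x (2 * m + 1) = (\<Sum>j\<in>{2*m+1, 2*m+2}. M_mat \<alpha> (2 * m + 1) j * x j)"
    unfolding mat_op_def by (intro suminf_finite) auto
  then show ?thesis by (simp add: M_mat_def Theta_def)
qed

lemma M_op_even:
  fixes x :: "nat \<Rightarrow> complex"
  shows "mat_op (M_mat \<alpha>) x (2 * m + 2) = rho (\<alpha> (2 * m + 1)) * x (2 * m + 1) - \<alpha> (2 * m + 1) * x (2 * m + 2)"
proof -
  have "M_mat \<alpha> (2 * m + 2) j = 0" if "j \<notin> {2*m+1, 2*m+2}" for j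
  proof -
    have "j = 0 \<or> (j - 1) div 2 \<noteq> m" using that by (cases j) auto
    then show ?thesis by (auto simp: M_mat_def)
  qed
  then have "mat_op (M_mat \<alpha>) x (2 * m + 2) = (\<Sum>j\<in>{2*m+1, 2*m+2}. M_mat \<alpha> (2 * m + 2) j * x j)"
    unfolding mat_op_def by (intro suminf_finite) auto
  then show ?thesis by (simp add: M_mat_def Theta_def)
qed

lemma even_odd_cases: obtains m where "i = 2 * m" | m where "i = 2 * m + (1::nat)"
  by (metis evenE oddE)

lemma zero_odd_even_cases: obtains "i = 0" | m where "i = 2 * m + 1" | m where "i = 2 * m + (2::nat)"
proof (cases i rule: even_odd_cases)
  case (1 m) then show ?thesis using that by (cases m) auto
qed (use that in auto)

definition disk_seq :: "(nat \<Rightarrow> complex) \<Rightarrow> bool" where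
  "disk_seq \<alpha> \<longleftrightarrow> (\<forall>j. cmod (\<alpha> j) < 1)"

definition conj_seq :: "(nat \<Rightarrow> complex) \<Rightarrow> (nat \<Rightarrow> complex)" where
  "conj_seq \<alpha> = (\<lambda>j. cnj (\<alpha> j))"

lemma rho_cnj [simp]: "rho (cnj a) = rho a"
  by (simp add: rho_def)

lemma rho_sq: "cmod a < 1 \<Longrightarrow> complex_of_real (rho a) * complex_of_real (rho a) = 1 - a * cnj a"
proof -
  assume "cmod a < 1"
  then have "rho a * rho a = 1 - (cmod a)\<^sup>2"
    by (simp add: rho_def power_le_one real_sqrt_mult[symmetric] flip: power2_eq_square)
  then have "complex_of_real (rho a * rho a) = 1 - complex_of_real ((cmod a)\<^sup>2)" by simp
  then show ?thesis by (simp only: complex_norm_square of_real_mult)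
qed

lemma conj_seq_conj_seq [simp]: "conj_seq (conj_seq \<alpha>) = \<alpha>"
  by (simp add: conj_seq_def)

lemma disk_seq_conj [simp]: "disk_seq (conj_seq \<alpha>) = disk_seq \<alpha>"
  by (simp add: disk_seq_def conj_seq_def)

lemma L_inverse: assumes "disk_seq \<alpha>" shows "mat_op (L_mat \<alpha>) (mat_op (L_mat (conj_seq \<alpha>)) x) = x"
proof
  fix i
  have r: "complex_of_real (rho (\<alpha> j)) * complex_of_real (rho (\<alpha> j)) = 1 - \<alpha> j * cnj (\<alpha> j)" for j
    using assms by (intro rho_sq) (auto simp: disk_seq_def)
  show "mat_op (L_mat \<alpha>) (mat_op (L_mat (conj_seq \<alpha>)) x) i = x i"
  proof (cases i rule: even_odd_cases)
    case (1 m)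
    show ?thesis using r[of "2*m"] by (simp add: 1 conj_seq_def L_op_even L_op_odd[simplified]) algebra
  next
    case (2 m)
    show ?thesis using r[of "2*m"] by (simp add: 2 conj_seq_def L_op_even L_op_odd[simplified]) algebra
  qed
qed

lemma M_inverse: assumes "disk_seq \<alpha>" shows "mat_op (M_mat \<alpha>) (mat_op (M_mat (conj_seq \<alpha>)) x) = x"
proof
  fix i
  have r: "complex_of_real (rho (\<alpha> j)) * complex_of_real (rho (\<alpha> j)) = 1 - \<alpha> j * cnj (\<alpha> j)" for j
    using assms by (intro rho_sq) (auto simp: disk_seq_def)
  show "mat_op (M_mat \<alpha>) (mat_op (M_mat (conj_seq \<alpha>)) x) i = x i"
  proof (cases i rule: zero_odd_even_cases)
    case 1 then show ?thesis by (simp add: M_op_0)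
  next
    case (2 m)
    show ?thesis using r[of "2*m+1"] by (simp add: 2 conj_seq_def M_op_even[simplified] M_op_odd[simplified]) algebra
  next
    case (3 m)
    show ?thesis using r[of "2*m+1"] by (simp add: 3 conj_seq_def M_op_even[simplified] M_op_odd[simplified]) algebra
  qed
qed

text \<open>
  The blocks satisfy \<open>\<Theta>(a) \<Theta>(cnj a) = 1\<close>, so conjugating the coefficients inverts \<open>L\<close> and \<open>M\<close>, and
  the inverse is defined on all sequences rather than only on \<open>ell2\<close>.
\<close>

definition cmv_inv :: "(nat \<Rightarrow> complex) \<Rightarrow> (nat \<Rightarrow> complex) \<Rightarrow> (nat \<Rightarrow> complex)" where
  "cmv_inv \<alpha> x = mat_op (M_mat (conj_seq \<alpha>)) (mat_op (L_mat (conj_seq \<alpha>)) x)"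

lemma cmv_cmv_inv: "disk_seq \<alpha> \<Longrightarrow> cmv \<alpha> (cmv_inv \<alpha> x) = x"
  by (simp add: cmv_def cmv_inv_def L_inverse M_inverse)

lemma cmv_inv_cmv: "disk_seq \<alpha> \<Longrightarrow> cmv_inv \<alpha> (cmv \<alpha> x) = x"
  using L_inverse[of "conj_seq \<alpha>"] M_inverse[of "conj_seq \<alpha>"]
  by (simp add: cmv_def cmv_inv_def)

lemma cmv_lincomb: "cmv \<alpha> (\<lambda>j. a * x j + b * y j) = (\<lambda>i. a * cmv \<alpha> x i + b * cmv \<alpha> y i)"
  by (simp add: cmv_def mat_op_lincomb)

lemma cmv_inv_lincomb: "cmv_inv \<alpha> (\<lambda>j. a * x j + b * y j) = (\<lambda>i. a * cmv_inv \<alpha> x i + b * cmv_inv \<alpha> y i)"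
  by (simp add: cmv_inv_def mat_op_lincomb)

lemma cmv_inv_sums: "(\<And>j. (\<lambda>n. f n j) sums s j) \<Longrightarrow> (\<lambda>n. cmv_inv \<alpha> (f n) i) sums cmv_inv \<alpha> s i"
  unfolding cmv_inv_def by (intro mat_op_sums) auto

definition normsq :: "(nat \<Rightarrow> complex) \<Rightarrow> real" where
  "normsq x = (\<Sum>j. (cmod (x j))\<^sup>2)"

lemma theta_isometry:
  fixes a x y :: complex
  assumes "cmod a < 1"
  shows "(cmod (cnj a * x + rho a * y))\<^sup>2 + (cmod (rho a * x - a * y))\<^sup>2 = (cmod x)\<^sup>2 + (cmod y)\<^sup>2"
proof -
  have "complex_of_real ((cmod (cnj a * x + rho a * y))\<^sup>2 + (cmod (rho a * x - a * y))\<^sup>2) = complex_of_real ((cmod x)\<^sup>2 + (cmod y)\<^sup>2)"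
    unfolding of_real_add complex_norm_square using rho_sq[OF assms] by simp algebra
  then show ?thesis by (simp only: of_real_eq_iff)
qed

lemma L_partial:
  assumes "disk_seq \<alpha>"
  shows "(\<Sum>j<2*m. (cmod (mat_op (L_mat \<alpha>) x j))\<^sup>2) = (\<Sum>j<2*m. (cmod (x j))\<^sup>2)"
proof (induction m)
  case (Suc m)
  have e: "{..<2 * Suc m} = insert (2*m+1) (insert (2*m) {..<2*m})" by auto
  show ?case
    unfolding e using Suc theta_isometry[of "\<alpha> (2*m)" "x (2*m)" "x (2*m+1)"] assms
    by (simp del: One_nat_def add: L_op_even L_op_odd disk_seq_def)
qed simp

lemma M_partial:
  assumes "disk_seq \<alpha>"
  shows "(\<Sum>j<2*m+1. (cmod (mat_op (M_mat \<alpha>) x j))\<^sup>2) = (\<Sum>j<2*m+1. (cmod (x j))\<^sup>2)"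
proof (induction m)
  case (Suc m)
  have e: "{..<2 * Suc m + 1} = insert (2*m+2) (insert (2*m+1) {..<2*m+1})" by auto
  show ?case
    unfolding e using Suc theta_isometry[of "\<alpha> (2*m+1)" "x (2*m+1)" "x (2*m+2)"] assms
    by (simp add: M_op_even[simplified] M_op_odd[simplified] disk_seq_def)
qed (simp add: M_op_0)

text \<open>
  The blocks of \<open>L\<close> and \<open>M\<close> preserve the partial sums of squares only at the ends of blocks; a subsequence of
  partial sums suffices.
\<close>

lemma ell2_isometryI:
  fixes \<phi> :: "nat \<Rightarrow> nat"
  assumes x: "x \<in> ell2" and \<phi>: "strict_mono \<phi>"
    and eq: "\<And>m. (\<Sum>j<\<phi> m. (cmod (y j))\<^sup>2) = (\<Sum>j<\<phi> m. (cmod (x j))\<^sup>2)"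
  shows "y \<in> ell2" "normsq y = normsq x"
proof -
  have sx: "summable (\<lambda>j. (cmod (x j))\<^sup>2)" using x by (simp add: ell2_def)
  have "(\<Sum>j<m. (cmod (y j))\<^sup>2) \<le> normsq x" for m
  proof -
    have "m \<le> \<phi> m" using \<phi> by (rule seq_suble)
    then have "(\<Sum>j<m. (cmod (y j))\<^sup>2) \<le> (\<Sum>j<\<phi> m. (cmod (y j))\<^sup>2)"
      by (intro sum_mono2) auto
    also have "\<dots> \<le> normsq x" unfolding eq normsq_def by (rule sum_le_suminf[OF sx]) auto
    finally show ?thesis .
  qed
  then have sy: "summable (\<lambda>j. (cmod (y j))\<^sup>2)" by (intro summableI_nonneg_bounded) auto
  then show "y \<in> ell2" by (simp add: ell2_def)
  have "(\<lambda>m. \<Sum>j<\<phi> m. (cmod (y j))\<^sup>2) \<longlonglongrightarrow> normsq y"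
    unfolding normsq_def by (rule LIMSEQ_subseq_LIMSEQ[OF summable_LIMSEQ[OF sy] \<phi>, unfolded o_def])
  moreover have "(\<lambda>m. \<Sum>j<\<phi> m. (cmod (y j))\<^sup>2) \<longlonglongrightarrow> normsq x"
    unfolding normsq_def eq by (rule LIMSEQ_subseq_LIMSEQ[OF summable_LIMSEQ[OF sx] \<phi>, unfolded o_def])
  ultimately show "normsq y = normsq x" by (rule LIMSEQ_unique)
qed

lemma L_isometry:
  assumes "disk_seq \<alpha>" "x \<in> ell2"
  shows "mat_op (L_mat \<alpha>) x \<in> ell2" "normsq (mat_op (L_mat \<alpha>) x) = normsq x"
  using ell2_isometryI[OF assms(2) _ L_partial[OF assms(1)]] by (auto simp: strict_mono_def)

lemma M_isometry:
  assumes "disk_seq \<alpha>" "x \<in> ell2"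
  shows "mat_op (M_mat \<alpha>) x \<in> ell2" "normsq (mat_op (M_mat \<alpha>) x) = normsq x"
  using ell2_isometryI[OF assms(2) _ M_partial[OF assms(1)]] by (auto simp: strict_mono_def)

lemma cmv_inv_isometry:
  assumes "disk_seq \<alpha>" "x \<in> ell2"
  shows "cmv_inv \<alpha> x \<in> ell2" "normsq (cmv_inv \<alpha> x) = normsq x"
  using assms by (simp_all add: cmv_inv_def L_isometry M_isometry)

lemma cmv_isometry:
  assumes "disk_seq \<alpha>" "x \<in> ell2"
  shows "cmv \<alpha> x \<in> ell2" "normsq (cmv \<alpha> x) = normsq x"
  using assms by (simp_all add: cmv_def L_isometry M_isometry)

lemma cmv_inv_pow_isometry:
  assumes "disk_seq \<alpha>" "x \<in> ell2"
  shows "(cmv_inv \<alpha> ^^ n) x \<in> ell2" "normsq ((cmv_inv \<alpha> ^^ n) x) = normsq x"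
  by (induction n) (use assms cmv_inv_isometry in auto)

lemma cmv_pow_isometry:
  assumes "disk_seq \<alpha>" "x \<in> ell2"
  shows "(cmv \<alpha> ^^ n) x \<in> ell2" "normsq ((cmv \<alpha> ^^ n) x) = normsq x"
  by (induction n) (use assms cmv_isometry in auto)

lemma ell2_scale:
  assumes "x \<in> ell2"
  shows "(\<lambda>j. a * x j) \<in> ell2" "normsq (\<lambda>j. a * x j) = (cmod a)\<^sup>2 * normsq x"
  using assms by (simp_all add: ell2_def normsq_def norm_mult power_mult_distrib suminf_mult summable_mult)

lemma ell2_add:
  assumes "x \<in> ell2" "y \<in> ell2" shows "(\<lambda>j. x j + y j) \<in> ell2"
proof -
  have sum: "summable (\<lambda>j. 2 * (cmod (x j))\<^sup>2 + 2 * (cmod (y j))\<^sup>2)"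
    using assms by (intro summable_add summable_mult) (auto simp: ell2_def)
  have "norm ((cmod (x j + y j))\<^sup>2) \<le> 2 * (cmod (x j))\<^sup>2 + 2 * (cmod (y j))\<^sup>2" for j
  proof -
    have "(cmod (x j + y j))\<^sup>2 \<le> (cmod (x j) + cmod (y j))\<^sup>2" by (intro power_mono norm_triangle_ineq) auto
    also have "\<dots> \<le> 2 * (cmod (x j))\<^sup>2 + 2 * (cmod (y j))\<^sup>2"
      using zero_le_power2[of "cmod (x j) - cmod (y j)"] by (simp add: power2_eq_square algebra_simps)
    finally show ?thesis by simp
  qed
  then show ?thesis unfolding ell2_def mem_Collect_eq by (rule summable_comparison_test'[OF sum])
qed

lemma ell2_finite: "finite S \<Longrightarrow> (\<And>j. j \<notin> S \<Longrightarrow> v j = 0) \<Longrightarrow> v \<in> ell2"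
  unfolding ell2_def by (auto intro: summable_finite[of S])

lemma normsq_finite: "finite S \<Longrightarrow> (\<And>j. j \<notin> S \<Longrightarrow> v j = 0) \<Longrightarrow> normsq v = (\<Sum>j\<in>S. (cmod (v j))\<^sup>2)"
  unfolding normsq_def by (intro suminf_finite) auto

lemma basis_vec_ell2 [simp]: "basis_vec l \<in> ell2" "normsq (basis_vec l) = 1"
  using ell2_finite[of "{l}" "basis_vec l"] normsq_finite[of "{l}" "basis_vec l"] by (auto simp: basis_vec_def)

lemma normsq_diff_finite:
  assumes x: "x \<in> ell2" and S: "finite S" "\<And>j. j \<notin> S \<Longrightarrow> v j = 0"
  shows "normsq (\<lambda>j. x j - v j) = normsq x - 2 * Re (\<Sum>j\<in>S. cnj (v j) * x j) + normsq v"
proof -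
  define d where "d j = (if j \<in> S then - 2 * Re (cnj (v j) * x j) + (cmod (v j))\<^sup>2 else 0)" for j
  have e: "(cmod (x j - v j))\<^sup>2 = (cmod (x j))\<^sup>2 + d j" for j
  proof -
    have "(cmod (x j - v j))\<^sup>2 = (cmod (x j))\<^sup>2 - 2 * Re (cnj (v j) * x j) + (cmod (v j))\<^sup>2"
      unfolding cmod_power2 by (simp add: power2_eq_square algebra_simps)
    then show ?thesis using S(2) by (auto simp: d_def)
  qed
  have "d sums (\<Sum>j\<in>S. d j)" by (rule sums_finite[OF S(1)]) (simp add: d_def)
  moreover have "(\<lambda>j. (cmod (x j))\<^sup>2) sums normsq x"
    using x by (simp add: ell2_def normsq_def summable_sums)
  ultimately have "(\<lambda>j. (cmod (x j))\<^sup>2 + d j) sums (normsq x + (\<Sum>j\<in>S. d j))" by (intro sums_add)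
  then have "normsq (\<lambda>j. x j - v j) = normsq x + (\<Sum>j\<in>S. d j)" unfolding normsq_def e by (simp add: sums_iff normsq_def)
  moreover have "(\<Sum>j\<in>S. d j) = - 2 * Re (\<Sum>j\<in>S. cnj (v j) * x j) + normsq v"
  proof -
    have "(\<Sum>j\<in>S. d j) = (\<Sum>j\<in>S. - 2 * Re (cnj (v j) * x j)) + (\<Sum>j\<in>S. (cmod (v j))\<^sup>2)"
      unfolding sum.distrib[symmetric] by (rule sum.cong) (auto simp: d_def)
    moreover have "normsq v = (\<Sum>j\<in>S. (cmod (v j))\<^sup>2)" by (rule normsq_finite) (use S in auto)
    ultimately show ?thesis by (simp only: Re_sum sum_distrib_left)
  qed
  ultimately show ?thesis by simp
qed

lemma entry_le_normsq: "x \<in> ell2 \<Longrightarrow> (cmod (x k))\<^sup>2 \<le> normsq x"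
  using sum_le_suminf[of "\<lambda>j. (cmod (x j))\<^sup>2" "{k}"] by (auto simp: ell2_def normsq_def)

lemma normsq_nonneg: "x \<in> ell2 \<Longrightarrow> 0 \<le> normsq x"
  using entry_le_normsq[of x 0] by (meson order_trans zero_le_power2)

definition inv_entry :: "(nat \<Rightarrow> complex) \<Rightarrow> nat \<Rightarrow> nat \<Rightarrow> nat \<Rightarrow> complex" where
  "inv_entry \<alpha> n k l = (cmv_inv \<alpha> ^^ n) (basis_vec l) k"

lemma cmv_inv_pow_lincomb: "(cmv_inv \<alpha> ^^ n) (\<lambda>j. a * x j + b * y j) = (\<lambda>i. a * (cmv_inv \<alpha> ^^ n) x i + b * (cmv_inv \<alpha> ^^ n) y i)"
  by (induction n) (simp_all add: cmv_inv_lincomb)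

lemma cmv_inv_pow_cmv_pow: "disk_seq \<alpha> \<Longrightarrow> (cmv_inv \<alpha> ^^ n) ((cmv \<alpha> ^^ n) x) = x"
proof (induction n arbitrary: x)
  case (Suc n)
  have "(cmv_inv \<alpha> ^^ Suc n) ((cmv \<alpha> ^^ Suc n) x) = (cmv_inv \<alpha> ^^ n) (cmv_inv \<alpha> (cmv \<alpha> ((cmv \<alpha> ^^ n) x)))"
    by (simp add: funpow_swap1)
  then show ?case using Suc by (simp add: cmv_inv_cmv)
qed simp

text \<open>
  Unitarity without an inner product: apply \<open>W\<^sup>n\<close> to \<open>\<delta>\<^sub>k + c C\<^sup>n \<delta>\<^sub>l\<close>, which has the same norm as
  \<open>W\<^sup>n \<delta>\<^sub>k + c \<delta>\<^sub>l\<close>, and compare the cross terms for \<open>c = 1\<close> and \<open>c = \<i>\<close>.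
\<close>

lemma cmv_pow_entry_conj:
  assumes "disk_seq \<alpha>"
  shows "(cmv \<alpha> ^^ n) (basis_vec l) k = cnj (inv_entry \<alpha> n l k)"
proof -
  define B where "B = (cmv \<alpha> ^^ n) (basis_vec l)"
  define A where "A = (cmv_inv \<alpha> ^^ n) (basis_vec k)"
  have B: "B \<in> ell2" "normsq B = 1" unfolding B_def by (simp_all add: cmv_pow_isometry assms)
  have A: "A \<in> ell2" "normsq A = 1" unfolding A_def by (simp_all add: cmv_inv_pow_isometry assms)
  have eq: "Re (cnj c * A l) = Re (c * B k)" for c
  proof -
    define u where "u = (\<lambda>j. 1 * basis_vec k j + c * B j)"
    have u: "u \<in> ell2" unfolding u_def using B by (intro ell2_add ell2_scale) auto
    have Wu: "(cmv_inv \<alpha> ^^ n) u = (\<lambda>j. A j - (- c) * basis_vec l j)"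
      unfolding u_def cmv_inv_pow_lincomb by (simp add: A_def B_def cmv_inv_pow_cmv_pow assms)
    have s1: "(\<lambda>j. (- c) * basis_vec l j) j = 0" if "j \<notin> {l}" for j using that by (simp add: basis_vec_def)
    have s2: "(\<lambda>j. - basis_vec k j) j = 0" if "j \<notin> {k}" for j using that by (simp add: basis_vec_def)
    have 1: "normsq ((cmv_inv \<alpha> ^^ n) u) = normsq A - 2 * Re (\<Sum>j\<in>{l}. cnj ((- c) * basis_vec l j) * A j) + normsq (\<lambda>j. (- c) * basis_vec l j)"
      unfolding Wu by (rule normsq_diff_finite[OF A(1)]) (use s1 in auto)
    have uu: "u = (\<lambda>j. c * B j - (- basis_vec k j))" by (auto simp: u_def)
    have 2: "normsq u = normsq (\<lambda>j. c * B j) - 2 * Re (\<Sum>j\<in>{k}. cnj (- basis_vec k j) * (c * B j)) + normsq (\<lambda>j. - basis_vec k j)"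
      unfolding uu by (rule normsq_diff_finite[OF ell2_scale(1)[OF B(1)]]) (use s2 in auto)
    have n2s: "normsq (\<lambda>j. - c * (if j = l then 1 else 0)) = (cmod c)\<^sup>2"
      using ell2_scale(2)[of "basis_vec l" "- c"] basis_vec_ell2[of l] unfolding basis_vec_def by simp
    have "normsq (\<lambda>j. - basis_vec k j) = 1" using ell2_scale(2)[of "basis_vec k" "-1"] by simp
    then show ?thesis
      using 1 2 cmv_inv_pow_isometry(2)[OF assms u, of n] A B
        ell2_scale(2)[OF B(1), of c] n2s
      by (simp add: basis_vec_def)
  qed
  have "Re (A l) = Re (B k)" "Im (A l) = - Im (B k)" using eq[of 1] eq[of \<i>] by simp_all
  then show ?thesis by (simp add: complex_eq_iff A_def B_def inv_entry_def)
qed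

lemma inv_entry_le:
  assumes "disk_seq \<alpha>"
  shows "cmod (inv_entry \<alpha> n k l) \<le> 1"
proof (rule power2_le_imp_le)
  show "(cmod (inv_entry \<alpha> n k l))\<^sup>2 \<le> 1\<^sup>2"
    using entry_le_normsq[OF cmv_inv_pow_isometry(1)[OF assms basis_vec_ell2(1)], of n l k]
    by (simp only: cmv_inv_pow_isometry(2)[OF assms basis_vec_ell2(1)] basis_vec_ell2(2) inv_entry_def one_power2)
qed simp

lemma cmv_inv_into:
  assumes "disk_seq \<alpha>" "y \<in> ell2"
  shows "inv_into ell2 (cmv \<alpha>) y = cmv_inv \<alpha> y"
proof (rule inv_into_f_eq)
  show "inj_on (cmv \<alpha>) ell2"
    by (rule inj_on_inverseI[of _ "cmv_inv \<alpha>"]) (simp add: cmv_inv_cmv assms)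
qed (simp_all add: cmv_inv_isometry cmv_cmv_inv assms)

lemma cmv_power_entry_eq:
  assumes "disk_seq \<alpha>"
  shows "cmv_power_entry \<alpha> n k l = (if n \<ge> 0 then cnj (inv_entry \<alpha> (nat n) l k) else inv_entry \<alpha> (nat (- n)) k l)"
proof -
  have "(inv_into ell2 (cmv \<alpha>) ^^ m) (basis_vec l) = (cmv_inv \<alpha> ^^ m) (basis_vec l)" for m
    by (induction m) (use assms cmv_inv_pow_isometry cmv_inv_into in auto)
  then show ?thesis
    using cmv_pow_entry_conj[OF assms] by (simp add: cmv_power_entry_def cmv_power_def inv_entry_def)
qed

section \<open>The resolvent inside the disk\<close>

text \<open>
  The Neumann series of \<open>(1 - z W)\<^sup>-\<^sup>1 v\<close>.
\<close>

definition res_vec :: "(nat \<Rightarrow> complex) \<Rightarrow> complex \<Rightarrow> (nat \<Rightarrow> complex) \<Rightarrow> nat \<Rightarrow> complex" where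
  "res_vec \<alpha> z v k = (\<Sum>n. (cmv_inv \<alpha> ^^ n) v k * z ^ n)"

lemma res_vec_summable:
  assumes "disk_seq \<alpha>" "v \<in> ell2" "cmod z < 1"
  shows "summable (\<lambda>n. cmod ((cmv_inv \<alpha> ^^ n) v k * z ^ n))"
proof (rule summable_comparison_test')
  show "summable (\<lambda>n. sqrt (normsq v) * cmod z ^ n)"
    using assms by (intro summable_mult summable_geometric) auto
  show "norm (cmod ((cmv_inv \<alpha> ^^ n) v k * z ^ n)) \<le> sqrt (normsq v) * cmod z ^ n" for n
    using entry_le_normsq[of "(cmv_inv \<alpha> ^^ n) v" k] cmv_inv_pow_isometry[OF assms(1,2), of n]
    by (auto simp: norm_mult norm_power intro!: mult_right_mono real_le_rsqrt)
qed

lemma res_vec_sums: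
  assumes "disk_seq \<alpha>" "v \<in> ell2" "cmod z < 1"
  shows "(\<lambda>n. (cmv_inv \<alpha> ^^ n) v k * z ^ n) sums res_vec \<alpha> z v k"
  unfolding res_vec_def by (rule summable_sums[OF summable_norm_cancel[OF res_vec_summable[OF assms]]])

lemma res_vec_eq:
  assumes "disk_seq \<alpha>" "v \<in> ell2" "cmod z < 1"
  shows "res_vec \<alpha> z v k = v k + z * cmv_inv \<alpha> (res_vec \<alpha> z v) k"
proof -
  have lin: "cmv_inv \<alpha> (\<lambda>j. (cmv_inv \<alpha> ^^ n) v j * z ^ n) k = (cmv_inv \<alpha> ^^ Suc n) v k * z ^ n" for n
    using cmv_inv_lincomb[of \<alpha> "z ^ n" "(cmv_inv \<alpha> ^^ n) v" 0 "\<lambda>_. 0"] by (simp add: mult.commute fun_eq_iff)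
  have "(\<lambda>n. cmv_inv \<alpha> (\<lambda>j. (cmv_inv \<alpha> ^^ n) v j * z ^ n) k) sums cmv_inv \<alpha> (res_vec \<alpha> z v) k"
    by (intro cmv_inv_sums res_vec_sums assms)
  then have "(\<lambda>n. (cmv_inv \<alpha> ^^ Suc n) v k * z ^ Suc n) sums (z * cmv_inv \<alpha> (res_vec \<alpha> z v) k)"
    unfolding lin using sums_mult[of _ _ z] by (fastforce simp: mult_ac)
  then have "(\<lambda>n. (cmv_inv \<alpha> ^^ n) v k * z ^ n) sums (z * cmv_inv \<alpha> (res_vec \<alpha> z v) k + (cmv_inv \<alpha> ^^ 0) v k * z ^ 0)"
    by (rule sums_Suc)
  then show ?thesis using sums_unique2[OF res_vec_sums[OF assms, of k]] by simp
qed

text \<open>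
  Minkowski's inequality for finitely many coordinates and finitely many terms, followed by two limits; the
  bound is the geometric series.
\<close>

lemma res_vec_ell2:
  assumes "disk_seq \<alpha>" "v \<in> ell2" "cmod z < 1"
  shows "res_vec \<alpha> z v \<in> ell2"
proof -
  define C where "C = sqrt (normsq v) * (1 / (1 - cmod z))"
  have part: "L2_set (\<lambda>j. cmod (\<Sum>n<N. (cmv_inv \<alpha> ^^ n) v j * z ^ n)) {..<J} \<le> (\<Sum>n<N. sqrt (normsq v) * cmod z ^ n)" for N J
  proof (induction N)
    case (Suc N)
    have "L2_set (\<lambda>j. cmod (\<Sum>n<Suc N. (cmv_inv \<alpha> ^^ n) v j * z ^ n)) {..<J}
       \<le> L2_set (\<lambda>j. cmod (\<Sum>n<N. (cmv_inv \<alpha> ^^ n) v j * z ^ n) + cmod ((cmv_inv \<alpha> ^^ N) v j) * cmod z ^ N) {..<J}"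
      by (intro L2_set_mono) (auto intro: order_trans[OF norm_triangle_ineq] simp: norm_mult norm_power)
    also have "\<dots> \<le> L2_set (\<lambda>j. cmod (\<Sum>n<N. (cmv_inv \<alpha> ^^ n) v j * z ^ n)) {..<J}
        + L2_set (\<lambda>j. cmod ((cmv_inv \<alpha> ^^ N) v j) * cmod z ^ N) {..<J}"
      by (rule L2_set_triangle_ineq)
    also have "L2_set (\<lambda>j. cmod ((cmv_inv \<alpha> ^^ N) v j) * cmod z ^ N) {..<J} = L2_set (\<lambda>j. cmod ((cmv_inv \<alpha> ^^ N) v j)) {..<J} * cmod z ^ N"
      by (simp add: L2_set_left_distrib)
    also have "L2_set (\<lambda>j. cmod ((cmv_inv \<alpha> ^^ N) v j)) {..<J} \<le> sqrt (normsq v)"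
    proof -
      have "(\<Sum>j<J. (cmod ((cmv_inv \<alpha> ^^ N) v j))\<^sup>2) \<le> normsq ((cmv_inv \<alpha> ^^ N) v)"
        unfolding normsq_def using cmv_inv_pow_isometry(1)[OF assms(1,2), of N]
        by (intro sum_le_suminf) (auto simp: ell2_def)
      then show ?thesis using cmv_inv_pow_isometry(2)[OF assms(1,2), of N] by (simp add: L2_set_def)
    qed
    finally show ?case using Suc by (simp add: mult_right_mono)
  qed (simp add: L2_set_def)
  have geo: "(\<Sum>n<N. sqrt (normsq v) * cmod z ^ n) \<le> C" for N
  proof -
    have "(\<Sum>n<N. cmod z ^ n) \<le> (\<Sum>n. cmod z ^ n)"
      by (rule sum_le_suminf) (use assms in auto)
    also have "\<dots> = 1 / (1 - cmod z)" using assms by (intro suminf_geometric) auto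
    finally show ?thesis
      unfolding C_def sum_distrib_left[symmetric] by (rule mult_left_mono) (simp add: normsq_nonneg assms)
  qed
  have C0: "0 \<le> C" using geo[of 0] by simp
  have "(\<Sum>j<J. (cmod (res_vec \<alpha> z v j))\<^sup>2) \<le> C\<^sup>2" for J
  proof (rule LIMSEQ_le_const2)
    show "(\<lambda>N. \<Sum>j<J. (cmod (\<Sum>n<N. (cmv_inv \<alpha> ^^ n) v j * z ^ n))\<^sup>2) \<longlonglongrightarrow> (\<Sum>j<J. (cmod (res_vec \<alpha> z v j))\<^sup>2)"
      by (intro tendsto_sum tendsto_power tendsto_norm) (use res_vec_sums[OF assms] in \<open>simp add: sums_def\<close>)
    have "(\<Sum>j<J. (cmod (\<Sum>n<N. (cmv_inv \<alpha> ^^ n) v j * z ^ n))\<^sup>2) \<le> C\<^sup>2" for N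
    proof -
      have "L2_set (\<lambda>j. cmod (\<Sum>n<N. (cmv_inv \<alpha> ^^ n) v j * z ^ n)) {..<J} \<le> C"
        using part geo order_trans by blast
      then show ?thesis unfolding L2_set_def using C0 by (simp add: real_sqrt_le_iff' sum_nonneg)
    qed
    then show "\<exists>N. \<forall>n\<ge>N. (\<Sum>j<J. (cmod (\<Sum>n<n. (cmv_inv \<alpha> ^^ n) v j * z ^ n))\<^sup>2) \<le> C\<^sup>2" by blast
  qed
  then show ?thesis unfolding ell2_def mem_Collect_eq by (intro summableI_nonneg_bounded) auto
qed

text \<open>
  For \<open>x = (1 - z W)\<^sup>-\<^sup>1 v\<close> the vector \<open>x - v = z W x\<close> has squared norm \<open>|z|\<^sup>2\<close> times that of \<open>x\<close>; expand the
  norm of \<open>x - v\<close>. The right-hand side makes the Poisson extension positive.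
\<close>

lemma res_vec_energy:
  assumes "disk_seq \<alpha>" "cmod z < 1" and S: "finite S" "\<And>j. j \<notin> S \<Longrightarrow> v j = 0"
  shows "2 * Re (\<Sum>j\<in>S. cnj (v j) * res_vec \<alpha> z v j) - normsq v = (1 - (cmod z)\<^sup>2) * normsq (res_vec \<alpha> z v)"
proof -
  define x where "x = res_vec \<alpha> z v"
  have v: "v \<in> ell2" using S by (rule ell2_finite)
  have x: "x \<in> ell2" unfolding x_def by (intro res_vec_ell2 assms v)
  have "(\<lambda>j. x j - v j) = (\<lambda>j. z * cmv_inv \<alpha> x j)"
    using res_vec_eq[OF assms(1) v assms(2)] by (simp add: x_def fun_eq_iff)
  then have "normsq (\<lambda>j. x j - v j) = (cmod z)\<^sup>2 * normsq x"
    using ell2_scale(2)[OF cmv_inv_isometry(1)[OF assms(1) x], of z] cmv_inv_isometry(2)[OF assms(1) x] by simp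
  moreover have "normsq (\<lambda>j. x j - v j) = normsq x - 2 * Re (\<Sum>j\<in>S. cnj (v j) * x j) + normsq v"
    by (rule normsq_diff_finite[OF x S])
  ultimately show ?thesis unfolding x_def[symmetric] by (simp add: left_diff_distrib)
qed

lemma carF_eq:
  assumes \<alpha>: "disk_seq \<alpha>" and z: "cmod z < 1"
  shows "carF \<alpha> k l z = 2 * res_vec \<alpha> z (basis_vec l) k - basis_vec l k"
proof -
  define x where "x = res_vec \<alpha> z (basis_vec l)"
  have x: "x \<in> ell2" unfolding x_def by (intro res_vec_ell2 assms) simp
  have xe: "x j = basis_vec l j + z * cmv_inv \<alpha> x j" for j unfolding x_def by (intro res_vec_eq assms) simp
  have "cmv_resolvent \<alpha> z (basis_vec l) = cmv_inv \<alpha> x"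
    unfolding cmv_resolvent_def
  proof (rule inv_into_f_eq)
    show "cmv_inv \<alpha> x \<in> ell2" by (rule cmv_inv_isometry(1)[OF \<alpha> x])
    show "(\<lambda>j. cmv \<alpha> (cmv_inv \<alpha> x) j - z * cmv_inv \<alpha> x j) = basis_vec l"
      unfolding cmv_cmv_inv[OF \<alpha>] using xe by (simp add: fun_eq_iff)
    show "inj_on (\<lambda>x j. cmv \<alpha> x j - z * x j) ell2"
    proof (rule inj_onI)
      fix a b assume ab: "a \<in> ell2" "b \<in> ell2" and e: "(\<lambda>j. cmv \<alpha> a j - z * a j) = (\<lambda>j. cmv \<alpha> b j - z * b j)"
      define d where "d = (\<lambda>j. 1 * a j + (-1) * b j)"
      have d: "d \<in> ell2" unfolding d_def by (intro ell2_add ell2_scale ab)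
      have "cmv \<alpha> d = (\<lambda>j. z * d j)"
        unfolding d_def cmv_lincomb using e by (auto simp: fun_eq_iff algebra_simps)
      then have "normsq d = (cmod z)\<^sup>2 * normsq d" using cmv_isometry(2)[OF \<alpha> d] ell2_scale(2)[OF d, of z] by simp
      moreover have "(cmod z)\<^sup>2 < 1" using z by (simp add: power_less_one_iff abs_square_less_1)
      ultimately have "normsq d = 0" by (metis mult_cancel_right1 order_less_irrefl)
      then have "d j = 0" for j using entry_le_normsq[OF d, of j] by simp
      then show "a = b" by (simp add: d_def fun_eq_iff)
    qed
  qed
  then show ?thesis
    unfolding carF_def Let_def by (simp add: cmv_cmv_inv[OF \<alpha>]) (use xe[of k] in \<open>simp add: x_def algebra_simps\<close>)
qed

section \<open>Rotating the tail of the coefficients\<close>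

text \<open>
  The diagonal of \<open>1 + (u - 1) |\<delta>\<^sub>l><\<delta>\<^sub>l|\<close>.
\<close>

definition kick :: "nat \<Rightarrow> complex \<Rightarrow> nat \<Rightarrow> complex" where
  "kick l u = (\<lambda>j. if j = l then u else 1)"

text \<open>
  In each block \<open>\<Theta>(u a)\<close> differs from \<open>\<Theta>(a)\<close> by phases on the rows and columns. Choosing the phases
  alternately on even and odd sites makes those of consecutive blocks of \<open>L\<close> and \<open>M\<close> cancel, except at the
  site \<open>l\<close> where the rotation begins; what is left there is the factor \<open>kick l u\<close>. The parity of \<open>l\<close> decides whether
  \<open>\<alpha>\<^sub>l\<close> sits in \<open>L\<close> or in \<open>M\<close>, which is why the phases depend on it.
\<close>

lemma T_rot_factors:
  assumes u: "cmod u = 1"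
  obtains d e :: "nat \<Rightarrow> complex" where
    "\<And>j. cnj (d j) * d j = 1" "\<And>j. cnj (e j) * e j = 1"
    "\<And>x. mat_op (L_mat (conj_seq (T_rot l u \<alpha>))) x =
       (\<lambda>i. cnj (e i) * mat_op (L_mat (conj_seq \<alpha>)) (\<lambda>j. kick l u j * (cnj (d j) * x j)) i)"
    "\<And>x. mat_op (M_mat (conj_seq (T_rot l u \<alpha>))) x =
       (\<lambda>i. d i * mat_op (M_mat (conj_seq \<alpha>)) (\<lambda>j. e j * x j) i)"
proof -
  have uu: "cnj u * u = 1" "u * cnj u = 1"
    using u by (metis complex_norm_square mult.commute of_real_1 one_power2)+
  have uu': "cnj u * (u * y) = y" "u * (cnj u * y) = y" for y
    using uu by (simp_all flip: mult.assoc)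
  have rho_u: "rho (u * a) = rho a" "rho (cnj u * a) = rho a" for a using u by (simp_all add: rho_def norm_mult)
  define d where "d j = (if odd l then (if l \<le> j \<and> odd j then u else 1) else (if l < j \<and> even j then cnj u else 1))" for j
  define e where "e j = (if odd l then (if l \<le> j \<and> even j then cnj u else 1) else (if l \<le> j \<and> odd j then u else 1))" for j
  have d: "cnj (d j) * d j = 1" and e: "cnj (e j) * e j = 1" for j
    using uu by (auto simp: d_def e_def)
  note defs = d_def e_def kick_def conj_seq_def T_rot_def rho_u
  have L: "mat_op (L_mat (conj_seq (T_rot l u \<alpha>))) x i =
       cnj (e i) * mat_op (L_mat (conj_seq \<alpha>)) (\<lambda>j. kick l u j * (cnj (d j) * x j)) i" for x i
  proof (cases i rule: even_odd_cases)
    case (1 m)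
    consider "2 * m < l" "Suc (2 * m) \<noteq> l" | "Suc (2 * m) = l" | "2 * m = l" | "l < 2 * m" by linarith
    then show ?thesis
      unfolding 1 L_op_even by cases (auto simp: defs uu uu' algebra_simps)
  next
    case (2 m)
    consider "2 * m < l" "Suc (2 * m) \<noteq> l" | "Suc (2 * m) = l" | "2 * m = l" | "l < 2 * m" by linarith
    then show ?thesis
      unfolding 2 L_op_odd by cases (auto simp: defs uu uu' algebra_simps)
  qed
  have M: "mat_op (M_mat (conj_seq (T_rot l u \<alpha>))) x i =
       d i * mat_op (M_mat (conj_seq \<alpha>)) (\<lambda>j. e j * x j) i" for x i
  proof (cases i rule: zero_odd_even_cases)
    case 1
    then show ?thesis by (cases "l = 0") (auto simp: M_op_0 defs)
  next
    case (2 m)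
    consider "2 * m + 1 < l" "Suc (Suc (2 * m)) \<noteq> l" | "Suc (Suc (2 * m)) = l" | "Suc (2 * m) = l" | "l < Suc (2 * m)" by linarith
    then show ?thesis
      unfolding 2 M_op_odd by cases (auto simp: defs uu uu' algebra_simps)
  next
    case (3 m)
    consider "2 * m + 1 < l" "Suc (Suc (2 * m)) \<noteq> l" | "Suc (Suc (2 * m)) = l" | "Suc (2 * m) = l" | "l < Suc (2 * m)" by linarith
    then show ?thesis
      unfolding 3 M_op_even by cases (auto simp: defs uu uu' algebra_simps)
  qed
  show ?thesis by (rule that[of d e]) (use d e L M in \<open>auto simp: fun_eq_iff\<close>)
qed

definition kicked_inv :: "(nat \<Rightarrow> complex) \<Rightarrow> nat \<Rightarrow> complex \<Rightarrow> (nat \<Rightarrow> complex) \<Rightarrow> (nat \<Rightarrow> complex)" where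
  "kicked_inv \<alpha> l u x = cmv_inv \<alpha> (\<lambda>j. kick l u j * x j)"

text \<open>
  The inner phases \<open>e\<close> cancel in the product of the two factors, and the outer phases \<open>d\<close> conjugate.
\<close>

lemma inv_entry_T_rot:
  assumes u: "cmod u = 1"
  obtains d :: "nat \<Rightarrow> complex" where "\<And>j. cnj (d j) * d j = 1"
    "\<And>n k m. inv_entry (T_rot l u \<alpha>) n k m = d k * cnj (d m) * (kicked_inv \<alpha> l u ^^ n) (basis_vec m) k"
proof -
  obtain d e where d: "\<And>j. cnj (d j) * d j = 1" and e: "\<And>j. cnj (e j) * e j = 1"
    and L: "\<And>x. mat_op (L_mat (conj_seq (T_rot l u \<alpha>))) x =
       (\<lambda>i. cnj (e i) * mat_op (L_mat (conj_seq \<alpha>)) (\<lambda>j. kick l u j * (cnj (d j) * x j)) i)"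
    and M: "\<And>x. mat_op (M_mat (conj_seq (T_rot l u \<alpha>))) x =
       (\<lambda>i. d i * mat_op (M_mat (conj_seq \<alpha>)) (\<lambda>j. e j * x j) i)"
    using T_rot_factors[OF u] by blast
  have e': "e j * (cnj (e j) * y) = y" and d': "cnj (d j) * (d j * y) = y" for j y
    using e[of j] d[of j] by (simp_all flip: mult.assoc add: mult.commute[of "e j"])
  have 1: "cmv_inv (T_rot l u \<alpha>) x = (\<lambda>i. d i * kicked_inv \<alpha> l u (\<lambda>j. cnj (d j) * x j) i)" for x
    unfolding cmv_inv_def kicked_inv_def L M by (simp add: e')
  have 2: "(cmv_inv (T_rot l u \<alpha>) ^^ n) x = (\<lambda>i. d i * (kicked_inv \<alpha> l u ^^ n) (\<lambda>j. cnj (d j) * x j) i)" for n x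
    by (induction n) (simp_all add: 1 d' flip: mult.assoc, simp_all add: d mult.commute[of "d _"])
  have lin: "kicked_inv \<alpha> l u (\<lambda>j. a * x j) = (\<lambda>j. a * kicked_inv \<alpha> l u x j)" for a x
    using cmv_inv_lincomb[of \<alpha> a "\<lambda>j. kick l u j * x j" 0 "\<lambda>_. 0"] by (simp add: kicked_inv_def mult.left_commute)
  have lin_pow: "(kicked_inv \<alpha> l u ^^ n) (\<lambda>j. a * x j) = (\<lambda>j. a * (kicked_inv \<alpha> l u ^^ n) x j)" for n a x
    by (induction n) (simp_all add: lin)
  have "(\<lambda>j. cnj (d j) * basis_vec m j) = (\<lambda>j. cnj (d m) * basis_vec m j)" for m
    by (auto simp: basis_vec_def)
  then have "inv_entry (T_rot l u \<alpha>) n k m = d k * cnj (d m) * (kicked_inv \<alpha> l u ^^ n) (basis_vec m) k" for n k m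
    unfolding inv_entry_def 2 by (simp add: lin_pow)
  with d show ?thesis using that by blast
qed

text \<open>
  The perturbation has rank one: multiplication by \<open>kick l u\<close> adds \<open>(u - 1) x\<^sub>l \<delta>\<^sub>l\<close> to a vector \<open>x\<close>. Sorting by the
  time of the last such addition gives a discrete renewal equation.
\<close>

lemma kicked_inv_renewal:
  "(kicked_inv \<alpha> l u ^^ n) (basis_vec m) k =
     inv_entry \<alpha> n k m + (u - 1) * (\<Sum>j<n. (kicked_inv \<alpha> l u ^^ j) (basis_vec m) l * inv_entry \<alpha> (n - j) k l)"
proof -
  define b where "b n = (kicked_inv \<alpha> l u ^^ n) (basis_vec m)" for n
  have step: "kicked_inv \<alpha> l u x = (\<lambda>k. cmv_inv \<alpha> x k + (u - 1) * x l * cmv_inv \<alpha> (basis_vec l) k)" for x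
  proof -
    have s: "(\<lambda>j. kick l u j * x j) = (\<lambda>j. 1 * x j + ((u - 1) * x l) * basis_vec l j)"
      by (auto simp: kick_def basis_vec_def algebra_simps)
    show ?thesis unfolding kicked_inv_def s cmv_inv_lincomb by simp
  qed
  have lin_sum: "cmv_inv \<alpha> (\<lambda>k. \<Sum>j<n. a j * f j k) = (\<lambda>k. \<Sum>j<n. a j * cmv_inv \<alpha> (f j) k)" for n and a :: "nat \<Rightarrow> complex" and f
  proof (induction n)
    case 0
    then show ?case using cmv_inv_lincomb[of \<alpha> 0 "\<lambda>_. 0" 0 "\<lambda>_. 0"] by simp
  next
    case (Suc n)
    then show ?case using cmv_inv_lincomb[of \<alpha> 1 "\<lambda>k. \<Sum>j<n. a j * f j k" "a n" "f n"] by simp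
  qed
  have "b n = (\<lambda>k. (cmv_inv \<alpha> ^^ n) (basis_vec m) k + (u - 1) * (\<Sum>j<n. b j l * (cmv_inv \<alpha> ^^ (n - j)) (basis_vec l) k))"
  proof (induction n)
    case 0
    then show ?case by (simp add: b_def)
  next
    case (Suc n)
    have "cmv_inv \<alpha> (b n) = (\<lambda>k. (cmv_inv \<alpha> ^^ Suc n) (basis_vec m) k + (u - 1) * (\<Sum>j<n. b j l * (cmv_inv \<alpha> ^^ Suc (n - j)) (basis_vec l) k))"
      by (subst Suc) (use cmv_inv_lincomb[of \<alpha> 1 "(cmv_inv \<alpha> ^^ n) (basis_vec m)" "u - 1"] in \<open>simp add: lin_sum\<close>)
    moreover have "b (Suc n) = kicked_inv \<alpha> l u (b n)" by (simp add: b_def)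
    ultimately have "b (Suc n) = (\<lambda>k. (cmv_inv \<alpha> ^^ Suc n) (basis_vec m) k + (u - 1) * (\<Sum>j<n. b j l * (cmv_inv \<alpha> ^^ Suc (n - j)) (basis_vec l) k)
        + (u - 1) * b n l * cmv_inv \<alpha> (basis_vec l) k)"
      by (simp add: step)
    moreover have "(\<Sum>j<n. b j l * (cmv_inv \<alpha> ^^ Suc (n - j)) (basis_vec l) k) = (\<Sum>j<n. b j l * (cmv_inv \<alpha> ^^ (Suc n - j)) (basis_vec l) k)" for k
      by (rule sum.cong) (auto simp: Suc_diff_le)
    ultimately show ?case by (simp add: algebra_simps)
  qed
  then show ?thesis unfolding b_def inv_entry_def by (rule fun_cong)
qed

definition Res :: "(nat \<Rightarrow> complex) \<Rightarrow> complex \<Rightarrow> nat \<Rightarrow> nat \<Rightarrow> complex" where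
  "Res \<alpha> z k l = (\<Sum>n. inv_entry \<alpha> n k l * z ^ n)"

lemma Res_eq_res_vec: "Res \<alpha> z k l = res_vec \<alpha> z (basis_vec l) k"
  by (simp add: Res_def res_vec_def inv_entry_def)

lemma Res_summable: "disk_seq \<alpha> \<Longrightarrow> cmod z < 1 \<Longrightarrow> summable (\<lambda>n. cmod (inv_entry \<alpha> n k l * z ^ n))"
  unfolding inv_entry_def by (rule res_vec_summable) auto

lemma Res_sums: "disk_seq \<alpha> \<Longrightarrow> cmod z < 1 \<Longrightarrow> (\<lambda>n. inv_entry \<alpha> n k l * z ^ n) sums Res \<alpha> z k l"
  unfolding Res_def by (rule summable_sums[OF summable_norm_cancel[OF Res_summable]])

text \<open>
  The diagonal and the off-diagonal entries of \<open>R + R\<^sup>* - 1\<close>, the Poisson extension of the spectral measures.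
  The diagonal ones are real, and no identity term is left off the diagonal.
\<close>

definition Pdiag :: "(nat \<Rightarrow> complex) \<Rightarrow> complex \<Rightarrow> nat \<Rightarrow> real" where
  "Pdiag \<alpha> z k = 2 * Re (Res \<alpha> z k k) - 1"

definition Poff :: "(nat \<Rightarrow> complex) \<Rightarrow> complex \<Rightarrow> nat \<Rightarrow> nat \<Rightarrow> complex" where
  "Poff \<alpha> z k l = Res \<alpha> z k l + cnj (Res \<alpha> z l k)"

text \<open>
  The energy identity for \<open>v = a \<delta>\<^sub>k + b \<delta>\<^sub>l\<close>; strict because the resolvent of a nonzero vector is nonzero.
\<close>

lemma quadratic_form_pos:
  assumes \<alpha>: "disk_seq \<alpha>" and z: "cmod z < 1" and kl: "k \<noteq> l" and ab: "a \<noteq> 0 \<or> b \<noteq> 0"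
  shows "0 < (cmod a)\<^sup>2 * Pdiag \<alpha> z k + (cmod b)\<^sup>2 * Pdiag \<alpha> z l + 2 * Re (cnj a * b * Poff \<alpha> z k l)"
proof -
  define v where "v j = a * basis_vec k j + b * basis_vec l j" for j
  have S: "finite {k, l}" "\<And>j. j \<notin> {k, l} \<Longrightarrow> v j = 0" by (auto simp: v_def basis_vec_def)
  have vkl: "v k = a" "v l = b" using kl by (auto simp: v_def basis_vec_def)
  have v2: "v \<in> ell2" using S by (rule ell2_finite)
  have r: "res_vec \<alpha> z v j = a * Res \<alpha> z j k + b * Res \<alpha> z j l" for j
  proof -
    have "(\<lambda>n. a * (inv_entry \<alpha> n j k * z ^ n) + b * (inv_entry \<alpha> n j l * z ^ n)) sums (a * Res \<alpha> z j k + b * Res \<alpha> z j l)"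
      by (intro sums_add sums_mult Res_sums \<alpha> z)
    moreover have "(cmv_inv \<alpha> ^^ n) v j * z ^ n = a * (inv_entry \<alpha> n j k * z ^ n) + b * (inv_entry \<alpha> n j l * z ^ n)" for n
      unfolding v_def cmv_inv_pow_lincomb inv_entry_def by (simp add: algebra_simps)
    ultimately have "(\<lambda>n. (cmv_inv \<alpha> ^^ n) v j * z ^ n) sums (a * Res \<alpha> z j k + b * Res \<alpha> z j l)" by simp
    then show ?thesis using sums_unique2[OF res_vec_sums[OF \<alpha> v2 z]] by blast
  qed
  have n2v: "normsq v = (cmod a)\<^sup>2 + (cmod b)\<^sup>2"
    using normsq_finite[of "{k,l}" v] S(2) kl vkl by simp
  have x: "res_vec \<alpha> z v \<in> ell2" by (intro res_vec_ell2 \<alpha> v2 z)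
  have "normsq (res_vec \<alpha> z v) \<noteq> 0"
  proof
    assume "normsq (res_vec \<alpha> z v) = 0"
    then have 0: "res_vec \<alpha> z v j = 0" for j using entry_le_normsq[OF x, of j] by simp
    then have "res_vec \<alpha> z v = (\<lambda>_. 0)" by auto
    moreover have "cmv_inv \<alpha> (\<lambda>_. 0) = (\<lambda>_. 0)" using cmv_inv_lincomb[of \<alpha> 0 "\<lambda>_. 0" 0 "\<lambda>_. 0"] by simp
    ultimately have "v j = 0" for j using res_vec_eq[OF \<alpha> v2 z, of j] by simp
    then show False using vkl ab by metis
  qed
  then have "0 < normsq (res_vec \<alpha> z v)" using normsq_nonneg[OF x] by simp
  moreover have "(cmod z)\<^sup>2 < 1" using z by (simp add: abs_square_less_1)
  ultimately have "0 < (1 - (cmod z)\<^sup>2) * normsq (res_vec \<alpha> z v)" by simp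
  also have "\<dots> = 2 * Re (\<Sum>j\<in>{k,l}. cnj (v j) * res_vec \<alpha> z v j) - normsq v"
    using res_vec_energy[OF \<alpha> z S(1), of v] S(2) by metis
  also have "(\<Sum>j\<in>{k,l}. cnj (v j) * res_vec \<alpha> z v j) =
      cnj a * (a * Res \<alpha> z k k + b * Res \<alpha> z k l) + cnj b * (a * Res \<alpha> z l k + b * Res \<alpha> z l l)"
    using kl by (simp add: vkl r)
  also have "2 * Re \<dots> - normsq v = (cmod a)\<^sup>2 * Pdiag \<alpha> z k + (cmod b)\<^sup>2 * Pdiag \<alpha> z l + 2 * Re (cnj a * b * Poff \<alpha> z k l)"
    unfolding n2v Pdiag_def Poff_def cmod_power2 by (simp add: power2_eq_square algebra_simps)
  finally show ?thesis .
qed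

lemma Pdiag_pos: assumes "disk_seq \<alpha>" "cmod z < 1" shows "0 < Pdiag \<alpha> z k"
  using quadratic_form_pos[OF assms, of k "Suc k" 1 0] by simp

lemma Poff_le:
  assumes "disk_seq \<alpha>" "cmod z < 1" "k \<noteq> l"
  shows "(cmod (Poff \<alpha> z k l))\<^sup>2 \<le> Pdiag \<alpha> z k * Pdiag \<alpha> z l"
proof -
  let ?P = "Poff \<alpha> z k l" and ?D = "Pdiag \<alpha> z l"
  have D: "0 < ?D" by (rule Pdiag_pos[OF assms(1,2)])
  have "Re (cnj ?P * ?P) = (cmod ?P)\<^sup>2" unfolding cmod_power2 by (simp add: power2_eq_square)
  then have re: "Re (cnj (complex_of_real ?D) * (- cnj ?P) * ?P) = - (?D * (cmod ?P)\<^sup>2)"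
    by (simp add: mult.assoc)
  \<comment> \<open>With the first coefficient \<open>P\<^sub>l\<^sub>l\<close>, the form is smallest at the second coefficient \<open>- cnj P\<^sub>k\<^sub>l\<close>.\<close>
  have "0 < (cmod (complex_of_real ?D))\<^sup>2 * Pdiag \<alpha> z k + (cmod (- cnj ?P))\<^sup>2 * ?D + 2 * Re (cnj (complex_of_real ?D) * (- cnj ?P) * ?P)"
    by (rule quadratic_form_pos[OF assms]) (use D in auto)
  then have "0 < ?D * (?D * Pdiag \<alpha> z k - (cmod ?P)\<^sup>2)"
    unfolding re by (simp add: power2_eq_square algebra_simps)
  then show ?thesis using D by (simp add: zero_less_mult_iff mult.commute)
qed

text \<open>
  Positivity of \<open>2 Re g - 1\<close> says that \<open>g\<close> is closer to \<open>1\<close> than to \<open>0\<close>.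
\<close>

lemma Res_diag_bounds:
  fixes l :: nat
  assumes "disk_seq \<alpha>" "cmod z < 1"
  defines "g \<equiv> Res \<alpha> z l l"
  shows "g \<noteq> 0" "cmod (1 - 1 / g) < 1" "cmod (1 / g) \<le> 2"
proof -
  have "0 < 2 * Re g - 1" using Pdiag_pos[OF assms(1,2), of l] unfolding Pdiag_def g_def .
  then have p: "1 < 2 * Re g" by linarith
  have g: "g \<noteq> 0" using p by auto
  then show "g \<noteq> 0" .
  have "(cmod (g - 1))\<^sup>2 < (cmod g)\<^sup>2"
    using p unfolding cmod_power2 by (simp add: power2_eq_square algebra_simps)
  then have "cmod (g - 1) < cmod g" by (rule power2_less_imp_less) simp
  moreover have "1 - 1 / g = (g - 1) / g" using g by (simp add: field_simps)
  ultimately show "cmod (1 - 1 / g) < 1" using g by (simp add: norm_divide)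
  have "1 < 2 * cmod g" using p complex_Re_le_cmod[of g] by linarith
  then show "cmod (1 / g) \<le> 2" using g by (simp add: norm_divide pos_divide_le_eq)
qed

lemma disk_seq_T_rot: "cmod u = 1 \<Longrightarrow> disk_seq \<alpha> \<Longrightarrow> disk_seq (T_rot l u \<alpha>)"
  by (simp add: disk_seq_def T_rot_def norm_mult)

text \<open>
  Multiplying power series turns the renewal equation into a linear equation for the perturbed entries, with the
  factor \<open>g (1 - u f)\<close>. The perturbation acts from the right, so for entries in column \<open>l\<close> the identity
  \<open>1 + (u - 1) / (1 - u f) = u / (g (1 - u f))\<close> restores the symmetry between row and column.
\<close>

lemma Res_T_rot:
  fixes l :: nat
  assumes \<alpha>: "disk_seq \<alpha>" and z: "cmod z < 1" and u: "cmod u = 1" and kl: "k \<noteq> l"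
  defines "g \<equiv> Res \<alpha> z l l"
  defines "f \<equiv> 1 - 1 / g"
  shows "Res (T_rot l u \<alpha>) z l l = 1 / (1 - u * f)"
    and "cmod (Res (T_rot l u \<alpha>) z l k) = cmod (Res \<alpha> z l k) * cmod (1 / g) / cmod (1 - u * f)"
    and "cmod (Res (T_rot l u \<alpha>) z k l) = cmod (Res \<alpha> z k l) * cmod (1 / g) / cmod (1 - u * f)"
proof -
  obtain d where d: "\<And>j. cnj (d j) * d j = 1"
    and T: "\<And>n k m. inv_entry (T_rot l u \<alpha>) n k m = d k * cnj (d m) * (kicked_inv \<alpha> l u ^^ n) (basis_vec m) k"
    using inv_entry_T_rot[OF u] by blast
  define b where "b n k m = (kicked_inv \<alpha> l u ^^ n) (basis_vec m) k" for n k m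
  have nd: "cmod (d j) = 1" for j
  proof -
    have "cmod (cnj (d j) * d j) = 1" using d[of j] by simp
    then have "(cmod (d j))\<^sup>2 = 1" by (simp add: norm_mult power2_eq_square)
    then show ?thesis using norm_ge_zero[of "d j"] unfolding power2_eq_1_iff by linarith
  qed
  have T\<alpha>: "disk_seq (T_rot l u \<alpha>)" by (rule disk_seq_T_rot[OF u \<alpha>])
  have b_eq: "b n k m = cnj (d k) * d m * inv_entry (T_rot l u \<alpha>) n k m" for n k m
  proof -
    have "cnj (d k) * d m * inv_entry (T_rot l u \<alpha>) n k m = (cnj (d k) * d k) * (cnj (d m) * d m) * b n k m"
      unfolding T b_def by (simp add: mult_ac)
    then show ?thesis by (simp add: d)
  qed
  define V where "V k m = cnj (d k) * d m * Res (T_rot l u \<alpha>) z k m" for k m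
  have V: "(\<lambda>n. b n k m * z ^ n) sums V k m" for k m
    using sums_mult[OF Res_sums[OF T\<alpha> z, of k m], of "cnj (d k) * d m"] by (simp add: b_eq V_def mult_ac)
  have Vabs: "summable (\<lambda>n. cmod (b n k m * z ^ n))" for k m
    using Res_summable[OF T\<alpha> z, of k m] by (simp add: b_eq norm_mult nd)
  have main: "V k m = Res \<alpha> z k m + (u - 1) * (V l m * (Res \<alpha> z k l - (if k = l then 1 else 0)))" for k m
  proof -
    \<comment> \<open>The convolution in the renewal equation omits the zeroth power of the inverse.\<close>
    define c where "c n = (if n = 0 then 0 else inv_entry \<alpha> n k l * z ^ n)" for n
    have c: "c sums (Res \<alpha> z k l - (if k = l then 1 else 0))"
    proof -
      have "(\<lambda>n. inv_entry \<alpha> n k l * z ^ n - (if n = 0 then inv_entry \<alpha> 0 k l else 0)) sums (Res \<alpha> z k l - inv_entry \<alpha> 0 k l)"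
        by (intro sums_diff Res_sums \<alpha> z sums_single)
      moreover have "(\<lambda>n. inv_entry \<alpha> n k l * z ^ n - (if n = 0 then inv_entry \<alpha> 0 k l else 0)) = c"
        by (auto simp: c_def)
      moreover have "inv_entry \<alpha> 0 k l = (if k = l then 1 else 0)" by (simp add: inv_entry_def basis_vec_def)
      ultimately show ?thesis by simp
    qed
    have cabs: "summable (\<lambda>n. cmod (c n))"
      by (rule summable_comparison_test'[OF Res_summable[OF \<alpha> z, of k l]]) (simp add: c_def)
    have "(\<lambda>n. \<Sum>j\<le>n. (b j l m * z ^ j) * c (n - j)) sums ((\<Sum>n. b n l m * z ^ n) * (\<Sum>n. c n))"
      by (rule Cauchy_product_sums[OF Vabs cabs])
    then have "(\<lambda>n. \<Sum>j\<le>n. (b j l m * z ^ j) * c (n - j)) sums (V l m * (Res \<alpha> z k l - (if k = l then 1 else 0)))"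
      using V[of l m] c by (simp add: sums_iff)
    moreover have "(\<Sum>j\<le>n. (b j l m * z ^ j) * c (n - j)) = (\<Sum>j<n. b j l m * inv_entry \<alpha> (n - j) k l) * z ^ n" for n
    proof -
      have "(\<Sum>j\<le>n. (b j l m * z ^ j) * c (n - j)) = (\<Sum>j<n. (b j l m * z ^ j) * c (n - j))"
        by (simp add: lessThan_Suc_atMost[symmetric] c_def)
      also have "\<dots> = (\<Sum>j<n. b j l m * inv_entry \<alpha> (n - j) k l * z ^ n)"
        by (rule sum.cong) (auto simp: c_def mult_ac simp flip: power_add)
      finally show ?thesis by (simp add: sum_distrib_right)
    qed
    ultimately have "(\<lambda>n. inv_entry \<alpha> n k m * z ^ n + (u - 1) * ((\<Sum>j<n. b j l m * inv_entry \<alpha> (n - j) k l) * z ^ n))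
        sums (Res \<alpha> z k m + (u - 1) * (V l m * (Res \<alpha> z k l - (if k = l then 1 else 0))))"
      by (intro sums_add sums_mult Res_sums \<alpha> z) simp
    moreover have "b n k m * z ^ n = inv_entry \<alpha> n k m * z ^ n + (u - 1) * ((\<Sum>j<n. b j l m * inv_entry \<alpha> (n - j) k l) * z ^ n)" for n
    proof -
      have w: "b n k m = inv_entry \<alpha> n k m + (u - 1) * (\<Sum>j<n. b j l m * inv_entry \<alpha> (n - j) k l)"
        unfolding b_def by (rule kicked_inv_renewal)
      show ?thesis by (subst w) (simp only: distrib_right mult.assoc)
    qed
    ultimately show ?thesis using V[of k m] sums_unique2 by (metis (no_types, lifting) sums_cong)
  qed
  note sch = Res_diag_bounds[OF \<alpha> z, of l, folded g_def, folded f_def]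
  have "cmod (u * f) < 1" using sch(2) u by (simp add: norm_mult)
  then have uf: "1 - u * f \<noteq> 0" by (metis less_irrefl norm_one right_minus_eq)
  have fg: "f * g = g - 1" using sch(1) by (simp add: f_def field_simps)
  have ll: "V l m * (g * (1 - u * f)) = Res \<alpha> z l m" for m
  proof -
    have "V l m = Res \<alpha> z l m + (u - 1) * (V l m * (g - 1))" using main[of l m] by (simp add: g_def)
    then show ?thesis using fg by algebra
  qed
  have ll': "V l m = Res \<alpha> z l m * (1 / g) / (1 - u * f)" for m
    using sch(1) uf by (simp flip: ll[of m])
  have Vll: "V l l = 1 / (1 - u * f)"
    unfolding ll' using sch(1) by (simp add: g_def)
  then show "Res (T_rot l u \<alpha>) z l l = 1 / (1 - u * f)"
    using d[of l] by (simp add: V_def)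
  note ll'[of k]
  moreover have "cmod (V k m) = cmod (Res (T_rot l u \<alpha>) z k m)" for k m by (simp add: V_def norm_mult nd)
  ultimately show "cmod (Res (T_rot l u \<alpha>) z l k) = cmod (Res \<alpha> z l k) * cmod (1 / g) / cmod (1 - u * f)"
    by (metis norm_divide norm_mult)
  have "V k l = Res \<alpha> z k l * (1 + (u - 1) * V l l)" using main[of k l] kl by (simp add: algebra_simps)
  also have "1 + (u - 1) * V l l = u * (1 / g) / (1 - u * f)"
  proof -
    have "1 + (u - 1) * V l l = (1 - u * f + (u - 1)) / (1 - u * f)" 
      unfolding Vll by (simp only: add_divide_distrib[of "1 - u * f" "u - 1"] divide_self[OF uf] times_divide_eq_right mult_1_right)
    also have "1 - u * f + (u - 1) = u * (1 / g)" by (simp add: f_def algebra_simps)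
    finally show ?thesis .
  qed
  finally have "cmod (V k l) = cmod (Res \<alpha> z k l) * (cmod u * cmod (1 / g) / cmod (1 - u * f))"
    by (simp only: norm_mult norm_divide)
  then show "cmod (Res (T_rot l u \<alpha>) z k l) = cmod (Res \<alpha> z k l) * cmod (1 / g) / cmod (1 - u * f)"
    using \<open>\<And>k m. cmod (V k m) = _\<close>[of k l] u by simp
qed

lemma Pdiag_T_rot:
  fixes l :: nat
  assumes \<alpha>: "disk_seq \<alpha>" and z: "cmod z < 1" and u: "cmod u = 1"
  defines "f \<equiv> 1 - 1 / Res \<alpha> z l l"
  shows "Pdiag (T_rot l u \<alpha>) z l = (1 - (cmod f)\<^sup>2) / (cmod (1 - u * f))\<^sup>2"
proof -
  have R: "Res (T_rot l u \<alpha>) z l l = 1 / (1 - u * f)"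
    unfolding f_def by (rule Res_T_rot(1)[OF \<alpha> z u, of "Suc l"]) simp
  have "cmod (u * f) < 1" using Res_diag_bounds(2)[OF \<alpha> z, of l] u by (simp add: norm_mult f_def)
  then have "1 - u * f \<noteq> 0" by (metis less_irrefl norm_one right_minus_eq)
  then have nz: "(cmod (1 - u * f))\<^sup>2 \<noteq> 0" by simp
  have "2 * Re (1 / (1 - u * f)) - 1 = 2 * (Re (1 - u * f) / (cmod (1 - u * f))\<^sup>2) - 1"
    by (simp add: Re_divide cmod_power2)
  also have "\<dots> = (2 * Re (1 - u * f) - (cmod (1 - u * f))\<^sup>2) / (cmod (1 - u * f))\<^sup>2"
    using nz by (simp add: diff_divide_distrib)
  also have "2 * Re (1 - u * f) - (cmod (1 - u * f))\<^sup>2 = 1 - (cmod (u * f))\<^sup>2"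
    unfolding cmod_power2 by (simp add: power2_eq_square algebra_simps)
  finally show ?thesis using u by (simp add: Pdiag_def R norm_mult)
qed

section \<open>Poisson extension and powers\<close>

lemma Res_holomorphic:
  assumes "disk_seq \<alpha>" shows "(\<lambda>z. Res \<alpha> z k l) holomorphic_on ball 0 1"
  by (rule power_series_holomorphic[where a = "\<lambda>n. inv_entry \<alpha> n k l"]) (use Res_sums[OF assms] in auto)

lemma Res_0: "Res \<alpha> 0 k l = (if k = l then 1 else 0)"
  unfolding Res_def powser_zero by (simp add: inv_entry_def basis_vec_def)

lemma circ_radius: "0 < r \<Longrightarrow> r < 1 \<Longrightarrow> cmod (polar r t) < 1"
  by (simp add: norm_mult)

lemma Res_circ_measurable:
  assumes "disk_seq \<alpha>" "0 < r" "r < 1"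
  shows "(\<lambda>t. Res \<alpha> (polar r t) k l) \<in> borel_measurable borel"
  using holomorphic_circ_measurable(1)[OF Res_holomorphic[OF assms(1)], of r] assms by auto

abbreviation Poff_mean :: "(nat \<Rightarrow> complex) \<Rightarrow> real \<Rightarrow> nat \<Rightarrow> nat \<Rightarrow> ennreal" where
  "Poff_mean \<alpha> r k l \<equiv> \<integral>\<^sup>+t. ennreal (cmod (Poff \<alpha> (polar r t) k l)) \<partial>circ"

text \<open>
  The analytic part of \<open>P\<^sub>m\<^sub>l\<close> has the wanted Taylor coefficient, and the conjugate part is orthogonal to positive
  frequencies.
\<close>

lemma inv_entry_fourier_bound:
  assumes \<alpha>: "disk_seq \<alpha>" and r: "0 < r" "r < 1" and ml: "m \<noteq> l"
  shows "ennreal (r ^ n * cmod (inv_entry \<alpha> n m l)) \<le> Poff_mean \<alpha> r m l"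
proof (cases "n = 0")
  case True
  then show ?thesis using ml by (simp add: inv_entry_def basis_vec_def)
next
  case False
  define c where "c j = inv_entry \<alpha> j m l * of_real r ^ j" for j
  define c' where "c' j = inv_entry \<alpha> j l m * of_real r ^ j" for j
  have rr: "cmod (of_real r) < 1" using r by simp
  have c: "summable (\<lambda>j. cmod (c j))" "summable (\<lambda>j. cmod (c' j))"
    unfolding c_def c'_def by (intro Res_summable \<alpha> rr)+
  define f where "f t = (\<Sum>j. c j * cis t ^ j)" for t
  define f' where "f' t = (\<Sum>j. c' j * cis t ^ j)" for t
  have P: "Poff \<alpha> (polar r t) m l = f t + cnj (f' t)" for t
    by (simp add: Poff_def Res_def f_def f'_def c_def c'_def power_mult_distrib mult_ac)
  have [measurable]: "f \<in> borel_measurable borel" "f' \<in> borel_measurable borel" unfolding f_def f'_def by measurable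
  have sb: "cmod (\<Sum>j. a j * cis t ^ j) \<le> (\<Sum>j. cmod (a j))" if "summable (\<lambda>j. cmod (a j))" for a t
    using summable_norm[of "\<lambda>n. a n * cis t ^ n"] that by (simp add: norm_mult norm_power)
  have i1: "integrable circ (\<lambda>t. f t * cnj (cis t ^ n))"
    by (rule integrable_circ_bounded[of _ "\<Sum>j. cmod (c j)"]) (use sb[OF c(1)] in \<open>auto simp: norm_mult norm_power f_def\<close>)
  have i2: "integrable circ (\<lambda>t. cnj (f' t * cis t ^ n))"
    by (rule integrable_circ_bounded[of _ "\<Sum>j. cmod (c' j)"]) (use sb[OF c(2)] in \<open>auto simp: norm_mult norm_power f'_def\<close>)
  have iP: "integrable circ (\<lambda>t. Poff \<alpha> (polar r t) m l * cnj (cis t ^ n))"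
    unfolding P using Bochner_Integration.integrable_add[OF i1 i2] by (simp add: distrib_right)
  have "(LINT t|circ. Poff \<alpha> (polar r t) m l * cnj (cis t ^ n))
      = (LINT t|circ. f t * cnj (cis t ^ n) + cnj (f' t * cis t ^ n))"
    unfolding P by (simp add: distrib_right)
  also have "\<dots> = c n + cnj (LINT t|circ. f' t * cis t ^ n)"
    unfolding Bochner_Integration.integral_add[OF i1 i2] Bochner_Integration.integral_cnj
    using power_series_coeff[OF c(1), of n] by (simp add: f_def)
  also have "\<dots> = c n"
    using power_series_coeff_neg[OF c(2), of n] False by (simp add: f'_def)
  finally have "cmod (c n) \<le> (LINT t|circ. cmod (Poff \<alpha> (polar r t) m l * cnj (cis t ^ n)))"
    by (metis integral_norm_bound)
  also have "\<dots> = (LINT t|circ. cmod (Poff \<alpha> (polar r t) m l))"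
    by (simp add: norm_mult norm_power)
  finally have "r ^ n * cmod (inv_entry \<alpha> n m l) \<le> (LINT t|circ. cmod (Poff \<alpha> (polar r t) m l))"
    using r by (simp add: c_def norm_mult norm_power mult.commute)
  moreover have "integrable circ (\<lambda>t. cmod (Poff \<alpha> (polar r t) m l))"
    using integrable_norm[OF iP] by (simp add: norm_mult norm_power)
  ultimately show ?thesis
    by (subst nn_integral_eq_integral) (auto intro: ennreal_leI)
qed

lemma Poff_commute: "Poff \<alpha> z l k = cnj (Poff \<alpha> z k l)"
  by (simp add: Poff_def)

text \<open>
  Positive powers of \<open>C\<close> are adjoints of powers of \<open>W\<close>; exchanging \<open>k\<close> and \<open>l\<close> conjugates \<open>P\<close>.
\<close>

lemma cmv_power_fourier_bound:
  assumes \<alpha>: "disk_seq \<alpha>" and r: "0 < r" "r < 1" and kl: "k \<noteq> l"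
  shows "ennreal (r ^ nat \<bar>n\<bar> * cmod (cmv_power_entry \<alpha> n k l)) \<le> Poff_mean \<alpha> r k l"
proof (cases "0 \<le> n")
  case True
  then have "ennreal (r ^ nat \<bar>n\<bar> * cmod (cmv_power_entry \<alpha> n k l)) = ennreal (r ^ nat n * cmod (inv_entry \<alpha> (nat n) l k))"
    by (simp add: cmv_power_entry_eq[OF \<alpha>])
  also have "\<dots> \<le> Poff_mean \<alpha> r l k"
    by (rule inv_entry_fourier_bound[OF \<alpha> r kl[symmetric]])
  finally show ?thesis by (simp add: Poff_commute[of \<alpha> _ l k])
next
  case False
  then show ?thesis using inv_entry_fourier_bound[OF \<alpha> r kl, of "nat (- n)"] by (simp add: cmv_power_entry_eq[OF \<alpha>])
qed

lemma Pdiag_average: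
  assumes \<alpha>: "disk_seq \<alpha>" and r: "0 < r" "r < 1"
  shows "(\<integral>\<^sup>+t. ennreal (Pdiag \<alpha> (polar r t) k) \<partial>circ) = 1"
proof -
  have [measurable]: "(\<lambda>t. Res \<alpha> (polar r t) k k) \<in> borel_measurable borel"
    by (rule Res_circ_measurable[OF \<alpha> r])
  obtain B where B: "\<And>t. cmod (Res \<alpha> (polar r t) k k) \<le> B"
    using holomorphic_circ_measurable(3)[OF Res_holomorphic[OF \<alpha>, of k k], of r] r by auto
  have i: "integrable circ (\<lambda>t. Res \<alpha> (polar r t) k k)" by (rule integrable_circ_bounded[of _ B]) (use B in auto)
  have iP: "integrable circ (\<lambda>t. Pdiag \<alpha> (polar r t) k)" unfolding Pdiag_def using i by simp
  have "(LINT t|circ. Pdiag \<alpha> (polar r t) k) = 2 * Re (LINT t|circ. Res \<alpha> (polar r t) k k) - 1"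
    unfolding Pdiag_def using i circ.prob_space by simp
  also have "\<dots> = 1" unfolding mean_value_circ[OF Res_holomorphic[OF \<alpha>] r] by (simp add: Res_0)
  finally have "(LINT t|circ. Pdiag \<alpha> (polar r t) k) = 1" .
  then show ?thesis
    by (subst nn_integral_eq_integral[OF iP]) (auto intro!: AE_I2 less_imp_le Pdiag_pos[OF \<alpha> circ_radius[OF r]])
qed

text \<open>
  Write \<open>P\<close> as the geometric mean of \<open>P\<^sup>s D\<^sup>1\<^sup>-\<^sup>s\<close> and \<open>P\<^sup>2 / D \<le> E\<close> with weights \<open>t = 1 / (2 - s)\<close> and
  \<open>1 - t\<close>: this is the combination in which \<open>P\<close> has exponent one and \<open>D\<close> exponent zero. The free parameter \<open>\<eta>\<close>
  replaces an application of the Hoelder inequality to the means.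
\<close>

lemma powr_interpolation:
  fixes P D E s \<eta> :: real
  assumes D: "0 < D" and P: "0 \<le> P" and le: "P\<^sup>2 \<le> E * D" and E: "0 < E" and s: "0 < s" "s < 1" and \<eta>: "0 < \<eta>"
  shows "P \<le> \<eta> powr ((s - 1) / (2 - s)) * (P powr s * D powr (1 - s)) + \<eta> powr (1 / (2 - s)) * E"
proof (cases "P = 0")
  case True
  then show ?thesis using E \<eta> by simp
next
  case False
  then have P0: "0 < P" using P by simp
  define t where "t = 1 / (2 - s)"
  have tt: "t * (2 - s) = 1" using s by (simp add: t_def)
  have t: "0 < t" "t < 1" using s by (auto simp: t_def)
  define X where "X = P powr s * D powr (1 - s)"
  have X0: "0 < X" using P0 D by (simp add: X_def)
  have "P = X powr t * (P\<^sup>2 / D) powr (1 - t)"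
  proof -
    have e1: "s * t + 2 * (1 - t) = 1" "(1 - s) * t = 1 - t" using tt by algebra+
    have "X powr t * (P\<^sup>2 / D) powr (1 - t) = P powr (s * t) * D powr ((1 - s) * t) * (P powr (2 * (1 - t)) / D powr (1 - t))"
      using P0 D by (simp add: X_def powr_mult powr_divide powr_powr flip: powr_numeral)
    also have "\<dots> = P powr (s * t + 2 * (1 - t))" unfolding e1(2) powr_add using D by simp
    also have "\<dots> = P" unfolding e1(1) using P0 by simp
    finally show ?thesis by (rule sym)
  qed
  also have "\<dots> \<le> X powr t * E powr (1 - t)"
    using le D t by (intro mult_left_mono powr_mono2) (auto simp: pos_divide_le_eq)
  also have "\<dots> = (\<eta> powr (t - 1) * X) powr t * (\<eta> powr t * E) powr (1 - t)"
  proof -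
    have "\<eta> powr ((t - 1) * t) * \<eta> powr (t * (1 - t)) = 1" using \<eta> by (simp add: algebra_simps flip: powr_add)
    then show ?thesis using X0 E \<eta> by (simp add: powr_mult powr_powr mult_ac)
  qed
  also have "\<dots> \<le> t * (\<eta> powr (t - 1) * X) + (1 - t) * (\<eta> powr t * E)"
    by (rule Youngs_inequality_0) (use t X0 E \<eta> in auto)
  also have "\<dots> \<le> 1 * (\<eta> powr (t - 1) * X) + 1 * (\<eta> powr t * E)"
    using t X0 E \<eta> by (intro add_mono mult_right_mono) auto
  also have "t - 1 = (s - 1) / (2 - s)"
  proof -
    have "(t - 1) * (2 - s) = s - 1" using tt by algebra
    then show ?thesis using s by (simp add: eq_divide_eq)
  qed
  finally show ?thesis by (simp add: X_def t_def)
qed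

text \<open>
  The interpolation for the rotated coefficients, expressed through the unrotated ones: the only dependence of
  the first term on \<open>u\<close> is through the kernel of \<open>kernel_average\<close>.
\<close>

lemma Poff_T_rot_le:
  assumes \<alpha>: "disk_seq \<alpha>" and z: "cmod z < 1" and u: "cmod u = 1" and kl: "k \<noteq> l"
    and s: "0 < s" "s < 1" and \<eta>: "0 < \<eta>"
  defines "f \<equiv> 1 - 1 / Res \<alpha> z l l"
  shows "cmod (Poff (T_rot l u \<alpha>) z k l) \<le>
     \<eta> powr ((s - 1) / (2 - s)) * (2 * (cmod (Res \<alpha> z k l) powr s + cmod (Res \<alpha> z l k) powr s) *
        ((1 - (cmod f)\<^sup>2) powr (1 - s) * cmod (1 - u * f) powr (s - 2)))
     + \<eta> powr (1 / (2 - s)) * Pdiag (T_rot l u \<alpha>) z k"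
proof -
  let ?\<alpha> = "T_rot l u \<alpha>"
  define P where "P = cmod (Poff ?\<alpha> z k l)"
  define D where "D = Pdiag ?\<alpha> z l"
  define a where "a = cmod (Res \<alpha> z k l)"
  define b where "b = cmod (Res \<alpha> z l k)"
  define w where "w = cmod (1 - u * f)"
  have ab: "0 \<le> a" "0 \<le> b" by (auto simp: a_def b_def)
  have T: "disk_seq ?\<alpha>" by (rule disk_seq_T_rot[OF u \<alpha>])
  note sch = Res_diag_bounds[OF \<alpha> z, of l, folded f_def]
  have "cmod (u * f) < 1" using sch(2) u by (simp add: norm_mult)
  then have w: "0 < w" unfolding w_def by (metis less_irrefl norm_one right_minus_eq zero_less_norm_iff)
  have f2: "0 < 1 - (cmod f)\<^sup>2" using sch(2) by (simp add: abs_square_less_1)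
  have D: "D = (1 - (cmod f)\<^sup>2) / w\<^sup>2" unfolding D_def f_def w_def by (rule Pdiag_T_rot[OF \<alpha> z u])
  have "P \<le> cmod (Res ?\<alpha> z k l) + cmod (Res ?\<alpha> z l k)"
    unfolding P_def Poff_def by (metis norm_triangle_ineq complex_mod_cnj)
  also have "\<dots> = (a + b) * cmod (1 / Res \<alpha> z l l) / w"
    unfolding Res_T_rot(2,3)[OF \<alpha> z u kl] f_def a_def b_def w_def by (simp add: add_divide_distrib distrib_right)
  also have "\<dots> \<le> (a + b) * 2 / w" using sch(3) ab w by (intro divide_right_mono mult_left_mono) auto
  finally have Ple: "P \<le> (a + b) * 2 / w" .
  have "P powr s \<le> ((a + b) * 2 / w) powr s" using s Ple by (intro powr_mono2) (auto simp: P_def)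
  also have "\<dots> = (a + b) powr s * 2 powr s / w powr s" by (simp only: powr_divide powr_mult)
  also have "\<dots> \<le> (a powr s + b powr s) * 2 / w powr s"
  proof (intro divide_right_mono mult_mono powr_add_le)
    show "2 powr s \<le> (2::real)" using s powr_mono[of s 1 "2::real"] by simp
  qed (use s ab in auto)
  finally have Ps: "P powr s \<le> 2 * (a powr s + b powr s) / w powr s" by (simp add: mult.commute)
  have "P powr s * D powr (1 - s) \<le> 2 * (a powr s + b powr s) / w powr s * D powr (1 - s)"
    by (intro mult_right_mono Ps) auto
  also have De: "D powr (1 - s) = (1 - (cmod f)\<^sup>2) powr (1 - s) * w powr (2 * s - 2)"
  proof -
    have "D powr (1 - s) = (1 - (cmod f)\<^sup>2) powr (1 - s) / w powr (2 * (1 - s))"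
      unfolding D using f2 w by (simp add: powr_divide powr_powr flip: powr_numeral)
    moreover have e: "2 * s - 2 = - (2 * (1 - s))" by simp
    ultimately show ?thesis unfolding e powr_minus divide_inverse by simp
  qed
  also have "2 * (a powr s + b powr s) / w powr s * ((1 - (cmod f)\<^sup>2) powr (1 - s) * w powr (2 * s - 2)) =
      2 * (a powr s + b powr s) * ((1 - (cmod f)\<^sup>2) powr (1 - s) * w powr (s - 2))"
  proof -
    have "w powr (2 * s - 2) = w powr (s - 2) * w powr s" by (simp flip: powr_add)
    then show ?thesis using w by simp
  qed
  finally have X: "P powr s * D powr (1 - s) \<le> 2 * (a powr s + b powr s) * ((1 - (cmod f)\<^sup>2) powr (1 - s) * w powr (s - 2))"
    unfolding De .
  have "P \<le> \<eta> powr ((s - 1) / (2 - s)) * (P powr s * D powr (1 - s)) + \<eta> powr (1 / (2 - s)) * Pdiag ?\<alpha> z k"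
    by (rule powr_interpolation)
       (use Pdiag_pos[OF T z] Poff_le[OF T z kl] s \<eta> in \<open>auto simp: P_def D_def\<close>)
  also have "\<dots> \<le> \<eta> powr ((s - 1) / (2 - s)) * (2 * (a powr s + b powr s) * ((1 - (cmod f)\<^sup>2) powr (1 - s) * w powr (s - 2)))
      + \<eta> powr (1 / (2 - s)) * Pdiag ?\<alpha> z k"
    by (intro add_right_mono mult_left_mono X) auto
  finally show ?thesis unfolding P_def a_def b_def w_def .
qed

section \<open>Boundary values of the matrix elements\<close>

text \<open>
  For unimodular \<open>c\<close>, \<open>H c\<close> is the diagonal matrix element of \<open>F\<close> at the vector \<open>\<delta>\<^sub>k + c \<delta>\<^sub>l\<close>.
\<close>

lemma polarization:
  assumes \<alpha>: "disk_seq \<alpha>" and kl: "k \<noteq> l"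
  obtains H :: "complex \<Rightarrow> complex \<Rightarrow> complex" where
    "\<And>c. cmod c = 1 \<Longrightarrow> H c holomorphic_on ball 0 1"
    "\<And>c z. cmod c = 1 \<Longrightarrow> cmod z < 1 \<Longrightarrow> 0 < Re (H c z)"
    "\<And>c. H c 0 = 2"
    "\<And>z. 2 * Res \<alpha> z k l = (\<Sum>c\<in>{1, -1, \<i>, -\<i>}. cnj c * H c z) / 4"
proof
  define H where "H c z = 2 * (Res \<alpha> z k k + Res \<alpha> z l l + c * Res \<alpha> z k l + cnj c * Res \<alpha> z l k) - 2" for c z
  show "H c holomorphic_on ball 0 1" for c
    unfolding H_def by (intro holomorphic_intros Res_holomorphic \<alpha>)
  show "0 < Re (H c z)" if "cmod c = 1" "cmod z < 1" for c z
  proof -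
    have "0 < (cmod 1)\<^sup>2 * Pdiag \<alpha> z k + (cmod c)\<^sup>2 * Pdiag \<alpha> z l + 2 * Re (cnj 1 * c * Poff \<alpha> z k l)"
      by (rule quadratic_form_pos[OF \<alpha> that(2) kl]) simp
    also have "\<dots> = Re (H c z)"
      using that by (simp add: Pdiag_def Poff_def H_def algebra_simps)
    finally show ?thesis .
  qed
  show "H c 0 = 2" for c using kl by (simp add: H_def Res_0)
  show "2 * Res \<alpha> z k l = (\<Sum>c\<in>{1, -1, \<i>, -\<i>}. cnj c * H c z) / 4" for z
  proof -
    have "(\<Sum>c\<in>{1, -1, \<i>, -\<i>}. cnj c * H c z) = H 1 z - H (-1) z - \<i> * H \<i> z + \<i> * H (-\<i>) z"
      by (simp add: complex_eq_iff)
    also have "\<dots> = 8 * Res \<alpha> z k l" by (simp add: H_def algebra_simps flip: mult.assoc)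
    finally show ?thesis by simp
  qed
qed

text \<open>
  Off the diagonal \<open>2 * Res\<close> is the matrix element of \<open>F\<close>.
\<close>

abbreviation Res_moment :: "real \<Rightarrow> (nat \<Rightarrow> complex) \<Rightarrow> real \<Rightarrow> nat \<Rightarrow> nat \<Rightarrow> ennreal" where
  "Res_moment p \<alpha> r k l \<equiv> \<integral>\<^sup>+t. ennreal (cmod (2 * Res \<alpha> (polar r t) k l) powr p) \<partial>circ"

text \<open>
  Moments of order below one are subadditive, and each of the four functions takes the value \<open>2\<close> at the origin.
\<close>

lemma Res_Lq_bound:
  assumes \<alpha>: "disk_seq \<alpha>" and kl: "k \<noteq> l" and q: "0 < q" "q < 1" and r: "0 < r" "r < 1"
  shows "Res_moment q \<alpha> r k l \<le> ennreal (8 / cos (q * pi / 2))"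
proof -
  obtain H where H: "\<And>c. cmod c = 1 \<Longrightarrow> H c holomorphic_on ball 0 1"
    "\<And>c z. cmod c = 1 \<Longrightarrow> cmod z < 1 \<Longrightarrow> 0 < Re (H c z)"
    "\<And>c. H c 0 = 2"
    "\<And>z. 2 * Res \<alpha> z k l = (\<Sum>c\<in>{1, -1, \<i>, -\<i>}. cnj c * H c z) / 4"
    by (rule polarization[OF \<alpha> kl]) blast
  define J where "J = {1, -1, \<i>, -\<i>}"
  have J: "finite J" "card J \<le> 4" "\<And>c. c \<in> J \<Longrightarrow> cmod c = 1"
    by (auto simp: J_def card_insert_if)
  have [measurable]: "(\<lambda>t. H c (polar r t)) \<in> borel_measurable borel" if "c \<in> J" for c
    using holomorphic_circ_measurable(1)[OF H(1)[OF J(3)[OF that]], of r] r by auto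
  define C where "C = 2 / cos (q * pi / 2)"
  have C0: "0 \<le> C" using cos_half_pi_pos[OF q] by (simp add: C_def)
  have pw: "cmod (2 * Res \<alpha> z k l) powr q \<le> (\<Sum>c\<in>J. cmod (H c z) powr q)" for z
  proof -
    have "cmod (2 * Res \<alpha> z k l) = cmod (\<Sum>c\<in>J. cnj c * H c z) / 4" unfolding H(4) J_def by (simp add: norm_divide)
    also have "\<dots> \<le> cmod (\<Sum>c\<in>J. cnj c * H c z)" by simp
    also have "\<dots> \<le> (\<Sum>c\<in>J. cmod (cnj c * H c z))" by (rule norm_sum)
    also have "\<dots> = (\<Sum>c\<in>J. cmod (H c z))" using J by (intro sum.cong) (auto simp: norm_mult)
    finally have "cmod (2 * Res \<alpha> z k l) powr q \<le> (\<Sum>c\<in>J. cmod (H c z)) powr q"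
      using q by (intro powr_mono2) auto
    also have "\<dots> \<le> (\<Sum>c\<in>J. cmod (H c z) powr q)" by (rule powr_sum_le) (use J q in auto)
    finally show ?thesis .
  qed
  have "Res_moment q \<alpha> r k l
      \<le> (\<integral>\<^sup>+t. (\<Sum>c\<in>J. ennreal (cmod (H c (polar r t)) powr q)) \<partial>circ)"
  proof (rule nn_integral_mono)
    fix t
    have "ennreal (cmod (2 * Res \<alpha> (polar r t) k l) powr q) \<le> ennreal (\<Sum>c\<in>J. cmod (H c (polar r t)) powr q)"
      by (rule ennreal_leI[OF pw])
    then show "ennreal (cmod (2 * Res \<alpha> (polar r t) k l) powr q) \<le> (\<Sum>c\<in>J. ennreal (cmod (H c (polar r t)) powr q))"
      by (subst sum_ennreal) auto
  qed
  also have "\<dots> = (\<Sum>c\<in>J. \<integral>\<^sup>+t. ennreal (cmod (H c (polar r t)) powr q) \<partial>circ)"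
    by (rule nn_integral_sum) measurable
  also have "\<dots> \<le> (\<Sum>c\<in>J. ennreal C)"
  proof (rule sum_mono)
    fix c assume "c \<in> J"
    then have c: "cmod c = 1" by (rule J)
    have "(\<integral>\<^sup>+t. ennreal (cmod (H c (polar r t)) powr q) \<partial>circ) \<le> ennreal (cmod (H c 0) powr q / cos (q * pi / 2))"
      by (rule kolmogorov_moment[OF H(1)[OF c] H(2)[OF c] q r])
    also have "\<dots> \<le> ennreal C"
      unfolding H(3) C_def using q cos_half_pi_pos[OF q] powr_mono[of q 1 "2::real"]
      by (intro ennreal_leI divide_right_mono) auto
    finally show "(\<integral>\<^sup>+t. ennreal (cmod (H c (polar r t)) powr q) \<partial>circ) \<le> ennreal C" .
  qed
  also have "\<dots> = ennreal (of_nat (card J) * C)" using C0 by (simp add: ennreal_mult ennreal_of_nat_eq_real_of_nat)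
  also have "\<dots> \<le> ennreal (8 / cos (q * pi / 2))"
  proof (intro ennreal_leI)
    have "of_nat (card J) * C \<le> 4 * C" using J(2) C0 by (intro mult_right_mono) auto
    then show "of_nat (card J) * C \<le> 8 / cos (q * pi / 2)" by (simp add: C_def)
  qed
  finally show ?thesis .
qed

text \<open>
  Off the diagonal \<open>F\<close> is \<open>2 R\<close>, and the four functions of the polarization have radial limits. So almost
  everywhere \<open>carF_bdry\<close> is a genuine limit and not the default value of \<open>Lim\<close>.
\<close>

lemma carF_boundary:
  assumes \<alpha>: "disk_seq \<alpha>" and kl: "k \<noteq> l"
  shows "AE t in circ. ((\<lambda>r. 2 * Res \<alpha> (polar r t) k l) \<longlongrightarrow> carF_bdry \<alpha> k l t) (at_left 1)"
proof -
  obtain H where H: "\<And>c. cmod c = 1 \<Longrightarrow> H c holomorphic_on ball 0 1"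
    "\<And>c z. cmod c = 1 \<Longrightarrow> cmod z < 1 \<Longrightarrow> 0 < Re (H c z)"
    "\<And>c. H c 0 = 2"
    "\<And>z. 2 * Res \<alpha> z k l = (\<Sum>c\<in>{1, -1, \<i>, -\<i>}. cnj c * H c z) / 4"
    by (rule polarization[OF \<alpha> kl]) blast
  have "AE t in circ. \<forall>c\<in>{1, -1, \<i>, -\<i>}. \<exists>l. ((\<lambda>r. H c (polar r t)) \<longlongrightarrow> l) (at_left 1)"
    by (intro AE_finite_allI fatou_Re_pos H) auto
  then show ?thesis
  proof eventually_elim
    fix t assume "\<forall>c\<in>{1, -1, \<i>, -\<i>}. \<exists>l. ((\<lambda>r. H c (polar r t)) \<longlongrightarrow> l) (at_left 1)"
    then obtain L where L: "\<And>c. c \<in> {1, -1, \<i>, -\<i>} \<Longrightarrow> ((\<lambda>r. H c (polar r t)) \<longlongrightarrow> L c) (at_left 1)" by metis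
    have lim: "((\<lambda>r. 2 * Res \<alpha> (polar r t) k l) \<longlongrightarrow> (\<Sum>c\<in>{1, -1, \<i>, -\<i>}. cnj c * L c) / 4) (at_left 1)"
      unfolding H(4) by (intro tendsto_divide tendsto_sum tendsto_mult tendsto_const L) auto
    have "((\<lambda>r. carF \<alpha> k l (polar r t)) \<longlongrightarrow> (\<Sum>c\<in>{1, -1, \<i>, -\<i>}. cnj c * L c) / 4) (at_left 1)"
    proof (rule Lim_transform_eventually[OF lim])
      show "\<forall>\<^sub>F r in at_left 1. 2 * Res \<alpha> (polar r t) k l = carF \<alpha> k l (polar r t)"
      proof (rule eventually_mono[OF eventually_at_left_real[of 0 1]])
        fix r :: real assume "r \<in> {0<..<1}"
        then have "carF \<alpha> k l (polar r t) = 2 * res_vec \<alpha> (polar r t) (basis_vec l) k - basis_vec l k"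
          by (intro carF_eq \<alpha> circ_radius) auto
        then show "2 * Res \<alpha> (polar r t) k l = carF \<alpha> k l (polar r t)"
          using kl by (simp add: Res_eq_res_vec basis_vec_def)
      qed simp
    qed
    then have e: "carF_bdry \<alpha> k l t = (\<Sum>c\<in>{1, -1, \<i>, -\<i>}. cnj c * L c) / 4"
      unfolding carF_bdry_def by (intro tendsto_Lim) (simp_all add: trivial_limit_at_left_real)
    show "((\<lambda>r. 2 * Res \<alpha> (polar r t) k l) \<longlongrightarrow> carF_bdry \<alpha> k l t) (at_left 1)"
      unfolding e by (rule lim)
  qed
qed

section \<open>Averaging over the coefficients\<close>

lemma coordinate_measurable: "(\<lambda>\<alpha>. \<alpha> j) \<in> borel_measurable Verb_space"
proof -
  have "(\<lambda>\<alpha>. \<alpha> j) \<in> Verb_space \<rightarrow>\<^sub>M restrict_space borel (ball 0 1)"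
    unfolding Verb_space_def by simp
  then show ?thesis
    by (rule measurable_restrict_space2_iff[THEN iffD1, THEN conjunct1])
qed

lemma rho_measurable [measurable]: "rho \<in> borel_measurable borel"
  unfolding rho_def by (intro borel_measurable_continuous_onI continuous_intros)

lemma inv_entry_measurable:
  assumes "sets \<Gamma> = sets Verb_space"
  shows "(\<lambda>\<alpha>. inv_entry \<alpha> n k l) \<in> borel_measurable \<Gamma>"
proof -
  have [measurable]: "(\<lambda>\<alpha>. \<alpha> j) \<in> borel_measurable \<Gamma>" for j
    using coordinate_measurable measurable_cong_sets[OF assms refl] by blast
  have [measurable]: "(\<lambda>\<alpha>. L_mat (conj_seq \<alpha>) i j) \<in> borel_measurable \<Gamma>" for i j
    unfolding L_mat_def Theta_def conj_seq_def by measurable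
  have [measurable]: "(\<lambda>\<alpha>. M_mat (conj_seq \<alpha>) i j) \<in> borel_measurable \<Gamma>" for i j
    unfolding M_mat_def Theta_def conj_seq_def by measurable
  have "(\<lambda>\<alpha>. (cmv_inv \<alpha> ^^ n) (basis_vec l) k) \<in> borel_measurable \<Gamma>" for k
  proof (induction n arbitrary: k)
    case (Suc n)
    note [measurable] = Suc
    have "(\<lambda>\<alpha>. (cmv_inv \<alpha> ^^ Suc n) (basis_vec l) k) =
        (\<lambda>\<alpha>. \<Sum>j<k+2. M_mat (conj_seq \<alpha>) k j * (\<Sum>i<j+2. L_mat (conj_seq \<alpha>) j i * (cmv_inv \<alpha> ^^ n) (basis_vec l) i))"
      by (simp add: cmv_inv_def mat_op_upper_band del: add_2_eq_Suc')
    also have "\<dots> \<in> borel_measurable \<Gamma>" by measurable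
    finally show ?case .
  qed simp
  then show ?thesis by (simp add: inv_entry_def)
qed

lemma Res_measurable:
  assumes "sets \<Gamma> = sets Verb_space"
  shows "(\<lambda>x. Res (fst x) (of_real r * cis (snd x)) k l) \<in> borel_measurable (\<Gamma> \<Otimes>\<^sub>M circ)"
proof -
  note [measurable] = inv_entry_measurable[OF assms]
  show ?thesis unfolding Res_def by measurable
qed

lemma disk_seq_of_space:
  assumes "sets \<Gamma> = sets Verb_space" "\<alpha> \<in> space \<Gamma>"
  shows "disk_seq \<alpha>"
  using assms(2) sets_eq_imp_space_eq[OF assms(1)] by (auto simp: space_Verb_space disk_seq_def)

text \<open>
  Pulling \<open>h\<close> back by the rotation and pushing the measure forward by its inverse leaves the expectation
  unchanged; the density of the rotated measure is at most \<open>K\<close>.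
\<close>

lemma quasi_invariance_bound:
  assumes "prob_space \<Gamma>" and \<Gamma>: "sets \<Gamma> = sets Verb_space" and sqi: "strongly_quasi_invariant \<Gamma>"
  obtains K :: real where "0 \<le> K"
    "\<And>n u h. cmod u = 1 \<Longrightarrow> h \<in> borel_measurable \<Gamma> \<Longrightarrow>
       (\<integral>\<^sup>+\<alpha>. h \<alpha> \<partial>\<Gamma>) \<le> ennreal K * (\<integral>\<^sup>+\<alpha>. h (T_rot n u \<alpha>) \<partial>\<Gamma>)"
proof -
  interpret prob_space \<Gamma> by fact
  define KK where "KK = (SUP n. SUP u\<in>sphere 0 1. esssup \<Gamma> (RN_deriv \<Gamma> (rotated_measure \<Gamma> n u)))"
  have "KK < \<infinity>" using sqi unfolding strongly_quasi_invariant_def KK_def by blast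
  then obtain K where K: "KK = ennreal K" "0 \<le> K" by (cases KK) auto
  have le: "(\<integral>\<^sup>+\<alpha>. h \<alpha> \<partial>\<Gamma>) \<le> ennreal K * (\<integral>\<^sup>+\<alpha>. h (T_rot n u \<alpha>) \<partial>\<Gamma>)"
    if u: "cmod u = 1" and h[measurable]: "h \<in> borel_measurable \<Gamma>" for n u h
  proof -
    have us: "u \<in> sphere 0 1" "cnj u \<in> sphere 0 1" using u by auto
    have [measurable]: "T_rot n u \<in> \<Gamma> \<rightarrow>\<^sub>M \<Gamma>" "T_rot n (cnj u) \<in> \<Gamma> \<rightarrow>\<^sub>M \<Gamma>"
      using T_rot_measurable[OF us(1)] T_rot_measurable[OF us(2)] by (simp_all add: measurable_cong_sets[OF \<Gamma> \<Gamma>])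
    define D where "D = RN_deriv \<Gamma> (rotated_measure \<Gamma> n u)"
    have ac: "absolutely_continuous \<Gamma> (rotated_measure \<Gamma> n u)"
      using sqi us unfolding strongly_quasi_invariant_def by blast
    have rm: "rotated_measure \<Gamma> n u = distr \<Gamma> \<Gamma> (T_rot n (cnj u))" by (rule rotated_measure_eq_distr[OF \<Gamma> us(1)])
    have dens: "density \<Gamma> D = distr \<Gamma> \<Gamma> (T_rot n (cnj u))"
      unfolding D_def using density_RN_deriv[OF ac] rm by simp
    have [measurable]: "D \<in> borel_measurable \<Gamma>" unfolding D_def by simp
    have "esssup \<Gamma> D \<le> KK" unfolding KK_def D_def
      by (rule order_trans[OF SUP_upper[OF us(1)]]) (rule SUP_upper, simp)
    then have DK: "AE \<alpha> in \<Gamma>. D \<alpha> \<le> ennreal K"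
      using esssup_AE[where M = \<Gamma> and f = D] K by (auto elim!: eventually_mono)
    have "(\<integral>\<^sup>+\<alpha>. h \<alpha> \<partial>\<Gamma>) = (\<integral>\<^sup>+\<alpha>. h (T_rot n u (T_rot n (cnj u) \<alpha>)) \<partial>\<Gamma>)"
      by (simp add: T_rot_inverse[OF us(1)])
    also have "\<dots> = (\<integral>\<^sup>+\<alpha>. h (T_rot n u \<alpha>) \<partial>distr \<Gamma> \<Gamma> (T_rot n (cnj u)))"
      by (rule nn_integral_distr[symmetric]) measurable
    also have "\<dots> = (\<integral>\<^sup>+\<alpha>. D \<alpha> * h (T_rot n u \<alpha>) \<partial>\<Gamma>)"
      unfolding dens[symmetric] by (rule nn_integral_density) measurable
    also have "\<dots> \<le> (\<integral>\<^sup>+\<alpha>. ennreal K * h (T_rot n u \<alpha>) \<partial>\<Gamma>)"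
      by (rule nn_integral_mono_AE) (use DK in \<open>auto elim!: eventually_mono intro: mult_right_mono\<close>)
    also have "\<dots> = ennreal K * (\<integral>\<^sup>+\<alpha>. h (T_rot n u \<alpha>) \<partial>\<Gamma>)"
      by (rule nn_integral_cmult) measurable
    finally show ?thesis .
  qed
  show ?thesis by (rule that[OF K(2) le])
qed

text \<open>
  The left-hand side does not depend on the rotation, while the bound obtained for each rotation does; average it
  over the rotation. The term in \<open>P\<^sub>k\<^sub>k\<close> has mean one for every rotation, and the kernel in the other term is
  integrated first over the rotation, with the coefficients and the angle fixed.
\<close>

lemma expectation_Poff_le:
  assumes "prob_space \<Gamma>" and \<Gamma>: "sets \<Gamma> = sets Verb_space"
    and K: "0 \<le> K" "\<And>u h. cmod u = 1 \<Longrightarrow> h \<in> borel_measurable \<Gamma> \<Longrightarrow>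
       (\<integral>\<^sup>+\<alpha>. h \<alpha> \<partial>\<Gamma>) \<le> ennreal K * (\<integral>\<^sup>+\<alpha>. h (T_rot l u \<alpha>) \<partial>\<Gamma>)"
    and kl: "k \<noteq> l" and r: "0 < r" "r < 1" and s: "0 < s" "s < 1" and \<eta>: "0 < \<eta>"
  shows "(\<integral>\<^sup>+\<alpha>. Poff_mean \<alpha> r k l \<partial>\<Gamma>) \<le>
    ennreal K * (ennreal (\<eta> powr ((s - 1) / (2 - s)) * 2 / cos (s * pi / 2)) *
        (\<integral>\<^sup>+\<alpha>. \<integral>\<^sup>+\<theta>. ennreal (cmod (Res \<alpha> (polar r \<theta>) k l) powr s + cmod (Res \<alpha> (polar r \<theta>) l k) powr s) \<partial>circ \<partial>\<Gamma>)
       + ennreal (\<eta> powr (1 / (2 - s))))"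
proof -
  interpret prob_space \<Gamma> by fact
  interpret Gc: pair_prob_space \<Gamma> circ by unfold_locales
  interpret Gcc: pair_prob_space "\<Gamma> \<Otimes>\<^sub>M circ" circ by unfold_locales
  note [measurable] = Res_measurable[OF \<Gamma>]
  have circz: "cmod (polar r \<theta>) < 1" for \<theta> by (rule circ_radius[OF r])
  define a where "a = \<eta> powr ((s - 1) / (2 - s))"
  define b where "b = \<eta> powr (1 / (2 - s))"
  define Z where "Z x = cmod (Res (fst x) (of_real r * cis (snd x)) k l) powr s + cmod (Res (fst x) (of_real r * cis (snd x)) l k) powr s" for x
  define f where "f x = 1 - 1 / Res (fst x) (of_real r * cis (snd x)) l l" for x
  define kern where "kern x t = (1 - (cmod (f x))\<^sup>2) powr (1 - s) * cmod (1 - cis t * f x) powr (s - 2)" for x t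
  have [measurable]: "Z \<in> borel_measurable (\<Gamma> \<Otimes>\<^sub>M circ)" unfolding Z_def by measurable
  have [measurable]: "f \<in> borel_measurable (\<Gamma> \<Otimes>\<^sub>M circ)" unfolding f_def by measurable
  have [measurable]: "case_prod kern \<in> borel_measurable ((\<Gamma> \<Otimes>\<^sub>M circ) \<Otimes>\<^sub>M circ)" unfolding kern_def by measurable
  have Z0: "0 \<le> Z x" for x by (simp add: Z_def)
  have kern0: "0 \<le> kern x t" for x t by (simp add: kern_def)
  have ab: "0 \<le> a" "0 \<le> b" by (auto simp: a_def b_def)
  define h where "h \<alpha> = Poff_mean \<alpha> r k l" for \<alpha>
  have "(\<lambda>x. Poff (fst x) (of_real r * cis (snd x)) k l) \<in> borel_measurable (\<Gamma> \<Otimes>\<^sub>M circ)"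
    unfolding Poff_def by measurable
  then have [measurable]: "h \<in> borel_measurable \<Gamma>"
    unfolding h_def by (intro circ.borel_measurable_nn_integral) (simp add: case_prod_beta')
  define I where "I t = (\<integral>\<^sup>+x. ennreal (a * (2 * Z x * kern x t)) \<partial>(\<Gamma> \<Otimes>\<^sub>M circ))" for t
  have [measurable]: "I \<in> borel_measurable borel"
    unfolding I_def by measurable
  have le: "(\<integral>\<^sup>+\<alpha>. h \<alpha> \<partial>\<Gamma>) \<le> ennreal K * (I t + ennreal b)" for t
  proof -
    have u: "cmod (cis t) = 1" by simp
    let ?A = "\<lambda>\<alpha> \<theta>. ennreal (a * (2 * Z (\<alpha>, \<theta>) * kern (\<alpha>, \<theta>) t))"
      and ?D = "\<lambda>\<alpha> \<theta>. Pdiag (T_rot l (cis t) \<alpha>) (polar r \<theta>) k"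
    have "(\<integral>\<^sup>+\<alpha>. h (T_rot l (cis t) \<alpha>) \<partial>\<Gamma>) \<le> (\<integral>\<^sup>+\<alpha>. (\<integral>\<^sup>+\<theta>. ?A \<alpha> \<theta> \<partial>circ) + ennreal b \<partial>\<Gamma>)"
    proof (rule nn_integral_mono)
      fix \<alpha> assume \<alpha>G: "\<alpha> \<in> space \<Gamma>"
      then have \<alpha>: "disk_seq \<alpha>" by (rule disk_seq_of_space[OF \<Gamma>])
      have T: "disk_seq (T_rot l (cis t) \<alpha>)" by (rule disk_seq_T_rot[OF u \<alpha>])
      note [measurable] = Res_circ_measurable[OF \<alpha> r] Res_circ_measurable[OF T r]
      have m1: "(\<lambda>\<theta>. ?A \<alpha> \<theta>) \<in> borel_measurable circ"
        unfolding Z_def kern_def f_def fst_conv snd_conv by measurable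
      have m2: "(\<lambda>\<theta>. ennreal (b * ?D \<alpha> \<theta>)) \<in> borel_measurable circ"
        unfolding Pdiag_def by measurable
      have "h (T_rot l (cis t) \<alpha>) \<le> (\<integral>\<^sup>+\<theta>. ?A \<alpha> \<theta> + ennreal (b * ?D \<alpha> \<theta>) \<partial>circ)"
        unfolding h_def
      proof (rule nn_integral_mono)
        fix \<theta>
        have P0: "0 \<le> ?D \<alpha> \<theta>" by (rule less_imp_le[OF Pdiag_pos[OF T circz]])
        have "cmod (Poff (T_rot l (cis t) \<alpha>) (polar r \<theta>) k l) \<le>
            a * (2 * Z (\<alpha>, \<theta>) * kern (\<alpha>, \<theta>) t) + b * ?D \<alpha> \<theta>"
          unfolding a_def b_def Z_def kern_def f_def fst_conv snd_conv
          by (rule Poff_T_rot_le[OF \<alpha> circz u kl s \<eta>])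
        then have "ennreal (cmod (Poff (T_rot l (cis t) \<alpha>) (polar r \<theta>) k l)) \<le>
            ennreal (a * (2 * Z (\<alpha>, \<theta>) * kern (\<alpha>, \<theta>) t) + b * ?D \<alpha> \<theta>)"
          by (rule ennreal_leI)
        also have "\<dots> = ?A \<alpha> \<theta> + ennreal (b * ?D \<alpha> \<theta>)"
          using ab Z0 kern0 P0 by (intro ennreal_plus mult_nonneg_nonneg) auto
        finally show "ennreal (cmod (Poff (T_rot l (cis t) \<alpha>) (polar r \<theta>) k l)) \<le> \<dots>" .
      qed
      also have "\<dots> = (\<integral>\<^sup>+\<theta>. ?A \<alpha> \<theta> \<partial>circ) + (\<integral>\<^sup>+\<theta>. ennreal (b * ?D \<alpha> \<theta>) \<partial>circ)"
        by (rule nn_integral_add[OF m1 m2])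
      also have "(\<integral>\<^sup>+\<theta>. ennreal (b * ?D \<alpha> \<theta>) \<partial>circ) = (\<integral>\<^sup>+\<theta>. ennreal b * ennreal (?D \<alpha> \<theta>) \<partial>circ)"
        using ab by (simp add: ennreal_mult')
      also have "\<dots> = ennreal b * (\<integral>\<^sup>+\<theta>. ennreal (?D \<alpha> \<theta>) \<partial>circ)"
        unfolding Pdiag_def by (rule nn_integral_cmult) measurable
      also have "\<dots> = ennreal b" unfolding Pdiag_average[OF T r] by simp
      finally show "h (T_rot l (cis t) \<alpha>) \<le> (\<integral>\<^sup>+\<theta>. ?A \<alpha> \<theta> \<partial>circ) + ennreal b" .
    qed
    also have "\<dots> = (\<integral>\<^sup>+\<alpha>. \<integral>\<^sup>+\<theta>. ?A \<alpha> \<theta> \<partial>circ \<partial>\<Gamma>) + (\<integral>\<^sup>+\<alpha>. ennreal b \<partial>\<Gamma>)"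
      by (rule nn_integral_add) measurable
    also have "(\<integral>\<^sup>+\<alpha>. ennreal b \<partial>\<Gamma>) = ennreal b" by (simp add: emeasure_space_1)
    also have "(\<integral>\<^sup>+\<alpha>. \<integral>\<^sup>+\<theta>. ?A \<alpha> \<theta> \<partial>circ \<partial>\<Gamma>) = I t"
      unfolding I_def by (rule circ.nn_integral_fst) measurable
    finally have "(\<integral>\<^sup>+\<alpha>. h (T_rot l (cis t) \<alpha>) \<partial>\<Gamma>) \<le> I t + ennreal b" .
    then have "ennreal K * (\<integral>\<^sup>+\<alpha>. h (T_rot l (cis t) \<alpha>) \<partial>\<Gamma>) \<le> ennreal K * (I t + ennreal b)"
      by (rule mult_left_mono) simp
    with K(2)[OF u \<open>h \<in> borel_measurable \<Gamma>\<close>] show ?thesis by (rule order_trans)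
  qed
  have avg: "(\<integral>\<^sup>+\<alpha>. h \<alpha> \<partial>\<Gamma>) \<le> ennreal K * ((\<integral>\<^sup>+t. I t \<partial>circ) + ennreal b)"
  proof -
    have "(\<integral>\<^sup>+\<alpha>. h \<alpha> \<partial>\<Gamma>) = (\<integral>\<^sup>+t. (\<integral>\<^sup>+\<alpha>. h \<alpha> \<partial>\<Gamma>) \<partial>circ)" using circ.emeasure_space_1 by simp
    also have "\<dots> \<le> (\<integral>\<^sup>+t. ennreal K * (I t + ennreal b) \<partial>circ)" by (intro nn_integral_mono le)
    also have "\<dots> = ennreal K * ((\<integral>\<^sup>+t. I t \<partial>circ) + ennreal b)"
      using circ.emeasure_space_1 by (simp add: nn_integral_cmult nn_integral_add)
    finally show ?thesis .
  qed
  have "(\<integral>\<^sup>+t. I t \<partial>circ) = (\<integral>\<^sup>+x. \<integral>\<^sup>+t. ennreal (a * (2 * Z x * kern x t)) \<partial>circ \<partial>(\<Gamma> \<Otimes>\<^sub>M circ))"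
    unfolding I_def by (rule Gcc.Fubini') measurable
  also have "\<dots> \<le> (\<integral>\<^sup>+x. ennreal (a * 2 / cos (s * pi / 2)) * ennreal (Z x) \<partial>(\<Gamma> \<Otimes>\<^sub>M circ))"
  proof (rule nn_integral_mono)
    fix x assume "x \<in> space (\<Gamma> \<Otimes>\<^sub>M circ)"
    then have \<alpha>: "disk_seq (fst x)" using disk_seq_of_space[OF \<Gamma>] by (auto simp: space_pair_measure)
    have fx: "cmod (f x) < 1" unfolding f_def by (rule Res_diag_bounds(2)[OF \<alpha> circz])
    have "(\<integral>\<^sup>+t. ennreal (a * (2 * Z x * kern x t)) \<partial>circ) = (\<integral>\<^sup>+t. ennreal (a * 2 * Z x) * ennreal (kern x t) \<partial>circ)"
      using ab Z0 kern0 by (simp add: mult_ac flip: ennreal_mult)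
    also have "\<dots> = ennreal (a * 2 * Z x) * (\<integral>\<^sup>+t. ennreal (kern x t) \<partial>circ)"
      unfolding kern_def by (rule nn_integral_cmult) measurable
    also have "\<dots> \<le> ennreal (a * 2 * Z x) * ennreal (1 / cos (s * pi / 2))"
      unfolding kern_def by (intro mult_left_mono kernel_average fx s) simp
    also have "\<dots> = ennreal (a * 2 / cos (s * pi / 2)) * ennreal (Z x)"
      using ab Z0[of x] cos_half_pi_pos[OF s] by (simp add: mult_ac flip: ennreal_mult)
    finally show "(\<integral>\<^sup>+t. ennreal (a * (2 * Z x * kern x t)) \<partial>circ) \<le> \<dots>" .
  qed
  also have "\<dots> = ennreal (a * 2 / cos (s * pi / 2)) * (\<integral>\<^sup>+x. ennreal (Z x) \<partial>(\<Gamma> \<Otimes>\<^sub>M circ))"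
    by (rule nn_integral_cmult) measurable
  also have "(\<integral>\<^sup>+x. ennreal (Z x) \<partial>(\<Gamma> \<Otimes>\<^sub>M circ)) = (\<integral>\<^sup>+\<alpha>. \<integral>\<^sup>+\<theta>. ennreal (Z (\<alpha>, \<theta>)) \<partial>circ \<partial>\<Gamma>)"
    by (rule circ.nn_integral_fst[symmetric]) measurable
  finally have "(\<integral>\<^sup>+t. I t \<partial>circ) \<le> ennreal (a * 2 / cos (s * pi / 2)) * (\<integral>\<^sup>+\<alpha>. \<integral>\<^sup>+\<theta>. ennreal (Z (\<alpha>, \<theta>)) \<partial>circ \<partial>\<Gamma>)" .
  then have "ennreal K * ((\<integral>\<^sup>+t. I t \<partial>circ) + ennreal b) \<le>
      ennreal K * (ennreal (a * 2 / cos (s * pi / 2)) * (\<integral>\<^sup>+\<alpha>. \<integral>\<^sup>+\<theta>. ennreal (Z (\<alpha>, \<theta>)) \<partial>circ \<partial>\<Gamma>) + ennreal b)"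
    by (intro mult_left_mono add_right_mono) auto
  with avg show ?thesis
    unfolding h_def a_def b_def Z_def fst_conv snd_conv by (rule order_trans)
qed

text \<open>
  Large values are paid for by a higher moment; this yields uniform integrability.
\<close>

lemma powr_truncate:
  fixes x M p q :: real
  assumes "0 \<le> x" "0 < M" "0 < p" "p < q"
  shows "x powr p \<le> min x M powr p + M powr (p - q) * x powr q"
proof (cases "x \<le> M")
  case False
  then have x: "0 < x" "M \<le> x" using assms by auto
  have "x powr p = x powr (p - q) * x powr q" using x by (simp flip: powr_add)
  also have "\<dots> \<le> M powr (p - q) * x powr q"
    using x assms by (intro mult_right_mono powr_mono2') auto
  finally show ?thesis using powr_ge_zero[of "min x M" p] by linarith
qed auto

text \<open>
  The truncated moments pass to the limit by the reverse Fatou lemma, with the almost sure limit bounded by the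
  boundary value; the truncation error is uniformly small by the bound on moments of order \<open>q > p\<close>.
\<close>

lemma carF_moments_inside:
  assumes "prob_space \<Gamma>" and \<Gamma>: "sets \<Gamma> = sets Verb_space" and kl: "k \<noteq> l" and p: "0 < p" "p < 1"
    and H: "0 \<le> H" and \<epsilon>: "0 < \<epsilon>"
    and hyp: "(\<integral>\<^sup>+\<alpha>. (\<integral>\<^sup>+t\<in>{0..2*pi}. ennreal (cmod (carF_bdry \<alpha> k l t) powr p / (2*pi)) \<partial>lborel) \<partial>\<Gamma>) \<le> ennreal H"
  shows "\<forall>\<^sub>F n in sequentially.
    (\<integral>\<^sup>+\<alpha>. Res_moment p \<alpha> (1 - 1 / real (n + 2)) k l \<partial>\<Gamma>) \<le> ennreal (H + \<epsilon>)"
proof -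
  interpret prob_space \<Gamma> by fact
  interpret Gc: pair_prob_space \<Gamma> circ by unfold_locales
  note [measurable] = Res_measurable[OF \<Gamma>]
  define \<rho> where "\<rho> n = 1 - 1 / real (n + 2)" for n :: nat
  have \<rho>: "0 < \<rho> n" "\<rho> n < 1" for n unfolding \<rho>_def by (rule radius_seq)+
  define q where "q = (1 + p) / 2"
  have q: "0 < q" "q < 1" "p < q" using p by (auto simp: q_def)
  define C where "C = 8 / cos (q * pi / 2)"
  have C: "0 < C" unfolding C_def using cos_half_pi_pos[OF q(1,2)] by simp
  \<comment> \<open>The level at which the truncation error is exactly \<open>\<epsilon> / 2\<close>.\<close>
  define M where "M = (\<epsilon> / (2 * C)) powr (1 / (p - q))"
  have M: "0 < M" using \<epsilon> C by (simp add: M_def)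
  have MC: "M powr (p - q) * C = \<epsilon> / 2" using \<epsilon> C q by (simp add: M_def powr_powr)
  define F where "F n x = cmod (2 * Res (fst x) (of_real (\<rho> n) * cis (snd x)) k l)" for n and x :: "(nat \<Rightarrow> complex) \<times> real"
  have [measurable]: "F n \<in> borel_measurable (\<Gamma> \<Otimes>\<^sub>M circ)" for n unfolding F_def by measurable
  define u where "u n x = ennreal (min (F n x) M powr p)" for n x
  have [measurable]: "u n \<in> borel_measurable (\<Gamma> \<Otimes>\<^sub>M circ)" for n unfolding u_def by measurable
  have F0: "0 \<le> F n x" for n x by (simp add: F_def)
  \<comment> \<open>The upper limit is measurable, whereas \<open>carF_bdry\<close> is only known to agree with a measurable function almost everywhere.\<close>
  define L where "L x = limsup (\<lambda>n. u n x)" for x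
  have [measurable]: "L \<in> borel_measurable (\<Gamma> \<Otimes>\<^sub>M circ)" unfolding L_def by measurable
  have "limsup (\<lambda>n. \<integral>\<^sup>+x. u n x \<partial>(\<Gamma> \<Otimes>\<^sub>M circ)) \<le> (\<integral>\<^sup>+x. L x \<partial>(\<Gamma> \<Otimes>\<^sub>M circ))"
    unfolding L_def
  proof (rule nn_integral_limsup[where w = "\<lambda>_. ennreal (M powr p)"])
    show "AE x in \<Gamma> \<Otimes>\<^sub>M circ. u n x \<le> ennreal (M powr p)" for n
      unfolding u_def using F0 M p by (intro AE_I2 ennreal_leI powr_mono2) auto
    show "(\<integral>\<^sup>+x. ennreal (M powr p) \<partial>(\<Gamma> \<Otimes>\<^sub>M circ)) < \<infinity>" by (simp add: Gc.emeasure_space_1)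
  qed measurable
  also have "\<dots> = (\<integral>\<^sup>+\<alpha>. \<integral>\<^sup>+t. L (\<alpha>, t) \<partial>circ \<partial>\<Gamma>)" by (rule circ.nn_integral_fst[symmetric]) measurable
  also have "\<dots> \<le> (\<integral>\<^sup>+\<alpha>. (\<integral>\<^sup>+t\<in>{0..2*pi}. ennreal (cmod (carF_bdry \<alpha> k l t) powr p / (2*pi)) \<partial>lborel) \<partial>\<Gamma>)"
  proof (rule nn_integral_mono)
    fix \<alpha> assume \<alpha>G: "\<alpha> \<in> space \<Gamma>"
    then have \<alpha>: "disk_seq \<alpha>" by (rule disk_seq_of_space[OF \<Gamma>])
    have "AE t in circ. L (\<alpha>, t) \<le> ennreal (cmod (carF_bdry \<alpha> k l t) powr p)"
      using carF_boundary[OF \<alpha> kl]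
    proof eventually_elim
      fix t assume "((\<lambda>r. 2 * Res \<alpha> (polar r t) k l) \<longlongrightarrow> carF_bdry \<alpha> k l t) (at_left 1)"
      then have "(\<lambda>n. 2 * Res \<alpha> (of_real (\<rho> n) * cis t) k l) \<longlonglongrightarrow> carF_bdry \<alpha> k l t"
        unfolding \<rho>_def by (rule filterlim_compose[OF _ radius_seq(2)])
      then have lim: "(\<lambda>n. ennreal (F n (\<alpha>, t) powr p)) \<longlonglongrightarrow> ennreal (cmod (carF_bdry \<alpha> k l t) powr p)"
        unfolding F_def fst_conv snd_conv using p by (intro tendsto_ennrealI tendsto_powr' tendsto_norm tendsto_const) auto
      have "L (\<alpha>, t) \<le> limsup (\<lambda>n. ennreal (F n (\<alpha>, t) powr p))"
        unfolding L_def u_def using F0 M p by (intro Limsup_mono always_eventually allI ennreal_leI powr_mono2) auto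
      also have "\<dots> = ennreal (cmod (carF_bdry \<alpha> k l t) powr p)"
        using lim by (intro lim_imp_Limsup) auto
      finally show "L (\<alpha>, t) \<le> ennreal (cmod (carF_bdry \<alpha> k l t) powr p)" .
    qed
    then have ae: "AE t in lborel. t \<in> {0..2*pi} \<longrightarrow> L (\<alpha>, t) \<le> ennreal (cmod (carF_bdry \<alpha> k l t) powr p)"
      by (simp only: AE_circ_iff)
    have mL: "(\<lambda>t. L (\<alpha>, t)) \<in> borel_measurable borel"
    proof -
      have "(\<lambda>t. L (\<alpha>, t)) \<in> borel_measurable circ"
        by (rule measurable_compose[OF measurable_Pair1'[OF \<alpha>G]]) measurable
      then show ?thesis by simp
    qed
    have "(\<integral>\<^sup>+t. L (\<alpha>, t) \<partial>circ) = (\<integral>\<^sup>+t. L (\<alpha>, t) * indicator {0..2*pi} t / ennreal (2*pi) \<partial>lborel)"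
      unfolding nn_integral_circ[OF mL] by (rule nn_integral_divide[symmetric]) (use mL in measurable)
    also have "\<dots> \<le> (\<integral>\<^sup>+t\<in>{0..2*pi}. ennreal (cmod (carF_bdry \<alpha> k l t) powr p / (2*pi)) \<partial>lborel)"
    proof (rule nn_integral_mono_AE)
      show "AE t in lborel. L (\<alpha>, t) * indicator {0..2*pi} t / ennreal (2*pi) \<le>
          ennreal (cmod (carF_bdry \<alpha> k l t) powr p / (2*pi)) * indicator {0..2*pi} t"
        using ae
      proof eventually_elim
        fix t assume le: "t \<in> {0..2*pi} \<longrightarrow> L (\<alpha>, t) \<le> ennreal (cmod (carF_bdry \<alpha> k l t) powr p)"
        show "L (\<alpha>, t) * indicator {0..2*pi} t / ennreal (2*pi) \<le>
          ennreal (cmod (carF_bdry \<alpha> k l t) powr p / (2*pi)) * indicator {0..2*pi} t"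
        proof (cases "t \<in> {0..2*pi}")
          case True
          have "L (\<alpha>, t) / ennreal (2*pi) \<le> ennreal (cmod (carF_bdry \<alpha> k l t) powr p) / ennreal (2*pi)"
            using le True by (intro divide_right_mono_ennreal) auto
          also have "\<dots> = ennreal (cmod (carF_bdry \<alpha> k l t) powr p / (2*pi))"
            by (rule divide_ennreal) auto
          finally show ?thesis using True by simp
        qed simp
      qed
    qed
    finally show "(\<integral>\<^sup>+t. L (\<alpha>, t) \<partial>circ) \<le> (\<integral>\<^sup>+t\<in>{0..2*pi}. ennreal (cmod (carF_bdry \<alpha> k l t) powr p / (2*pi)) \<partial>lborel)" .
  qed
  also have "\<dots> \<le> ennreal H" by (rule hyp)
  also have "ennreal H < ennreal (H + \<epsilon> / 2)" using H \<epsilon> by (simp add: ennreal_less_iff)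
  finally have "\<forall>\<^sub>F n in sequentially. (\<integral>\<^sup>+x. u n x \<partial>(\<Gamma> \<Otimes>\<^sub>M circ)) < ennreal (H + \<epsilon> / 2)"
    by (rule Limsup_lessD)
  then show ?thesis
  proof (rule eventually_mono)
    fix n assume less: "(\<integral>\<^sup>+x. u n x \<partial>(\<Gamma> \<Otimes>\<^sub>M circ)) < ennreal (H + \<epsilon> / 2)"
    have "(\<integral>\<^sup>+x. ennreal (F n x powr p) \<partial>(\<Gamma> \<Otimes>\<^sub>M circ)) \<le> (\<integral>\<^sup>+x. u n x + ennreal (M powr (p - q)) * ennreal (F n x powr q) \<partial>(\<Gamma> \<Otimes>\<^sub>M circ))"
    proof (rule nn_integral_mono)
      fix x
      have "ennreal (F n x powr p) \<le> ennreal (min (F n x) M powr p + M powr (p - q) * F n x powr q)"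
        by (intro ennreal_leI powr_truncate F0 M p q)
      then show "ennreal (F n x powr p) \<le> u n x + ennreal (M powr (p - q)) * ennreal (F n x powr q)"
        unfolding u_def by (simp add: ennreal_mult ennreal_plus)
    qed
    also have "\<dots> = (\<integral>\<^sup>+x. u n x \<partial>(\<Gamma> \<Otimes>\<^sub>M circ)) + ennreal (M powr (p - q)) * (\<integral>\<^sup>+x. ennreal (F n x powr q) \<partial>(\<Gamma> \<Otimes>\<^sub>M circ))"
      by (simp add: nn_integral_add nn_integral_cmult)
    also have "\<dots> \<le> ennreal (H + \<epsilon> / 2) + ennreal (M powr (p - q)) * ennreal C"
    proof (intro add_mono mult_left_mono)
      have "(\<integral>\<^sup>+x. ennreal (F n x powr q) \<partial>(\<Gamma> \<Otimes>\<^sub>M circ)) = (\<integral>\<^sup>+\<alpha>. \<integral>\<^sup>+t. ennreal (F n (\<alpha>, t) powr q) \<partial>circ \<partial>\<Gamma>)"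
        by (rule circ.nn_integral_fst[symmetric]) measurable
      also have "\<dots> \<le> (\<integral>\<^sup>+\<alpha>. ennreal C \<partial>\<Gamma>)"
      proof (rule nn_integral_mono)
        fix \<alpha> assume "\<alpha> \<in> space \<Gamma>"
        then have \<alpha>: "disk_seq \<alpha>" by (rule disk_seq_of_space[OF \<Gamma>])
        show "(\<integral>\<^sup>+t. ennreal (F n (\<alpha>, t) powr q) \<partial>circ) \<le> ennreal C"
          unfolding F_def fst_conv snd_conv C_def by (rule Res_Lq_bound[OF \<alpha> kl q(1,2) \<rho>])
      qed
      finally show "(\<integral>\<^sup>+x. ennreal (F n x powr q) \<partial>(\<Gamma> \<Otimes>\<^sub>M circ)) \<le> ennreal C" by (simp add: emeasure_space_1)
    qed (use less in auto)
    also have "\<dots> = ennreal (H + \<epsilon> / 2 + \<epsilon> / 2)"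
      using C H \<epsilon> MC by (simp flip: ennreal_mult ennreal_plus)
    finally have "(\<integral>\<^sup>+x. ennreal (F n x powr p) \<partial>(\<Gamma> \<Otimes>\<^sub>M circ)) \<le> ennreal (H + \<epsilon>)" by (simp add: add.commute)
    moreover have "(\<integral>\<^sup>+x. ennreal (F n x powr p) \<partial>(\<Gamma> \<Otimes>\<^sub>M circ)) = (\<integral>\<^sup>+\<alpha>. \<integral>\<^sup>+t. ennreal (F n (\<alpha>, t) powr p) \<partial>circ \<partial>\<Gamma>)"
      by (rule circ.nn_integral_fst[symmetric]) measurable
    ultimately show "(\<integral>\<^sup>+\<alpha>. Res_moment p \<alpha> (1 - 1 / real (n + 2)) k l \<partial>\<Gamma>) \<le> ennreal (H + \<epsilon>)"
      unfolding F_def \<rho>_def fst_conv snd_conv by simp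
  qed
qed

lemma cmv_power_entry_le_1: "disk_seq \<alpha> \<Longrightarrow> cmod (cmv_power_entry \<alpha> n k l) \<le> 1"
  by (simp add: cmv_power_entry_eq inv_entry_le)

lemma cmv_power_entry_measurable:
  assumes \<Gamma>: "sets \<Gamma> = sets Verb_space"
  shows "(\<lambda>\<alpha>. cmv_power_entry \<alpha> n k l) \<in> borel_measurable \<Gamma>"
proof -
  note [measurable] = inv_entry_measurable[OF \<Gamma>]
  have "(\<lambda>\<alpha>. if n \<ge> 0 then cnj (inv_entry \<alpha> (nat n) l k) else inv_entry \<alpha> (nat (- n)) k l) \<in> borel_measurable \<Gamma>"
    by measurable
  then show ?thesis
    by (subst measurable_cong[OF cmv_power_entry_eq[OF disk_seq_of_space[OF \<Gamma>]]])
qed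

text \<open>
  For \<open>|n| \<le> N\<close> the factor lost in the Fourier bound is at most \<open>r\<^sup>-\<^sup>N\<close>, which tends to one with \<open>r\<close>. Only
  then does \<open>N\<close> tend to infinity.
\<close>

lemma expectation_sup_power_le:
  assumes "prob_space \<Gamma>" and \<Gamma>: "sets \<Gamma> = sets Verb_space" and kl: "k \<noteq> l" and G: "0 \<le> G"
    and le: "\<forall>\<^sub>F n in sequentially.
      (\<integral>\<^sup>+\<alpha>. Poff_mean \<alpha> (1 - 1 / real (n + 2)) k l \<partial>\<Gamma>) \<le> ennreal G"
  shows "(\<integral>\<^sup>+\<alpha>. (SUP n::int. ennreal (cmod (cmv_power_entry \<alpha> n k l))) \<partial>\<Gamma>) \<le> ennreal G"
proof -
  interpret prob_space \<Gamma> by fact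
  note [measurable] = Res_measurable[OF \<Gamma>] cmv_power_entry_measurable[OF \<Gamma>]
  define S where "S N \<alpha> = (SUP n\<in>{- int N..int N}. ennreal (cmod (cmv_power_entry \<alpha> n k l)))" for N \<alpha>
  have [measurable]: "S N \<in> borel_measurable \<Gamma>" for N
    unfolding S_def by measurable
  have S_le: "(\<integral>\<^sup>+\<alpha>. S N \<alpha> \<partial>\<Gamma>) \<le> ennreal G" for N
  proof (rule tendsto_lowerbound)
    have "(\<lambda>n. ennreal (G / (1 - 1 / real (n + 2)) ^ N)) \<longlonglongrightarrow> ennreal (G / 1 ^ N)"
      by (intro tendsto_ennrealI tendsto_divide tendsto_power tendsto_const radius_seq(1)) simp
    then show "(\<lambda>n. ennreal (G / (1 - 1 / real (n + 2)) ^ N)) \<longlonglongrightarrow> ennreal G" by simp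
    show "\<forall>\<^sub>F n in sequentially. (\<integral>\<^sup>+\<alpha>. S N \<alpha> \<partial>\<Gamma>) \<le> ennreal (G / (1 - 1 / real (n + 2)) ^ N)"
      using le
    proof (rule eventually_mono)
      fix n :: nat
      define r where "r = 1 - 1 / real (n + 2)"
      have r: "0 < r" "r < 1" unfolding r_def by (rule radius_seq)+
      assume "(\<integral>\<^sup>+\<alpha>. Poff_mean \<alpha> (1 - 1 / real (n + 2)) k l \<partial>\<Gamma>) \<le> ennreal G"
      then have A: "(\<integral>\<^sup>+\<alpha>. Poff_mean \<alpha> r k l \<partial>\<Gamma>) \<le> ennreal G"
        unfolding r_def .
      have "(\<lambda>x. Poff (fst x) (of_real r * cis (snd x)) k l) \<in> borel_measurable (\<Gamma> \<Otimes>\<^sub>M circ)"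
        unfolding Poff_def by measurable
      then have mh: "(\<lambda>\<alpha>. Poff_mean \<alpha> r k l) \<in> borel_measurable \<Gamma>"
        by (intro circ.borel_measurable_nn_integral) (simp add: case_prod_beta')
      have "(\<integral>\<^sup>+\<alpha>. S N \<alpha> \<partial>\<Gamma>) \<le> (\<integral>\<^sup>+\<alpha>. ennreal (1 / r ^ N) * Poff_mean \<alpha> r k l \<partial>\<Gamma>)"
      proof (rule nn_integral_mono)
        fix \<alpha> assume "\<alpha> \<in> space \<Gamma>"
        then have \<alpha>: "disk_seq \<alpha>" by (rule disk_seq_of_space[OF \<Gamma>])
        show "S N \<alpha> \<le> ennreal (1 / r ^ N) * Poff_mean \<alpha> r k l"
          unfolding S_def
        proof (rule SUP_least)
          fix j assume "j \<in> {- int N..int N}"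
          then have jN: "nat \<bar>j\<bar> \<le> N" by auto
          have "r ^ N \<le> r ^ nat \<bar>j\<bar>" using r jN by (intro power_decreasing) auto
          then have "cmod (cmv_power_entry \<alpha> j k l) \<le> 1 / r ^ N * (r ^ nat \<bar>j\<bar> * cmod (cmv_power_entry \<alpha> j k l))"
            using r mult_right_mono[of "r ^ N" "r ^ nat \<bar>j\<bar>" "cmod (cmv_power_entry \<alpha> j k l)"]
            by (simp add: pos_le_divide_eq mult.commute)
          then have "ennreal (cmod (cmv_power_entry \<alpha> j k l)) \<le> ennreal (1 / r ^ N * (r ^ nat \<bar>j\<bar> * cmod (cmv_power_entry \<alpha> j k l)))"
            by (rule ennreal_leI)
          also have "\<dots> = ennreal (1 / r ^ N) * ennreal (r ^ nat \<bar>j\<bar> * cmod (cmv_power_entry \<alpha> j k l))"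
            using r by (intro ennreal_mult) auto
          also have "\<dots> \<le> ennreal (1 / r ^ N) * Poff_mean \<alpha> r k l"
            by (intro mult_left_mono cmv_power_fourier_bound \<alpha> r kl) simp
          finally show "ennreal (cmod (cmv_power_entry \<alpha> j k l)) \<le> \<dots>" .
        qed
      qed
      also have "\<dots> = ennreal (1 / r ^ N) * (\<integral>\<^sup>+\<alpha>. Poff_mean \<alpha> r k l \<partial>\<Gamma>)"
        by (rule nn_integral_cmult[OF mh])
      also have "\<dots> \<le> ennreal (1 / r ^ N) * ennreal G" by (intro mult_left_mono A) simp
      also have "\<dots> = ennreal (G / r ^ N)" using r G by (simp flip: ennreal_mult)
      finally show "(\<integral>\<^sup>+\<alpha>. S N \<alpha> \<partial>\<Gamma>) \<le> ennreal (G / (1 - 1 / real (n + 2)) ^ N)" unfolding r_def .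
    qed
  qed simp
  have sup: "(SUP n::int. ennreal (cmod (cmv_power_entry \<alpha> n k l))) = (SUP N. S N \<alpha>)" for \<alpha>
  proof (rule antisym)
    show "(SUP n::int. ennreal (cmod (cmv_power_entry \<alpha> n k l))) \<le> (SUP N. S N \<alpha>)"
    proof (rule SUP_least)
      fix n :: int
      have "ennreal (cmod (cmv_power_entry \<alpha> n k l)) \<le> S (nat \<bar>n\<bar>) \<alpha>"
        unfolding S_def by (rule SUP_upper) auto
      also have "\<dots> \<le> (SUP N. S N \<alpha>)" by (rule SUP_upper) simp
      finally show "ennreal (cmod (cmv_power_entry \<alpha> n k l)) \<le> (SUP N. S N \<alpha>)" .
    qed
    show "(SUP N. S N \<alpha>) \<le> (SUP n::int. ennreal (cmod (cmv_power_entry \<alpha> n k l)))"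
      unfolding S_def by (intro SUP_least SUP_upper) simp
  qed
  have "(\<integral>\<^sup>+\<alpha>. (SUP n::int. ennreal (cmod (cmv_power_entry \<alpha> n k l))) \<partial>\<Gamma>) = (SUP N. \<integral>\<^sup>+\<alpha>. S N \<alpha> \<partial>\<Gamma>)"
    unfolding sup
    by (rule nn_integral_monotone_convergence_SUP)
       (auto simp: incseq_def le_fun_def S_def intro!: SUP_subset_mono)
  also have "\<dots> \<le> ennreal G" by (intro SUP_least S_le)
  finally show ?thesis .
qed

section \<open>Exponential decay of the powers\<close>

theorem theorem1p1:
  fixes \<Gamma> :: "(nat \<Rightarrow> complex) measure" and p \<kappa>1 C1 :: real
  assumes "prob_space \<Gamma>" and "sets \<Gamma> = sets Verb_space"
    and "strongly_quasi_invariant \<Gamma>"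
    and "0 < p" and "p < 1" and "0 < \<kappa>1"
    and "\<And>k l :: nat.
      (\<integral>\<^sup>+\<alpha>. (\<integral>\<^sup>+t\<in>{0..2*pi}. ennreal (cmod (carF_bdry \<alpha> k l t) powr p / (2*pi)) \<partial>lborel) \<partial>\<Gamma>)
        \<le> ennreal (C1 * exp (- \<kappa>1 * \<bar>real k - real l\<bar>))"
  shows "\<exists>\<kappa>2>0. \<exists>C2::real. \<forall>k l :: nat.
      (\<integral>\<^sup>+\<alpha>. (SUP n::int. ennreal (cmod (cmv_power_entry \<alpha> n k l))) \<partial>\<Gamma>)
        \<le> ennreal (C2 * exp (- \<kappa>2 * \<bar>real k - real l\<bar>))"
proof -
  interpret prob_space \<Gamma> by fact
  note \<Gamma> = assms(2) and p = assms(4,5)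
  obtain K :: real where K: "0 \<le> K"
    "\<And>n u h. cmod u = 1 \<Longrightarrow> h \<in> borel_measurable \<Gamma> \<Longrightarrow>
       (\<integral>\<^sup>+\<alpha>. h \<alpha> \<partial>\<Gamma>) \<le> ennreal K * (\<integral>\<^sup>+\<alpha>. h (T_rot n u \<alpha>) \<partial>\<Gamma>)"
    using quasi_invariance_bound[OF assms(1-3)] by blast
  define B where "B = max C1 0 + 1"
  have B: "0 < B" by (simp add: B_def)
  define c where "c = cos (p * pi / 2)"
  have c: "0 < c" unfolding c_def by (rule cos_half_pi_pos[OF p])
  define \<kappa>2 where "\<kappa>2 = \<kappa>1 / (2 - p)"
  have \<kappa>2: "0 < \<kappa>2" using assms(6) p by (simp add: \<kappa>2_def)
  define C2 where "C2 = K * (4 * B / c + 1) + 1"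
  have C2: "1 \<le> C2" using K B c by (simp add: C2_def)
  have "(\<integral>\<^sup>+\<alpha>. (SUP n::int. ennreal (cmod (cmv_power_entry \<alpha> n k l))) \<partial>\<Gamma>)
        \<le> ennreal (C2 * exp (- \<kappa>2 * \<bar>real k - real l\<bar>))" for k l
  proof (cases "k = l")
    case True
    have "(\<integral>\<^sup>+\<alpha>. (SUP n::int. ennreal (cmod (cmv_power_entry \<alpha> n k l))) \<partial>\<Gamma>) \<le> (\<integral>\<^sup>+\<alpha>. 1 \<partial>\<Gamma>)"
      by (intro nn_integral_mono SUP_least) (use cmv_power_entry_le_1 disk_seq_of_space[OF \<Gamma>] in auto)
    also have "\<dots> = ennreal 1" by (simp add: emeasure_space_1)
    also have "\<dots> \<le> ennreal (C2 * exp (- \<kappa>2 * \<bar>real k - real l\<bar>))"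
      using True C2 by (intro ennreal_leI) simp
    finally show ?thesis .
  next
    case kl: False
    \<comment> \<open>The same exponential as in the hypothesis: both terms of the interpolated bound are then of the size \<open>\<eta>\<close> to the power \<open>1 / (2 - p)\<close>.\<close>
    define \<eta> where "\<eta> = exp (- \<kappa>1 * \<bar>real k - real l\<bar>)"
    have \<eta>: "0 < \<eta>" by (simp add: \<eta>_def)
    define A where "A n k l = (\<integral>\<^sup>+\<alpha>. Res_moment p \<alpha> (1 - 1 / real (n + 2)) k l \<partial>\<Gamma>)" for n k l
    have mom: "\<forall>\<^sub>F n in sequentially. A n k' l' \<le> ennreal (B * \<eta>)" if "k' \<noteq> l'" "\<bar>real k' - real l'\<bar> = \<bar>real k - real l\<bar>" for k' l'
    proof -
      have "(\<integral>\<^sup>+\<alpha>. (\<integral>\<^sup>+t\<in>{0..2*pi}. ennreal (cmod (carF_bdry \<alpha> k' l' t) powr p / (2*pi)) \<partial>lborel) \<partial>\<Gamma>) \<le> ennreal (C1 * \<eta>)"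
        using assms(7)[of k' l'] unfolding that(2) \<eta>_def .
      also have "\<dots> \<le> ennreal (max C1 0 * \<eta>)" using \<eta> by (intro ennreal_leI mult_right_mono) auto
      finally have "\<forall>\<^sub>F n in sequentially. A n k' l' \<le> ennreal (max C1 0 * \<eta> + \<eta>)"
        unfolding A_def by (intro carF_moments_inside[OF assms(1) \<Gamma> that(1) p _ \<eta>]) (use \<eta> in auto)
      then show ?thesis by (simp add: B_def algebra_simps)
    qed
    define G where "G = K * (4 * B / c + 1) * exp (- \<kappa>2 * \<bar>real k - real l\<bar>)"
    have G0: "0 \<le> G" using K B c by (simp add: G_def)
    have \<eta>b: "\<eta> powr (1 / (2 - p)) = exp (- \<kappa>2 * \<bar>real k - real l\<bar>)"
      by (simp add: \<eta>_def \<kappa>2_def powr_def)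
    have \<eta>a: "\<eta> powr ((p - 1) / (2 - p)) * \<eta> = \<eta> powr (1 / (2 - p))"
    proof -
      have "1 / (2 - p) = (p - 1) / (2 - p) + 1" using p by (simp add: field_simps)
      then show ?thesis using \<eta> by (simp only: powr_add powr_one)
    qed
    have "\<forall>\<^sub>F n in sequentially.
      (\<integral>\<^sup>+\<alpha>. Poff_mean \<alpha> (1 - 1 / real (n + 2)) k l \<partial>\<Gamma>) \<le> ennreal G"
      using eventually_conj[OF mom[OF kl refl] mom[OF kl[symmetric] abs_minus_commute]]
    proof (rule eventually_mono)
      fix n :: nat
      define r where "r = 1 - 1 / real (n + 2)"
      have r: "0 < r" "r < 1" unfolding r_def by (rule radius_seq)+
      assume A: "A n k l \<le> ennreal (B * \<eta>) \<and> A n l k \<le> ennreal (B * \<eta>)"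
      let ?Z = "\<lambda>\<alpha> t. ennreal (cmod (Res \<alpha> (polar r t) k l) powr p + cmod (Res \<alpha> (polar r t) l k) powr p)"
      note [measurable] = Res_measurable[OF \<Gamma>]
      have mA: "(\<lambda>\<alpha>. Res_moment p \<alpha> r k' l') \<in> borel_measurable \<Gamma>" for k' l'
      proof -
        have "(\<lambda>x. 2 * Res (fst x) (of_real r * cis (snd x)) k' l') \<in> borel_measurable (\<Gamma> \<Otimes>\<^sub>M circ)" by measurable
        then show ?thesis by (intro circ.borel_measurable_nn_integral) (simp add: case_prod_beta')
      qed
      have "(\<integral>\<^sup>+\<alpha>. \<integral>\<^sup>+t. ?Z \<alpha> t \<partial>circ \<partial>\<Gamma>)
         \<le> (\<integral>\<^sup>+\<alpha>. Res_moment p \<alpha> r k l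
               + Res_moment p \<alpha> r l k \<partial>\<Gamma>)"
      proof (rule nn_integral_mono)
        fix \<alpha> assume "\<alpha> \<in> space \<Gamma>"
        then have \<alpha>: "disk_seq \<alpha>" by (rule disk_seq_of_space[OF \<Gamma>])
        note [measurable] = Res_circ_measurable[OF \<alpha> r]
        have dbl: "cmod x powr p \<le> cmod (2 * x) powr p" for x using p by (intro powr_mono2) (auto simp: norm_mult)
        have "(\<integral>\<^sup>+t. ?Z \<alpha> t \<partial>circ)
          \<le> (\<integral>\<^sup>+t. ennreal (cmod (2 * Res \<alpha> (polar r t) k l) powr p) + ennreal (cmod (2 * Res \<alpha> (polar r t) l k) powr p) \<partial>circ)"
        proof (rule nn_integral_mono)
          fix t
          have "?Z \<alpha> t
             = ennreal (cmod (Res \<alpha> (polar r t) k l) powr p) + ennreal (cmod (Res \<alpha> (polar r t) l k) powr p)"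
            by (rule ennreal_plus) auto
          also have "\<dots> \<le> ennreal (cmod (2 * Res \<alpha> (polar r t) k l) powr p) + ennreal (cmod (2 * Res \<alpha> (polar r t) l k) powr p)"
            by (intro add_mono ennreal_leI dbl)
          finally show "?Z \<alpha> t \<le> \<dots>" .
        qed
        also have "\<dots> = Res_moment p \<alpha> r k l
               + Res_moment p \<alpha> r l k"
          by (rule nn_integral_add) measurable
        finally show "(\<integral>\<^sup>+t. ?Z \<alpha> t \<partial>circ) \<le> \<dots>" .
      qed
      also have "\<dots> = A n k l + A n l k"
        unfolding A_def r_def[symmetric] by (rule nn_integral_add[OF mA mA])
      also have "\<dots> \<le> ennreal (B * \<eta>) + ennreal (B * \<eta>)" using A by (intro add_mono) auto
      also have "\<dots> = ennreal (2 * B * \<eta>)" using B \<eta> by (simp flip: ennreal_plus)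
      finally have Z: "(\<integral>\<^sup>+\<alpha>. \<integral>\<^sup>+t. ?Z \<alpha> t \<partial>circ \<partial>\<Gamma>)
         \<le> ennreal (2 * B * \<eta>)" .
      have "(\<integral>\<^sup>+\<alpha>. Poff_mean \<alpha> r k l \<partial>\<Gamma>) \<le>
        ennreal K * (ennreal (\<eta> powr ((p - 1) / (2 - p)) * 2 / cos (p * pi / 2)) *
        (\<integral>\<^sup>+\<alpha>. \<integral>\<^sup>+t. ?Z \<alpha> t \<partial>circ \<partial>\<Gamma>)
        + ennreal (\<eta> powr (1 / (2 - p))))"
        by (rule expectation_Poff_le[OF assms(1) \<Gamma> K kl r p \<eta>])
      also have "\<dots> \<le> ennreal K * (ennreal (\<eta> powr ((p - 1) / (2 - p)) * 2 / c) * ennreal (2 * B * \<eta>) + ennreal (\<eta> powr (1 / (2 - p))))"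
        unfolding c_def by (intro mult_left_mono add_right_mono Z) auto
      also have "\<dots> = ennreal (K * (\<eta> powr ((p - 1) / (2 - p)) * 2 / c * (2 * B * \<eta>) + \<eta> powr (1 / (2 - p))))"
        using K B c \<eta> by (simp flip: ennreal_mult ennreal_plus)
      also have "K * (\<eta> powr ((p - 1) / (2 - p)) * 2 / c * (2 * B * \<eta>) + \<eta> powr (1 / (2 - p)))
          = K * ((\<eta> powr ((p - 1) / (2 - p)) * \<eta>) * (4 * B / c) + \<eta> powr (1 / (2 - p)))" by (simp add: mult_ac)
      also have "\<dots> = G" unfolding \<eta>a \<eta>b G_def by (simp add: algebra_simps)
      finally show "(\<integral>\<^sup>+\<alpha>. Poff_mean \<alpha> (1 - 1 / real (n + 2)) k l \<partial>\<Gamma>) \<le> ennreal G"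
        unfolding r_def .
    qed
    then have "(\<integral>\<^sup>+\<alpha>. (SUP n::int. ennreal (cmod (cmv_power_entry \<alpha> n k l))) \<partial>\<Gamma>) \<le> ennreal G"
      by (rule expectation_sup_power_le[OF assms(1) \<Gamma> kl G0])
    also have "\<dots> \<le> ennreal (C2 * exp (- \<kappa>2 * \<bar>real k - real l\<bar>))"
      unfolding G_def C2_def by (intro ennreal_leI mult_right_mono) auto
    finally show ?thesis .
  qed
  then show ?thesis using \<kappa>2 by blast
qed

end
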